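(* Let $P\in\mathbb{R}[x_1,y_1,x_2,y_2]$ be an irreducible polynomial of degree at most $D$. Then there exists a variety $Y\subset\mathbb{C}^4$ of dimension at most two and degree bounded by a constant depending only on $D$, such that for every point $p\in \mathbf{Z}_{\mathbb{R}}(P)\setminus Y(\mathbb{R})$ there is at most one irreducible complex algebraic curve $\gamma\subset\mathbb{C}^2$ with $p\in\iota(\gamma)_{\mathrm{reg}}$ and $\iota(\gamma)\subset \mathbf{Z}_{\mathbb{R}}(P)$.
   Context: $\iota:\mathbb{C}^2\to\mathbb{R}^4$ is the identification $\iota(x_1+iy_1,x_2+iy_2)=(x_1,y_1,x_2,y_2)$ with $x_1,y_1,x_2,y_2\in\mathbb{R}$. $\mathbf{Z}_{\mathbb{R}}(P)\subset\mathbb{R}^4$ is the real zero set of $P$. For a complex variety $Y\subset\mathbb{C}^4$, $Y(\mathbb{R})=Y\cap\mathbb{R}^4$ is its set of real points. Varieties are (possibly reducible) Zariski closed sets; the degree of a reducible variety is the sum of the degrees of its irreducible components. For a complex curve $\gamma$, $\iota(\gamma)_{\mathrm{reg}}$ denotes the set of regular (nonsingular) points of the real variety $\iota(\gamma)$, which equals $\iota(\gamma_{\mathrm{reg}})$, the image of the nonsingular points of $\gamma$. *)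

theory Defs
  imports Complex_Main "HOL-Library.Poly_Mapping" "HOL-Library.Extended_Nat"
    "HOL-Computational_Algebra.Factorial_Ring"
begin

text \<open>Multivariate polynomials over a ring 'a in variables indexed by nat:
  monomials are finitely supported exponent vectors nat =>0 nat.
  The ring structure (and hence irreducible) comes from HOL-Library.Poly_Mapping.\<close>

type_synonym 'a mpoly = "(nat \<Rightarrow>\<^sub>0 nat) \<Rightarrow>\<^sub>0 'a"

definition vars :: "'a::zero mpoly \<Rightarrow> nat set" where
  "vars p = {i. \<exists>m\<in>Poly_Mapping.keys p. i \<in> Poly_Mapping.keys m}"

definition tdeg :: "'a::zero mpoly \<Rightarrow> nat" where
  "tdeg p = Max (insert 0 ((\<lambda>m. sum (Poly_Mapping.lookup m) (Poly_Mapping.keys m)) ` Poly_Mapping.keys p))"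

definition aff :: "nat \<Rightarrow> (nat \<Rightarrow> 'a::zero) set" where
  "aff n = {x. \<forall>i\<ge>n. x i = 0}"

definition peval :: "'a::comm_semiring_1 mpoly \<Rightarrow> (nat \<Rightarrow> 'a) \<Rightarrow> 'a" where
  "peval p x = (\<Sum>m\<in>Poly_Mapping.keys p. Poly_Mapping.lookup p m * (\<Prod>j\<in>Poly_Mapping.keys m. x j ^ Poly_Mapping.lookup m j))"

definition peval_pdiff :: "nat \<Rightarrow> 'a::comm_semiring_1 mpoly \<Rightarrow> (nat \<Rightarrow> 'a) \<Rightarrow> 'a" where
  "peval_pdiff i p x = (\<Sum>m\<in>Poly_Mapping.keys p. Poly_Mapping.lookup p m * of_nat (Poly_Mapping.lookup m i) *
      (\<Prod>j\<in>Poly_Mapping.keys m. x j ^ (if j = i then Poly_Mapping.lookup m j - 1 else Poly_Mapping.lookup m j)))"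

definition zeros :: "nat \<Rightarrow> 'a::comm_semiring_1 mpoly set \<Rightarrow> (nat \<Rightarrow> 'a) set" where
  "zeros n F = {x \<in> aff n. \<forall>f\<in>F. peval f x = 0}"

definition zclosed :: "nat \<Rightarrow> (nat \<Rightarrow> 'a::comm_semiring_1) set \<Rightarrow> bool" where
  "zclosed n V \<longleftrightarrow> (\<exists>F. (\<forall>f\<in>F. vars f \<subseteq> {..<n}) \<and> V = zeros n F)"

definition zirred :: "nat \<Rightarrow> (nat \<Rightarrow> 'a::comm_semiring_1) set \<Rightarrow> bool" where
  "zirred n V \<longleftrightarrow> zclosed n V \<and> V \<noteq> {} \<and>
     (\<forall>A B. zclosed n A \<and> zclosed n B \<and> V = A \<union> B \<longrightarrow> V = A \<or> V = B)"

definition zdim :: "nat \<Rightarrow> (nat \<Rightarrow> 'a::comm_semiring_1) set \<Rightarrow> enat" where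
  "zdim n V = Sup {enat k | k. \<exists>c :: nat \<Rightarrow> (nat \<Rightarrow> 'a) set.
      (\<forall>i\<le>k. zirred n (c i) \<and> c i \<subseteq> V) \<and> (\<forall>i<k. c i \<subset> c (Suc i))}"

definition zcomponents :: "nat \<Rightarrow> (nat \<Rightarrow> 'a::comm_semiring_1) set \<Rightarrow> (nat \<Rightarrow> 'a) set set" where
  "zcomponents n V = {W. zirred n W \<and> W \<subseteq> V \<and>
      (\<forall>W'. zirred n W' \<and> W \<subseteq> W' \<and> W' \<subseteq> V \<longrightarrow> W' = W)}"

definition zdeg_irr :: "nat \<Rightarrow> (nat \<Rightarrow> 'a::comm_semiring_1) set \<Rightarrow> nat" where
  "zdeg_irr n W = Sup {card (W \<inter> L) | L. \<exists>(a :: nat \<Rightarrow> nat \<Rightarrow> 'a) (b :: nat \<Rightarrow> 'a).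
      L = {x \<in> aff n. \<forall>j < the_enat (zdim n W). (\<Sum>i<n. a j i * x i) = b j} \<and>
      finite (W \<inter> L)}"

definition zdeg :: "nat \<Rightarrow> (nat \<Rightarrow> 'a::comm_semiring_1) set \<Rightarrow> nat" where
  "zdeg n V = (\<Sum>W\<in>zcomponents n V. zdeg_irr n W)"

definition realZ :: "real mpoly \<Rightarrow> (nat \<Rightarrow> real) set" where
  "realZ P = zeros 4 {P}"

definition real_points :: "(nat \<Rightarrow> complex) set \<Rightarrow> (nat \<Rightarrow> real) set" where
  "real_points Y = {x \<in> aff 4. (\<lambda>i. complex_of_real (x i)) \<in> Y}"

definition iota :: "(nat \<Rightarrow> complex) \<Rightarrow> (nat \<Rightarrow> real)" where
  "iota z = (\<lambda>i. if i = 0 then Re (z 0) else if i = 1 then Im (z 0)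
       else if i = 2 then Re (z 1) else if i = 3 then Im (z 1) else 0)"

definition plane_curve :: "(nat \<Rightarrow> complex) set \<Rightarrow> bool" where
  "plane_curve \<gamma> \<longleftrightarrow> zirred 2 \<gamma> \<and> zdim 2 \<gamma> = 1"

definition curve_reg :: "(nat \<Rightarrow> complex) set \<Rightarrow> (nat \<Rightarrow> complex) set" where
  "curve_reg \<gamma> = {q \<in> \<gamma>. \<exists>f :: complex mpoly. vars f \<subseteq> {..<2} \<and> irreducible f \<and>
      zeros 2 {f} = \<gamma> \<and> (peval_pdiff 0 f q \<noteq> 0 \<or> peval_pdiff 1 f q \<noteq> 0)}"

end

theory Submission
  imports Defs "Subresultants.Subresultant_Gcd" "HOL-Computational_Algebra.Field_as_Ring"
    "HOL-Computational_Algebra.Fundamental_Theorem_Algebra" "HOL-Analysis.Analysis"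
begin

text \<open>
  At a point where the gradient of \<open>P\<close> does not vanish, the tangent space of the real hypersurface
  is three-dimensional and contains exactly one complex line.  A complex curve inside the
  hypersurface is therefore an integral curve of a fixed Lipschitz field of complex directions, and
  two such curves through the point coincide.  So it suffices to enclose the locus where \<open>P\<close> and one
  directional derivative vanish in a complex surface of bounded degree.

  After a real shear \<open>P\<close> is monic in one variable.  As \<open>P\<close> is irreducible, its discriminant with respect
  to this variable is nonzero, and after a second shear it is monic too.  These two polynomials define
  a surface \<open>Y\<close> that is finite over \<open>\<complex>\<^sup>2\<close> with fibres of bounded cardinality.  Norms of polynomials along
  \<open>Y \<rightarrow> \<complex>\<^sup>2\<close> replace commutative algebra: they bound the number of components of \<open>Y\<close>, show that every
  component dominates \<open>\<complex>\<^sup>2\<close>, and give the bound on the dimension.  For the degree of a component \<open>W\<close>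
  and a linear form \<open>l\<close>, the image of \<open>W\<close> under \<open>(z\<^sub>0, z\<^sub>1, l)\<close> is a closed hypersurface given by a factor of a
  polynomial of bounded degree, so a finite section of \<open>W\<close> by two linear equations projects to a
  finite planar set cut out by polynomials of bounded degree.
\<close>

section \<open>Polynomial functions\<close>

text \<open>Degree is a supremum over all finite linear sections, and its bound must depend on
  \<open>D\<close> alone although neither the number nor the equations of the components of
  \<open>Y\<close> are known. Monicity makes this manageable: no leading coefficient degenerates, so
  every fibre over the plane is finite, resultants specialise well at every point, and their degrees
  are read off the size of a Sylvester matrix. One directional derivative suffices because its being
  nonzero already makes the gradient nonzero. Eliminating a variable between \<open>P\<close> and
  this derivative leaves the discriminant, a polynomial in three variables that can be made monic in
  turn. Both shears have real coefficients, so real points correspond to real points under the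
  change of coordinates. Polynomials are treated as functions with an upper bound on the degree:
  substitution, restriction to lines and norms become compositions, and over a field of
  characteristic 0 nothing is lost. Formal polynomials return only where factorisation is
  needed.\<close>

inductive polyfun :: "nat set \<Rightarrow> nat \<Rightarrow> ((nat \<Rightarrow> 'a::comm_ring_1) \<Rightarrow> 'a) \<Rightarrow> bool" for I where
  const: "polyfun I n (\<lambda>_. c)"
| var: "i \<in> I \<Longrightarrow> polyfun I (Suc n) (\<lambda>x. x i)"
| add: "polyfun I n f \<Longrightarrow> polyfun I n g \<Longrightarrow> polyfun I n (\<lambda>x. f x + g x)"
| mult: "polyfun I n f \<Longrightarrow> polyfun I m g \<Longrightarrow> polyfun I (n + m) (\<lambda>x. f x * g x)"

lemma polyfun_mono:
  assumes "polyfun I n f" "I \<subseteq> J" "n \<le> m"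
  shows "polyfun J m f"
  using assms
proof (induction arbitrary: m rule: polyfun.induct)
  case (const n c)
  then show ?case by (simp add: polyfun.const)
next
  case (var i n)
  then obtain k where "m = Suc k" by (cases m) auto
  then show ?case using var by (auto intro: polyfun.var)
next
  case (add n f g)
  then show ?case by (simp add: polyfun.add)
next
  case (mult n f k g)
  have "polyfun J n f" "polyfun J (m - n) g" using mult by auto
  then have "polyfun J (n + (m - n)) (\<lambda>x. f x * g x)" by (rule polyfun.mult)
  then show ?case using mult by simp
qed

lemma polyfun_cong_on:
  assumes "polyfun I n f" "\<And>i. i \<in> I \<Longrightarrow> x i = y i"
  shows "f x = f y"
  using assms by (induction rule: polyfun.induct) auto

lemma polyfun_subst:
  assumes "polyfun I n f" "\<And>i. i \<in> I \<Longrightarrow> polyfun J e (\<lambda>x. \<sigma> x i)"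
  shows "polyfun J (n * e) (\<lambda>x. f (\<sigma> x))"
  using assms
proof (induction rule: polyfun.induct)
  case (const n c)
  then show ?case by (simp add: polyfun.const)
next
  case (var i n)
  then show ?case by (auto intro: polyfun_mono[of J e])
next
  case (add n f g)
  then show ?case by (simp add: polyfun.add)
next
  case (mult n f k g)
  then show ?case using polyfun.mult[of J "n * e" "\<lambda>x. f (\<sigma> x)" "k * e" "\<lambda>x. g (\<sigma> x)"]
    by (simp add: algebra_simps)
qed

lemma polyfun_subst_linear:
  assumes "polyfun I n f" "\<And>i. i \<in> I \<Longrightarrow> polyfun J 1 (\<lambda>x. \<sigma> x i)"
  shows "polyfun J n (\<lambda>x. f (\<sigma> x))"
  using polyfun_subst[of I n f J 1 \<sigma>] assms by simp

lemma polyfun_var: "i \<in> I \<Longrightarrow> 1 \<le> n \<Longrightarrow> polyfun I n (\<lambda>x. x i)"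
  using polyfun.var[of i I "n - 1"] by simp

lemma polyfun_cmult: "polyfun I n f \<Longrightarrow> polyfun I n (\<lambda>x. c * f x)"
  using polyfun.mult[of I 0 "\<lambda>_. c" n f] by (simp add: polyfun.const)

lemma polyfun_diff:
  assumes "polyfun I n f" "polyfun I n g" shows "polyfun I n (\<lambda>x. f x - g x)"
  using polyfun.add[OF assms(1) polyfun_cmult[OF assms(2), of "-1"]] by simp

lemma polyfun_mult_le:
  "polyfun I n f \<Longrightarrow> polyfun I m g \<Longrightarrow> n + m \<le> k \<Longrightarrow> polyfun I k (\<lambda>x. f x * g x)"
  by (rule polyfun_mono[OF polyfun.mult]) auto

lemma polyfun_sum:
  "(\<And>k. k \<in> S \<Longrightarrow> polyfun I n (f k)) \<Longrightarrow> polyfun I n (\<lambda>x. \<Sum>k\<in>S. f k x)"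
  by (induction S rule: infinite_finite_induct) (auto intro: polyfun.const polyfun.add)

lemma polyfun_prod:
  "(\<And>k. k \<in> S \<Longrightarrow> polyfun I n (f k)) \<Longrightarrow> polyfun I (card S * n) (\<lambda>x. \<Prod>k\<in>S. f k x)"
proof (induction S rule: infinite_finite_induct)
  case (insert a S)
  then show ?case using polyfun.mult[of I n "f a" "card S * n" "\<lambda>x. \<Prod>k\<in>S. f k x"] by auto
qed (auto intro: polyfun.const)

lemma polyfun_power: "polyfun I n f \<Longrightarrow> polyfun I (k * n) (\<lambda>x. f x ^ k)"
  using polyfun_prod[of "{..<k}" I n "\<lambda>_. f"] by simp

text \<open>Coefficients multiply by convolution, as for univariate polynomials, and the bounds
  \<open>n - k\<close> add up. The clause for \<open>k > n\<close> is separate because truncated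
  subtraction would still admit nonzero constants there.\<close>

lemma polyfun_expand:
  fixes f :: "(nat \<Rightarrow> 'a::idom) \<Rightarrow> 'a"
  assumes "polyfun I n f"
  shows "\<exists>g. (\<forall>k. polyfun (I - {i}) (n - k) (g k)) \<and> (\<forall>k>n. g k = (\<lambda>_. 0)) \<and>
    (\<forall>x. f x = (\<Sum>k\<le>n. g k x * x i ^ k))"
  using assms
proof (induction rule: polyfun.induct)
  case (const n c)
  have "(\<Sum>k\<le>n. (if k = 0 then c else 0) * x i ^ k) = c" for x :: "nat \<Rightarrow> 'a"
    by (simp add: if_distrib[where f="\<lambda>a. a * _"] sum.delta cong: if_cong)
  then show ?case
    by (intro exI[of _ "\<lambda>k _. if k = 0 then c else 0"]) (auto intro: polyfun.const)
next
  case (var j n)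
  show ?case
  proof (cases "j = i")
    case True
    have "(\<Sum>k\<le>Suc n. (if k = 1 then 1 else 0) * x i ^ k) = x j" for x :: "nat \<Rightarrow> 'a"
      using True by (simp add: if_distrib[where f="\<lambda>a. a * _"] sum.delta del: sum.atMost_Suc cong: if_cong)
    then show ?thesis
      by (intro exI[of _ "\<lambda>k _. if k = 1 then 1 else 0"]) (auto intro: polyfun.const)
  next
    case False
    have "(\<Sum>k\<le>Suc n. (if k = 0 then x j else 0) * x i ^ k) = x j" for x :: "nat \<Rightarrow> 'a"
      by (simp add: if_distrib[where f="\<lambda>a. a * _"] sum.delta del: sum.atMost_Suc cong: if_cong)
    moreover have "polyfun (I - {i}) (Suc n - k) (\<lambda>x. if k = 0 then x j else 0)" for k
      using False var by (cases "k = 0") (auto intro: polyfun.const polyfun.var)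
    ultimately show ?thesis
      by (intro exI[of _ "\<lambda>k x. if k = 0 then x j else 0"]) auto
  qed
next
  case (add n f g)
  obtain a b where
    a: "\<forall>k. polyfun (I - {i}) (n - k) (a k)" "\<forall>k>n. a k = (\<lambda>_. 0)" "\<forall>x. f x = (\<Sum>k\<le>n. a k x * x i ^ k)" and
    b: "\<forall>k. polyfun (I - {i}) (n - k) (b k)" "\<forall>k>n. b k = (\<lambda>_. 0)" "\<forall>x. g x = (\<Sum>k\<le>n. b k x * x i ^ k)"
    using add.IH by auto
  show ?case
    by (intro exI[of _ "\<lambda>k x. a k x + b k x"])
      (use a b in \<open>auto intro: polyfun.add simp: sum.distrib algebra_simps\<close>)
next
  case (mult n f m g)
  obtain a b where
    a: "\<forall>k. polyfun (I - {i}) (n - k) (a k)" "\<forall>k>n. a k = (\<lambda>_. 0)" "\<forall>x. f x = (\<Sum>k\<le>n. a k x * x i ^ k)" and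
    b: "\<forall>k. polyfun (I - {i}) (m - k) (b k)" "\<forall>k>m. b k = (\<lambda>_. 0)" "\<forall>x. g x = (\<Sum>k\<le>m. b k x * x i ^ k)"
    using mult.IH by auto
  define c where "c r x = (\<Sum>k\<le>r. a k x * b (r - k) x)" for r x
  have z: "a k x * b (r - k) x = 0" if "k > n \<or> r - k > m" for k r x
    using a(2) b(2) that by auto
  have 1: "polyfun (I - {i}) (n + m - r) (c r)" for r
    unfolding c_def
  proof (rule polyfun_sum)
    fix k assume k: "k \<in> {..r}"
    show "polyfun (I - {i}) (n + m - r) (\<lambda>x. a k x * b (r - k) x)"
    proof (cases "k > n \<or> r - k > m")
      case True
      then have "(\<lambda>x. a k x * b (r - k) x) = (\<lambda>_. 0)" using z by auto
      then show ?thesis by (simp add: polyfun.const)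
    next
      case False
      show ?thesis
        by (rule polyfun_mult_le[OF a(1)[rule_format, of k] b(1)[rule_format, of "r - k"]])
          (use False k in auto)
    qed
  qed
  have 2: "c r = (\<lambda>_. 0)" if "r > n + m" for r
    unfolding c_def by (intro ext sum.neutral ballI z) (use that in auto)
  have 3: "f x * g x = (\<Sum>r\<le>n + m. c r x * x i ^ r)" for x
    unfolding c_def a(3)[rule_format] b(3)[rule_format]
    by (rule polynomial_product) (use a b in auto)
  show ?case using 1 2 3 by blast
qed

text \<open>Homogeneity is recorded as behaviour under scaling, the form in which the top part
  becomes a leading coefficient along lines through the origin.\<close>

lemma polyfun_homogeneous_parts:
  fixes f :: "(nat \<Rightarrow> 'a::idom) \<Rightarrow> 'a"
  assumes "polyfun I n f"
  shows "\<exists>h. (\<forall>k. polyfun I k (h k)) \<and> (\<forall>k>n. h k = (\<lambda>_. 0)) \<and>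
    (\<forall>k x s. h k (\<lambda>i. s * x i) = s ^ k * h k x) \<and> (\<forall>x. f x = (\<Sum>k\<le>n. h k x))"
  using assms
proof (induction rule: polyfun.induct)
  case (const n c)
  then show ?case
    by (intro exI[of _ "\<lambda>k _. if k = 0 then c else 0"]) (auto intro: polyfun.const simp: sum.delta)
next
  case (var j n)
  have "polyfun I k (\<lambda>x. if k = 1 then x j else 0)" for k
    using var by (cases "k = 1") (auto intro: polyfun.const polyfun_var)
  then show ?case
    by (intro exI[of _ "\<lambda>k x. if k = 1 then x j else 0"])
      (auto simp: sum.delta simp del: sum.atMost_Suc)
next
  case (add n f g)
  obtain a b where
    a: "\<forall>k. polyfun I k (a k)" "\<forall>k>n. a k = (\<lambda>_. 0)" "\<forall>k x s. a k (\<lambda>i. s * x i) = s ^ k * a k x" "\<forall>x. f x = (\<Sum>k\<le>n. a k x)" and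
    b: "\<forall>k. polyfun I k (b k)" "\<forall>k>n. b k = (\<lambda>_. 0)" "\<forall>k x s. b k (\<lambda>i. s * x i) = s ^ k * b k x" "\<forall>x. g x = (\<Sum>k\<le>n. b k x)"
    using add.IH by auto
  show ?case
    by (intro exI[of _ "\<lambda>k x. a k x + b k x"])
      (use a b in \<open>auto intro: polyfun.add simp: sum.distrib algebra_simps\<close>)
next
  case (mult n f m g)
  obtain a b where
    a: "\<forall>k. polyfun I k (a k)" "\<forall>k>n. a k = (\<lambda>_. 0)" "\<forall>k x s. a k (\<lambda>i. s * x i) = s ^ k * a k x" "\<forall>x. f x = (\<Sum>k\<le>n. a k x)" and
    b: "\<forall>k. polyfun I k (b k)" "\<forall>k>m. b k = (\<lambda>_. 0)" "\<forall>k x s. b k (\<lambda>i. s * x i) = s ^ k * b k x" "\<forall>x. g x = (\<Sum>k\<le>m. b k x)"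
    using mult.IH by auto
  define c where "c r x = (\<Sum>k\<le>r. a k x * b (r - k) x)" for r x
  have 1: "polyfun I r (c r)" for r
    unfolding c_def
    by (rule polyfun_sum, rule polyfun_mult_le) (use a b in auto)
  have 2: "c r = (\<lambda>_. 0)" if "r > n + m" for r
    unfolding c_def
  proof (intro ext sum.neutral ballI)
    fix x k assume "k \<in> {..r}"
    then have "k > n \<or> r - k > m" using that by auto
    then show "a k x * b (r - k) x = 0" using a(2) b(2) by auto
  qed
  have 3: "c r (\<lambda>i. s * x i) = s ^ r * c r x" for r s x
    unfolding c_def sum_distrib_left
  proof (rule sum.cong[OF refl])
    fix k assume "k \<in> {..r}"
    then have "s ^ r = s ^ k * s ^ (r - k)" by (simp flip: power_add)
    then show "a k (\<lambda>i. s * x i) * b (r - k) (\<lambda>i. s * x i) = s ^ r * (a k x * b (r - k) x)"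
      using a(3) b(3) by simp
  qed
  have 4: "f x * g x = (\<Sum>r\<le>n + m. c r x)" for x
    unfolding c_def a(4)[rule_format] b(4)[rule_format]
    using polynomial_product[of n "\<lambda>k. a k x" m "\<lambda>k. b k x" 1] a(2) b(2) by auto
  show ?case using 1 2 3 4 by blast
qed

lemma polyfun_degree_0_const:
  fixes f :: "(nat \<Rightarrow> 'a::idom) \<Rightarrow> 'a"
  assumes "polyfun I 0 f" shows "f x = f y"
proof -
  obtain h where h: "\<forall>k x s. h k (\<lambda>i. s * x i) = s ^ k * h k x" "\<forall>x. f x = (\<Sum>k\<le>0::nat. h k x)"
    using polyfun_homogeneous_parts[OF assms] by metis
  \<comment> \<open>Scaling the part of degree 0 by \<open>s = 0\<close> gives the factor
    \<open>0 ^ 0 = 1\<close>, so its value anywhere is its value at the origin.\<close>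
  show ?thesis using h(1)[rule_format, of 0 0 x] h(1)[rule_format, of 0 0 y] h(2) by simp
qed

section \<open>Restriction to lines and generic points\<close>

lemma polyfun_line:
  fixes f :: "(nat \<Rightarrow> 'a::idom) \<Rightarrow> 'a"
  assumes "polyfun I n f"
  shows "\<exists>p. degree p \<le> n \<and> (\<forall>s. poly p s = f (\<lambda>i. a i + s * b i))"
  using assms
proof (induction rule: polyfun.induct)
  case (const n c)
  then show ?case by (intro exI[of _ "[:c:]"]) auto
next
  case (var i n)
  then show ?case by (intro exI[of _ "[:a i, b i:]"]) auto
next
  case (add n f g)
  then obtain p q where "degree p \<le> n" "\<forall>s. poly p s = f (\<lambda>i. a i + s * b i)"
    "degree q \<le> n" "\<forall>s. poly q s = g (\<lambda>i. a i + s * b i)" by metis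
  then show ?case by (intro exI[of _ "p + q"]) (auto intro: degree_add_le)
next
  case (mult n f m g)
  then obtain p q where "degree p \<le> n" "\<forall>s. poly p s = f (\<lambda>i. a i + s * b i)"
    "degree q \<le> m" "\<forall>s. poly q s = g (\<lambda>i. a i + s * b i)" by metis
  then show ?case
    by (intro exI[of _ "p * q"]) (auto intro: order.trans[OF degree_mult_le])
qed

text \<open>On the line through \<open>x\<close> and \<open>y\<close> both functions become nonzero
  univariate polynomials, whose product has only finitely many roots. Generic points are found in
  this way throughout.\<close>

lemma polyfun_mult_nonzero:
  fixes f g :: "(nat \<Rightarrow> 'a::field_char_0) \<Rightarrow> 'a"
  assumes "polyfun I n f" "polyfun J m g" "f x \<noteq> 0" "g y \<noteq> 0"
  shows "\<exists>z. f z \<noteq> 0 \<and> g z \<noteq> 0"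
proof -
  obtain p where p: "\<forall>s. poly p s = f (\<lambda>i. x i + s * (y i - x i))" using polyfun_line[OF assms(1)] by metis
  obtain q where q: "\<forall>s. poly q s = g (\<lambda>i. x i + s * (y i - x i))" using polyfun_line[OF assms(2)] by metis
  have "poly p 0 \<noteq> 0" "poly q 1 \<noteq> 0" using p q assms by auto
  then have "p * q \<noteq> 0" by auto
  then obtain s where "poly (p * q) s \<noteq> 0" using poly_all_0_iff_0 by blast
  then show ?thesis using p q by (metis mult_eq_0_iff poly_mult)
qed

lemma polyfun_family_nonzero:
  fixes f :: "'b \<Rightarrow> (nat \<Rightarrow> 'a::field_char_0) \<Rightarrow> 'a"
  assumes "finite A" "\<And>i. i \<in> A \<Longrightarrow> \<exists>n. polyfun I n (f i)" "\<And>i. i \<in> A \<Longrightarrow> \<exists>x. f i x \<noteq> 0"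
  shows "\<exists>z. \<forall>i\<in>A. f i z \<noteq> 0"
proof -
  have "(\<exists>n. polyfun I n (\<lambda>x. \<Prod>i\<in>A. f i x)) \<and> (\<exists>z. (\<Prod>i\<in>A. f i z) \<noteq> 0)"
    using assms
  proof (induction A rule: finite_induct)
    case empty
    then show ?case by (auto intro: polyfun.const)
  next
    case (insert a A)
    then obtain n m x z where *: "polyfun I n (\<lambda>x. \<Prod>i\<in>A. f i x)" "(\<Prod>i\<in>A. f i z) \<noteq> 0" "polyfun I m (f a)" "f a x \<noteq> 0"
      by (metis insertCI)
    obtain z where "f a z \<noteq> 0" "(\<Prod>i\<in>A. f i z) \<noteq> 0" using polyfun_mult_nonzero[OF *(3,1,4,2)] by auto
    then show ?case using insert polyfun.mult[OF *(3,1)] by auto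
  qed
  then show ?thesis using \<open>finite A\<close> by (metis prod_zero)
qed

text \<open>For the least degree bound \<open>m\<close> the part of degree \<open>m\<close> cannot
  vanish identically, since otherwise \<open>m\<close> could be lowered;
  \<open>f x \<noteq> 0\<close> settles the case \<open>m = 0\<close>.\<close>

lemma polyfun_top_form:
  fixes f :: "(nat \<Rightarrow> 'a::field_char_0) \<Rightarrow> 'a"
  assumes "polyfun I n f" "f x \<noteq> 0"
  shows "\<exists>m h. m \<le> n \<and> polyfun I m f \<and> polyfun I m h \<and> (\<exists>v. h v \<noteq> 0) \<and>
    (\<forall>v s. h (\<lambda>i. s * v i) = s ^ m * h v) \<and>
    (\<forall>v. \<exists>p. degree p \<le> m \<and> coeff p m = h v \<and> (\<forall>s. poly p s = f (\<lambda>i. s * v i)))"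
proof -
  define m where "m = (LEAST m. polyfun I m f)"
  have m: "polyfun I m f" unfolding m_def using assms(1) by (rule LeastI)
  have mn: "m \<le> n" unfolding m_def using assms(1) by (rule Least_le)
  obtain h where h: "\<forall>k. polyfun I k (h k)" "\<forall>k x s. h k (\<lambda>i. s * x i) = s ^ k * h k x" "\<forall>x. f x = (\<Sum>k\<le>m. h k x)"
    using polyfun_homogeneous_parts[OF m] by metis
  have nz: "\<exists>v. h m v \<noteq> 0"
  proof (rule ccontr)
    assume "\<not> ?thesis"
    then have z: "h m v = 0" for v by auto
    show False
    proof (cases m)
      case 0
      then show False using h(3) z assms(2) by simp
    next
      case (Suc k)
      have "f = (\<lambda>x. \<Sum>j\<le>k. h j x)" using h(3) z Suc by auto
      moreover have "polyfun I k (\<lambda>x. \<Sum>j\<le>k. h j x)"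
        by (rule polyfun_sum) (use h(1) in \<open>auto intro: polyfun_mono\<close>)
      ultimately have "m \<le> k" unfolding m_def by (simp add: Least_le)
      then show False using Suc by simp
    qed
  qed
  have "\<exists>p. degree p \<le> m \<and> coeff p m = h m v \<and> (\<forall>s. poly p s = f (\<lambda>i. s * v i))" for v
  proof (intro exI[of _ "\<Sum>k\<le>m. monom (h k v) k"] conjI allI)
    show "degree (\<Sum>k\<le>m. monom (h k v) k) \<le> m"
      by (rule degree_sum_le) (auto intro: order.trans[OF degree_monom_le])
    show "coeff (\<Sum>k\<le>m. monom (h k v) k) m = h m v"
      by (simp add: coeff_sum)
    show "poly (\<Sum>k\<le>m. monom (h k v) k) s = f (\<lambda>i. s * v i)" for s
      using h by (simp add: poly_sum poly_monom mult.commute)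
  qed
  then show ?thesis using mn m h nz by (intro exI[of _ m] exI[of _ "h m"]) simp
qed

section \<open>Shears, monic normal form and avoidance of finitely many points\<close>

definition shear :: "nat \<Rightarrow> (nat \<Rightarrow> 'a::comm_ring_1) \<Rightarrow> (nat \<Rightarrow> 'a) \<Rightarrow> nat \<Rightarrow> 'a" where
  "shear i a x = (\<lambda>j. x j + a j * x i)"

lemma shear_inverse:
  assumes "a i = 0"
  shows "shear i (\<lambda>j. - a j) (shear i a x) = x" "shear i a (shear i (\<lambda>j. - a j) x) = x"
  using assms by (auto simp: shear_def)

lemma polyfun_shear:
  assumes "polyfun I n f" "i \<in> I \<or> (\<forall>j. a j = 0)"
  shows "polyfun I n (\<lambda>x. f (shear i a x))"
  unfolding shear_def
proof (rule polyfun_subst_linear[OF assms(1)])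
  fix j assume "j \<in> I"
  then show "polyfun I 1 (\<lambda>x. x j + a j * x i)"
  proof (cases "a j = 0")
    case False
    then show ?thesis using assms \<open>j \<in> I\<close> by (intro polyfun.add polyfun_cmult polyfun_var) auto
  qed (auto intro: polyfun_var)
qed

definition monic_fun :: "nat \<Rightarrow> nat \<Rightarrow> (nat \<Rightarrow> (nat \<Rightarrow> 'a::comm_ring_1) \<Rightarrow> 'a) \<Rightarrow> (nat \<Rightarrow> 'a) \<Rightarrow> 'a" where
  "monic_fun i d a x = x i ^ d + (\<Sum>k<d. a k x * x i ^ k)"

text \<open>A shear carries the \<open>i\<close>-th coordinate direction to a vector
  \<open>w\<close> with \<open>w i = 1\<close>, and the value of the top form at \<open>w\<close>
  becomes the coefficient of the highest power of \<open>x i\<close>. By homogeneity it is enough to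
  find a vector at which both the top form and the \<open>i\<close>-th coordinate are nonzero, and
  to rescale it.\<close>

lemma polyfun_shear_monic:
  fixes f :: "(nat \<Rightarrow> 'a::field_char_0) \<Rightarrow> 'a"
  assumes "polyfun I n f" "f x0 \<noteq> 0" "i \<in> I"
  obtains a d c g where "a i = 0" "\<And>j. j \<notin> I \<Longrightarrow> a j = 0" "d \<le> n" "c \<noteq> 0"
    "\<And>k. polyfun (I - {i}) d (g k)" "\<And>x. f (shear i a x) = c * monic_fun i d g x"
proof -
  obtain m h where mh: "m \<le> n" "polyfun I m f" "polyfun I m h" "\<exists>v. h v \<noteq> 0"
    "\<forall>v s. h (\<lambda>i. s * v i) = s ^ m * h v"
    "\<forall>v. \<exists>p. degree p \<le> m \<and> coeff p m = h v \<and> (\<forall>s. poly p s = f (\<lambda>i. s * v i))"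
    using polyfun_top_form[OF assms(1,2)] by blast
  have "polyfun I 1 (\<lambda>x::nat \<Rightarrow> 'a. x i)" using assms by (auto intro: polyfun_var)
  moreover obtain v0 where "h v0 \<noteq> 0" using mh by auto
  ultimately obtain v where v: "h v \<noteq> 0" "v i \<noteq> 0"
    using polyfun_mult_nonzero[OF mh(3), of I 1 "\<lambda>x. x i" v0 "\<lambda>_. 1"] by auto
  define a where "a j = (if j \<in> I - {i} then inverse (v i) * v j else 0)" for j
  define w where "w = a(i := 1)"
  have "h w = h (\<lambda>j. inverse (v i) * v j)"
    by (rule polyfun_cong_on[OF mh(3)]) (use v in \<open>auto simp: w_def a_def\<close>)
  then have hw: "h w \<noteq> 0" using mh(5) v by simp
  obtain p where p: "degree p \<le> m" "coeff p m = h w" "\<forall>s. poly p s = f (\<lambda>i. s * w i)" using mh(6) by metis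
  have "polyfun I m (\<lambda>x. f (shear i a x))" using polyfun_shear[OF mh(2)] assms by auto
  then obtain g where g: "\<forall>k. polyfun (I - {i}) (m - k) (g k)"
     "\<forall>x. f (shear i a x) = (\<Sum>k\<le>m. g k x * x i ^ k)"
    using polyfun_expand by metis
  \<comment> \<open>The bound \<open>m - m = 0\<close> makes the leading coefficient constant; its
    value is then read off the line through the origin in direction \<open>w\<close>.\<close>
  have gm: "g m x = g m (\<lambda>_. 0)" for x
    using polyfun_degree_0_const[of "I - {i}" "g m"] g(1)[rule_format, of m] by simp
  define q where "q = (\<Sum>k\<le>m. monom (g k (\<lambda>_. 0)) k)"
  have "poly p s = poly q s" for s
  proof -
    define y where "y = (\<lambda>j. if j = i then s else (0::'a))"
    have "shear i a y = (\<lambda>j. s * w j)" by (auto simp: shear_def y_def w_def a_def)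
    moreover have "g k y = g k (\<lambda>_. 0)" for k
      by (rule polyfun_cong_on[OF g(1)[rule_format]]) (auto simp: y_def)
    ultimately have "f (\<lambda>j. s * w j) = (\<Sum>k\<le>m. g k (\<lambda>_. 0) * s ^ k)"
      using g(2)[rule_format, of y] by (simp add: y_def)
    then show ?thesis using p by (simp add: q_def poly_sum poly_monom)
  qed
  then have "p = q" by (simp add: poly_eq_poly_eq_iff[symmetric] fun_eq_iff)
  then have "g m (\<lambda>_. 0) = h w" using p(2) by (simp add: q_def coeff_sum)
  then have gmx: "g m x = h w" for x using gm by simp
  define c where "c = h w"
  have eq: "f (shear i a x) = c * monic_fun i m (\<lambda>k x. inverse c * g k x) x" for x
  proof -
    have "f (shear i a x) = (\<Sum>k<m. g k x * x i ^ k) + g m x * x i ^ m"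
      using g(2) by (simp flip: lessThan_Suc_atMost)
    moreover have "c * (\<Sum>k<m. inverse c * g k x * x i ^ k) = (\<Sum>k<m. g k x * x i ^ k)"
      unfolding sum_distrib_left using hw by (intro sum.cong) (auto simp: c_def)
    ultimately show ?thesis using gmx by (simp add: monic_fun_def c_def algebra_simps)
  qed
  have pg: "polyfun (I - {i}) m (\<lambda>x. inverse c * g k x)" for k
    by (intro polyfun_cmult polyfun_mono[OF g(1)[rule_format]]) auto
  show ?thesis
    by (rule that[of a m c, OF _ _ mh(1) _ pg eq]) (use hw in \<open>auto simp: a_def c_def\<close>)
qed

lemma polyfun_root_count:
  fixes f :: "(nat \<Rightarrow> 'a::field_char_0) \<Rightarrow> 'a"
  assumes "polyfun I n f" "f (x(i := t0)) \<noteq> 0"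
  shows "finite {t. f (x(i := t)) = 0} \<and> card {t. f (x(i := t)) = 0} \<le> n"
proof -
  obtain p where p: "degree p \<le> n" "\<forall>s. poly p s = f (\<lambda>j. (x(i := 0)) j + s * (if j = i then 1 else 0))"
    using polyfun_line[OF assms(1)] by metis
  have e: "(\<lambda>j. (x(i := 0)) j + s * (if j = i then 1 else 0)) = x(i := s)" for s by auto
  have "p \<noteq> 0" using p(2)[rule_format, of t0] assms(2) unfolding e by auto
  then have "finite {t. poly p t = 0}" "card {t. poly p t = 0} \<le> degree p"
    by (auto intro: poly_roots_finite card_poly_roots_bound)
  then show ?thesis using p(1) p(2) unfolding e by simp
qed

text \<open>A vector space over an infinite field is not a finite union of proper subspaces, here
  the subspaces of functions vanishing at a given point of \<open>S\<close>. This is the linear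
  counterpart of prime avoidance.\<close>

lemma avoid_finite_union:
  fixes V :: "('b \<Rightarrow> 'a::field_char_0) set"
  assumes V: "\<And>f g c. f \<in> V \<Longrightarrow> g \<in> V \<Longrightarrow> (\<lambda>x. f x + c * g x) \<in> V" "V \<noteq> {}"
    and S: "finite S" "\<And>y. y \<in> S \<Longrightarrow> \<exists>g\<in>V. g y \<noteq> 0"
  shows "\<exists>g\<in>V. \<forall>y\<in>S. g y \<noteq> 0"
  using S
proof (induction S rule: finite_induct)
  case empty
  then show ?case using V by auto
next
  case (insert y S)
  obtain g where g: "g \<in> V" "\<forall>y\<in>S. g y \<noteq> 0" using insert by auto
  obtain h where h: "h \<in> V" "h y \<noteq> 0" using insert.prems[of y] by auto
  show ?case
  proof (cases "g y = 0")
    case True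
    \<comment> \<open>Each old point forbids a single value of \<open>c\<close>; at \<open>y\<close>
      the combination equals \<open>h y\<close> because \<open>g y = 0\<close>.\<close>
    have "infinite (UNIV :: 'a set)" by (rule infinite_UNIV_char_0)
    then obtain c where c: "c \<notin> (\<lambda>s. - h s / g s) ` S"
      using insert(1) by (metis finite_imageI ex_new_if_finite)
    have "h s + c * g s \<noteq> 0" if "s \<in> S" for s
    proof
      assume "h s + c * g s = 0"
      then have "c = - h s / g s" using g(2) that by (simp add: field_simps eq_neg_iff_add_eq_0 add.commute)
      then show False using c that by blast
    qed
    then show ?thesis using V(1)[OF h(1) g(1), of c] h(2) True by (intro bexI[of _ "\<lambda>x. h x + c * g x"]) auto
  qed (use g in auto)
qed

section \<open>Norms along a monic polynomial\<close>

lemma coeff_sum_monom_lessThan: "coeff (\<Sum>k<d. monom (a k) k) j = (if j < d then a j else 0)"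
  by (simp add: coeff_sum)

text \<open>The Leibniz formula is a sum of products of \<open>m + n\<close> entries. Degrees that
  do not depend on \<open>x\<close> keep the Sylvester matrix at one size.\<close>

lemma polyfun_resultant:
  fixes p q :: "(nat \<Rightarrow> 'a::idom) \<Rightarrow> 'a poly"
  assumes "\<And>k. polyfun J e (\<lambda>x. coeff (p x) k)" "\<And>k. polyfun J e (\<lambda>x. coeff (q x) k)"
    and "\<And>x. degree (p x) = m" "\<And>x. degree (q x) = n"
  shows "polyfun J ((m + n) * e) (\<lambda>x. resultant (p x) (q x))"
proof -
  have dim: "dim_row (sylvester_mat (p x) (q x)) = m + n" "dim_col (sylvester_mat (p x) (q x)) = m + n" for x
    using assms(3,4) by simp_all
  have entry: "polyfun J e (\<lambda>x. sylvester_mat (p x) (q x) $$ (i, j))" if "i < m + n" "j < m + n" for i j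
  proof -
    have eq: "sylvester_mat (p x) (q x) $$ (i, j) =
      (if i < n then if i \<le> j \<and> j - i \<le> m then coeff (p x) (m + i - j) else 0
       else if i - n \<le> j \<and> j \<le> i then coeff (q x) (i - j) else 0)" for x
      using sylvester_index_mat[of i "p x" "q x" j] that assms(3,4) by simp
    show ?thesis unfolding eq
      by (cases "i < n"; cases "i \<le> j \<and> j - i \<le> m"; cases "i - n \<le> j \<and> j \<le> i")
        (use assms(1,2) in \<open>auto intro: polyfun.const\<close>)
  qed
  have "polyfun J ((m + n) * e) (\<lambda>x. signof \<pi> * (\<Prod>i = 0..<m + n. sylvester_mat (p x) (q x) $$ (i, \<pi> i)))"
    if "\<pi> permutes {0..<m + n}" for \<pi>
  proof (rule polyfun_cmult)
    have "polyfun J (card {0..<m + n} * e) (\<lambda>x. \<Prod>i = 0..<m + n. sylvester_mat (p x) (q x) $$ (i, \<pi> i))"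
      by (rule polyfun_prod, rule entry) (use permutes_in_image[OF that] in auto)
    then show "polyfun J ((m + n) * e) (\<lambda>x. \<Prod>i = 0..<m + n. sylvester_mat (p x) (q x) $$ (i, \<pi> i))"
      by simp
  qed
  then show ?thesis
    unfolding resultant_def Determinant.det_def dim by (auto intro: polyfun_sum)
qed

definition monic_poly :: "nat \<Rightarrow> (nat \<Rightarrow> (nat \<Rightarrow> 'a::comm_ring_1) \<Rightarrow> 'a) \<Rightarrow> (nat \<Rightarrow> 'a) \<Rightarrow> 'a poly" where
  "monic_poly d a x = monom 1 d + (\<Sum>k<d. monom (a k x) k)"

lemma coeff_monic_poly: "coeff (monic_poly d a x) j = (if j < d then a j x else if j = d then 1 else 0)"
  by (auto simp: monic_poly_def coeff_sum_monom_lessThan)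

lemma degree_monic_poly: "degree (monic_poly d a (x :: nat \<Rightarrow> 'a::comm_ring_1)) = d"
  by (intro antisym degree_le le_degree) (auto simp: coeff_monic_poly)

lemma monic_poly_nonzero: "monic_poly d a (x :: nat \<Rightarrow> 'a::comm_ring_1) \<noteq> 0"
  using coeff_monic_poly[of d a x d] by auto

lemma poly_monic_poly:
  assumes "\<And>k. polyfun (I - {i}) e (a k)"
  shows "poly (monic_poly d a x) t = monic_fun i d a (x(i := t))"
proof -
  have "a k (x(i := t)) = a k x" for k
    by (rule polyfun_cong_on[OF assms]) auto
  then show ?thesis by (simp add: monic_poly_def monic_fun_def poly_sum poly_monom)
qed

lemma polyfun_coeff_monic_poly:
  assumes "\<And>k. polyfun J e (a k)" shows "polyfun J e (\<lambda>x. coeff (monic_poly d a x) k)"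
  unfolding coeff_monic_poly
  by (cases "k < d"; cases "k = d") (use assms in \<open>auto intro: polyfun.const\<close>)

lemma complex_resultant_eq_0_iff:
  fixes p q :: "complex poly"
  assumes "p \<noteq> 0"
  shows "resultant p q = 0 \<longleftrightarrow> (\<exists>t. poly p t = 0 \<and> poly q t = 0)"
proof -
  have nz: "gcd p q \<noteq> 0" using assms by simp
  have "degree (gcd p q) \<noteq> 0 \<longleftrightarrow> (\<exists>t. poly (gcd p q) t = 0)"
  proof
    assume "degree (gcd p q) \<noteq> 0"
    then show "\<exists>t. poly (gcd p q) t = 0"
      using alg_closed_imp_poly_has_root[of "gcd p q"] by simp
  next
    assume "\<exists>t. poly (gcd p q) t = 0"
    then show "degree (gcd p q) \<noteq> 0" using nz by (auto elim!: degree_eq_zeroE)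
  qed
  moreover have "poly (gcd p q) t = 0 \<longleftrightarrow> poly p t = 0 \<and> poly q t = 0" for t
    by (simp add: poly_eq_0_iff_dvd)
  ultimately show ?thesis unfolding resultant_0_gcd by simp
qed

text \<open>Adding a high multiple of the monic polynomial to \<open>g\<close> fixes the size of the Sylvester matrix.\<close>

lemma norm_exists:
  fixes g :: "(nat \<Rightarrow> complex) \<Rightarrow> complex"
  assumes a: "\<And>k. polyfun (I - {i}) e (a k)" and g: "polyfun I e g"
  shows "\<exists>N. polyfun (I - {i}) ((2 * d + e + 1) * e) N \<and>
    (\<forall>x. N x = 0 \<longleftrightarrow> (\<exists>t. monic_fun i d a (x(i := t)) = 0 \<and> g (x(i := t)) = 0))"
proof -
  obtain b where b: "\<forall>k. polyfun (I - {i}) (e - k) (b k)" "\<forall>k>e. b k = (\<lambda>_. 0)"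
     "\<forall>x. g x = (\<Sum>k\<le>e. b k x * x i ^ k)"
    using polyfun_expand[OF g] by metis
  \<comment> \<open>The exponent \<open>Suc e\<close> exceeds the degree of \<open>g\<close> in
    \<open>x i\<close>, so the two summands do not overlap and \<open>q x\<close> is monic of degree
    \<open>Suc e + d\<close> for every \<open>x\<close>. At the roots of the monic polynomial it
    still agrees with \<open>g\<close>.\<close>
  define q where "q x = (\<Sum>k<Suc e. monom (b k x) k) + monom 1 (Suc e) * monic_poly d a x" for x
  have be: "polyfun (I - {i}) e (b k)" for k
    by (rule polyfun_mono[OF b(1)[rule_format]]) auto
  have qc: "coeff (q x) k = (if k < Suc e then b k x else coeff (monic_poly d a x) (k - Suc e))" for x k
    unfolding q_def coeff_add coeff_sum_monom_lessThan coeff_monom_mult by auto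
  have qd: "degree (q x) = Suc e + d" for x
    by (intro antisym degree_le le_degree) (auto simp: qc coeff_monic_poly)
  have qp: "polyfun (I - {i}) e (\<lambda>x. coeff (q x) k)" for k
    unfolding qc using be polyfun_coeff_monic_poly[of "I - {i}" e a d, OF a] by (cases "k < Suc e") auto
  have poly_q: "poly (q x) t = g (x(i := t)) + t ^ Suc e * poly (monic_poly d a x) t" for x t
  proof -
    have "b k (x(i := t)) = b k x" for k by (rule polyfun_cong_on[OF be]) auto
    then have "g (x(i := t)) = (\<Sum>k<Suc e. b k x * t ^ k)"
      using b(3) by (simp add: lessThan_Suc_atMost)
    then show ?thesis unfolding q_def by (simp add: poly_sum poly_monom del: sum.lessThan_Suc)
  qed
  define N where "N x = resultant (monic_poly d a x) (q x)" for x
  have "polyfun (I - {i}) ((d + (Suc e + d)) * e) N"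
    unfolding N_def
    by (rule polyfun_resultant) (use a qp in \<open>auto simp: degree_monic_poly qd intro: polyfun_coeff_monic_poly\<close>)
  moreover have "(d + (Suc e + d)) * e = (2 * d + e + 1) * e" by simp
  ultimately have "polyfun (I - {i}) ((2 * d + e + 1) * e) N" by (simp only:)
  moreover have "N x = 0 \<longleftrightarrow> (\<exists>t. monic_fun i d a (x(i := t)) = 0 \<and> g (x(i := t)) = 0)" for x
    unfolding N_def complex_resultant_eq_0_iff[OF monic_poly_nonzero] poly_q poly_monic_poly[OF a]
    by auto
  ultimately show ?thesis by blast
qed

section \<open>Polynomial functions as a factorial ring\<close>

definition ev_step :: "nat \<Rightarrow> ('r \<Rightarrow> (nat \<Rightarrow> 'a) \<Rightarrow> 'a) \<Rightarrow> 'r::comm_ring_1 poly \<Rightarrow> (nat \<Rightarrow> 'a::comm_ring_1) \<Rightarrow> 'a" where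
  "ev_step i e p x = poly (map_poly (\<lambda>c. e c x) p) (x i)"

text \<open>Iterating \<open>ev_step\<close> realises the polynomial functions in the variables \<open>I\<close> as a type of nested
  univariate polynomials, which is a unique factorisation domain.\<close>

definition poly_model :: "nat set \<Rightarrow> ('r::comm_ring_1 \<Rightarrow> (nat \<Rightarrow> 'a::comm_ring_1) \<Rightarrow> 'a) \<Rightarrow> bool" where
  "poly_model I e \<longleftrightarrow> (\<forall>x. comm_ring_hom (\<lambda>p. e p x)) \<and> (\<forall>p. (\<forall>x. e p x = 0) \<longrightarrow> p = 0) \<and>
     (\<forall>p. \<exists>n. polyfun I n (e p)) \<and> (\<forall>n f. polyfun I n f \<longrightarrow> (\<exists>p. e p = f))"

lemma poly_modelD:
  assumes "poly_model I e"
  shows "comm_ring_hom (\<lambda>p. e p x)" "(\<And>x. e p x = 0) \<Longrightarrow> p = 0" "\<exists>n. polyfun I n (e p)"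
    "polyfun I n f \<Longrightarrow> \<exists>p. e p = f"
  using assms by (auto simp: poly_model_def)

lemma comm_ring_hom_ev_step:
  assumes "comm_ring_hom (\<lambda>c. e c x)"
  shows "comm_ring_hom (\<lambda>p. ev_step i e p x)"
proof -
  interpret map_poly_comm_ring_hom "\<lambda>c. e c x" using assms by (simp add: map_poly_comm_ring_hom_def)
  show ?thesis
    by unfold_locales (auto simp: ev_step_def hom_distribs)
qed

lemma poly_model_const: "poly_model {} (\<lambda>c (_ :: nat \<Rightarrow> 'a::comm_ring_1). c)"
proof -
  have "\<exists>c. (\<lambda>_. c) = f" if "polyfun {} n f" for n and f :: "(nat \<Rightarrow> 'a) \<Rightarrow> 'a"
    using that by (induction rule: polyfun.induct) auto
  then show ?thesis
    unfolding poly_model_def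
    by (auto intro: polyfun.const) (unfold_locales, auto)
qed

text \<open>Surjectivity is \<open>polyfun_expand\<close>. For injectivity, the coefficients do not
  depend on \<open>x i\<close>, so varying this coordinate alone gives a univariate polynomial all
  of whose values are 0.\<close>

lemma poly_model_step:
  fixes e :: "'r::comm_ring_1 \<Rightarrow> (nat \<Rightarrow> 'a::field_char_0) \<Rightarrow> 'a"
  assumes e: "poly_model I e" and i: "i \<notin> I"
  shows "poly_model (insert i I) (ev_step i e)"
proof -
  interpret h: comm_ring_hom "\<lambda>c. e c x" for x using poly_modelD(1)[OF e] .
  interpret E: comm_ring_hom "\<lambda>p. ev_step i e p x" for x
    by (rule comm_ring_hom_ev_step) (rule poly_modelD(1)[OF e])
  have indep: "e c (x(i := t)) = e c x" for c x t
  proof -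
    obtain n where "polyfun I n (e c)" using poly_modelD(3)[OF e] by blast
    then show ?thesis by (rule polyfun_cong_on) (use i in auto)
  qed
  have inj: "p = 0" if z: "\<And>x. ev_step i e p x = 0" for p
  proof (rule poly_eqI)
    fix k
    have "e (coeff p k) x = 0" for x
    proof -
      have "poly (map_poly (\<lambda>c. e c x) p) t = 0" for t
        using z[of "x(i := t)"] by (simp add: ev_step_def indep)
      then have "map_poly (\<lambda>c. e c x) p = 0" using poly_all_0_iff_0 by blast
      then show ?thesis by (metis coeff_map_poly coeff_0 h.hom_zero)
    qed
    then show "coeff p k = coeff 0 k" using poly_modelD(2)[OF e] by simp
  qed
  have pf: "\<exists>n. polyfun (insert i I) n (ev_step i e p)" for p
  proof (induction p)
    case 0
    have "ev_step i e 0 = (\<lambda>_. 0)" by (auto simp: ev_step_def)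
    then show ?case by (auto intro: polyfun.const)
  next
    case (pCons a p)
    obtain n where n: "polyfun (insert i I) n (ev_step i e p)" using pCons by auto
    obtain m where m: "polyfun I m (e a)" using poly_modelD(3)[OF e] by auto
    have "ev_step i e (pCons a p) = (\<lambda>x. e a x + x i * ev_step i e p x)"
      using pCons by (auto simp: ev_step_def map_poly_pCons)
    moreover have "polyfun (insert i I) (m + (1 + n)) (\<lambda>x. e a x + x i * ev_step i e p x)"
      by (rule polyfun.add, rule polyfun_mono[OF m]) (auto intro!: polyfun_mult_le[OF polyfun_var n])
    ultimately show ?case by auto
  qed
  have mon: "ev_step i e (monom c k) x = e c x * x i ^ k" for c k x
    by (simp add: ev_step_def map_poly_monom poly_monom)
  have surj: "\<exists>p. ev_step i e p = f" if f: "polyfun (insert i I) n f" for n f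
  proof -
    obtain g where g: "\<forall>k. polyfun (insert i I - {i}) (n - k) (g k)" "\<forall>x. f x = (\<Sum>k\<le>n. g k x * x i ^ k)"
      using polyfun_expand[OF f] by metis
    have "\<exists>p. e p = g k" for k using g(1)[rule_format, of k] i poly_modelD(4)[OF e] by simp
    then obtain p where p: "\<And>k. e (p k) = g k" by metis
    have "ev_step i e (\<Sum>k\<le>n. monom (p k) k) = f"
      using g(2) p by (auto simp: E.hom_sum mon)
    then show ?thesis by blast
  qed
  show ?thesis unfolding poly_model_def
    using E.comm_ring_hom_axioms inj pf surj by blast
qed

lemma polyfun_truncate:
  assumes "polyfun J n f"
  shows "polyfun I n (\<lambda>x. f (\<lambda>i. if i \<in> I then x i else 0))"
proof (rule polyfun_subst_linear[OF assms])
  fix i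
  show "polyfun I 1 (\<lambda>x. if i \<in> I then x i else 0)"
    by (cases "i \<in> I") (auto intro: polyfun.const polyfun_var)
qed

lemma poly_model_inj: 
  assumes "poly_model I e" "\<And>x. e p x = e q x" shows "p = q"
proof -
  interpret comm_ring_hom "\<lambda>c. e c x" for x using poly_modelD(1)[OF assms(1)] .
  have "p - q = 0" by (rule poly_modelD(2)[OF assms(1)]) (use assms(2) in \<open>simp add: hom_minus\<close>)
  then show ?thesis by simp
qed

lemma poly_model_unit:
  assumes e: "poly_model I e" and u: "polyfun I n u" "\<And>x. e a x * u x = 1"
  shows "a dvd 1"
proof -
  interpret comm_ring_hom "\<lambda>c. e c x" for x using poly_modelD(1)[OF e] .
  obtain b where b: "e b = u" using poly_modelD(4)[OF e u(1)] by auto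
  have "a * b = 1" by (rule poly_model_inj[OF e]) (use u b in \<open>simp add: hom_mult\<close>)
  then show ?thesis by (metis dvd_triv_left)
qed

text \<open>With \<open>a i = 0\<close> the shear is invertible, so composition with it is an
  automorphism of the ring of polynomial functions; units and factorisations can be carried in both
  directions.\<close>

lemma poly_model_irreducible_shear:
  fixes e :: "'r::idom \<Rightarrow> (nat \<Rightarrow> 'a::field_char_0) \<Rightarrow> 'a"
  assumes e: "poly_model I e" and p: "irreducible p" and q: "\<And>x. e q x = e p (shear i a x)"
    and i: "i \<in> I" "a i = 0"
  shows "irreducible q"
proof -
  interpret comm_ring_hom "\<lambda>c. e c x" for x using poly_modelD(1)[OF e] .
  have tr: "\<exists>c'. \<forall>x. e c' x = e c (shear i b x)" for c b
  proof -
    obtain n where "polyfun I n (e c)" using poly_modelD(3)[OF e] by blast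
    then have "polyfun I n (\<lambda>x. e c (shear i b x))" using i by (auto intro: polyfun_shear)
    then show ?thesis using poly_modelD(4)[OF e] by metis
  qed
  have unit: "c dvd 1" if eq: "\<And>x. e c x = e c' (shear i b x)" and c': "c' dvd 1" for c c' b
  proof -
    obtain d where d: "1 = c' * d" using c' by (rule dvdE)
    obtain n where n: "polyfun I n (e d)" using poly_modelD(3)[OF e] by blast
    have "polyfun I n (\<lambda>x. e d (shear i b x))" using i n by (auto intro: polyfun_shear)
    moreover have "e c x * e d (shear i b x) = 1" for x
      using eq hom_mult[of c' d "shear i b x"] by (simp flip: d)
    ultimately show ?thesis by (rule poly_model_unit[OF e])
  qed
  have p': "e p x = e q (shear i (\<lambda>j. - a j) x)" for x
    using q shear_inverse(2)[of a i x] i by simp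
  show ?thesis
  proof (rule irreducibleI)
    show "q \<noteq> 0"
    proof
      assume "q = 0"
      then have "p = 0" using p' by (intro poly_modelD(2)[OF e]) simp
      then show False using p by simp
    qed
    show "\<not> q dvd 1" using unit[OF p'] p by (auto simp: irreducible_def)
    fix u v assume uv: "q = u * v"
    obtain u' v' where u': "\<forall>x. e u' x = e u (shear i (\<lambda>j. - a j) x)" and v': "\<forall>x. e v' x = e v (shear i (\<lambda>j. - a j) x)"
      using tr by metis
    have "p = u' * v'" by (rule poly_model_inj[OF e]) (use p' u' v' uv in \<open>simp add: hom_mult\<close>)
    then have "u' dvd 1 \<or> v' dvd 1" using p by (auto simp: irreducible_def)
    moreover have "e u x = e u' (shear i a x)" "e v x = e v' (shear i a x)" for x
      using u' v' shear_inverse(1)[of a i x] i by simp_all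
    ultimately show "u dvd 1 \<or> v dvd 1" using unit by metis
  qed
qed

section \<open>Formal multivariate polynomials and their nested models\<close>

definition mpoly_var :: "nat \<Rightarrow> 'a::comm_ring_1 mpoly" where
  "mpoly_var i = Poly_Mapping.single (Poly_Mapping.single i 1) 1"

definition mono_eval :: "(nat \<Rightarrow>\<^sub>0 nat) \<Rightarrow> (nat \<Rightarrow> 'a::comm_semiring_1) \<Rightarrow> 'a" where
  "mono_eval m x = (\<Prod>j\<in>Poly_Mapping.keys m. x j ^ Poly_Mapping.lookup m j)"

lemma mono_eval_superset:
  assumes "finite S" "Poly_Mapping.keys m \<subseteq> S"
  shows "mono_eval m x = (\<Prod>j\<in>S. x j ^ Poly_Mapping.lookup m j)"
  unfolding mono_eval_def
  by (rule prod.mono_neutral_left) (use assms in \<open>auto simp: in_keys_iff\<close>)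

lemma mono_eval_add: "mono_eval (m + n) x = mono_eval m x * mono_eval n x"
proof -
  let ?S = "Poly_Mapping.keys m \<union> Poly_Mapping.keys n"
  have "mono_eval (m + n) x = (\<Prod>j\<in>?S. x j ^ Poly_Mapping.lookup (m + n) j)"
    by (rule mono_eval_superset) (auto simp: Poly_Mapping.keys_add)
  also have "\<dots> = mono_eval m x * mono_eval n x"
    by (simp add: lookup_add power_add prod.distrib mono_eval_superset[of ?S])
  finally show ?thesis .
qed

lemma peval_superset:
  assumes "finite S" "Poly_Mapping.keys p \<subseteq> S"
  shows "peval p x = (\<Sum>m\<in>S. Poly_Mapping.lookup p m * mono_eval m x)"
  unfolding peval_def mono_eval_def[symmetric]
  by (rule sum.mono_neutral_left) (use assms in \<open>auto simp: in_keys_iff\<close>)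

lemma peval_add: "peval (p + q) x = peval p x + peval q x"
proof -
  let ?S = "Poly_Mapping.keys p \<union> Poly_Mapping.keys q"
  have "peval (p + q) x = (\<Sum>m\<in>?S. Poly_Mapping.lookup (p + q) m * mono_eval m x)"
    by (rule peval_superset) (auto simp: Poly_Mapping.keys_add)
  also have "\<dots> = peval p x + peval q x"
    by (simp add: lookup_add distrib_right sum.distrib peval_superset[of ?S])
  finally show ?thesis .
qed

lemma peval_0: "peval 0 x = 0" by (simp add: peval_def)

lemma peval_single: "peval (Poly_Mapping.single m c) x = c * mono_eval m x"
  by (subst peval_superset[of "{m}"]) (auto simp: lookup_single)

lemma peval_sum: "peval (\<Sum>k\<in>S. f k) x = (\<Sum>k\<in>S. peval (f k) x)"
  by (induction S rule: infinite_finite_induct) (auto simp: peval_add peval_0)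

lemma mpoly_sum_monomials: "(\<Sum>m\<in>Poly_Mapping.keys p. Poly_Mapping.single m (Poly_Mapping.lookup p m)) = p"
  by (rule poly_mapping_eqI) (auto simp: lookup_sum lookup_single when_def in_keys_iff)

lemma peval_mult: "peval (p * q) x = peval p x * (peval q x :: 'a::comm_ring_1)"
proof -
  have "p * q = (\<Sum>m\<in>Poly_Mapping.keys p. Poly_Mapping.single m (Poly_Mapping.lookup p m)) *
      (\<Sum>n\<in>Poly_Mapping.keys q. Poly_Mapping.single n (Poly_Mapping.lookup q n))"
    by (simp only: mpoly_sum_monomials)
  also have "\<dots> = (\<Sum>m\<in>Poly_Mapping.keys p. \<Sum>n\<in>Poly_Mapping.keys q.
      Poly_Mapping.single (m + n) (Poly_Mapping.lookup p m * Poly_Mapping.lookup q n))"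
    by (simp add: sum_product mult_single)
  finally have "peval (p * q) x = (\<Sum>m\<in>Poly_Mapping.keys p. \<Sum>n\<in>Poly_Mapping.keys q.
      (Poly_Mapping.lookup p m * mono_eval m x) * (Poly_Mapping.lookup q n * mono_eval n x))"
    by (simp add: peval_sum peval_single mono_eval_add mult_ac)
  then show ?thesis by (simp add: peval_def mono_eval_def[symmetric] sum_product)
qed

lemma peval_1: "peval 1 x = 1"
  using peval_single[of 0 1 x] by (simp add: mono_eval_def)

lemma peval_var: "peval (mpoly_var i) x = x i"
  by (simp add: mpoly_var_def peval_single mono_eval_def)

lemma comm_ring_hom_peval: "comm_ring_hom (\<lambda>p. peval p (x :: nat \<Rightarrow> 'a::comm_ring_1))"
  by unfold_locales (auto simp: peval_0 peval_1 peval_add peval_mult)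

lemma polyfun_peval:
  assumes "tdeg p \<le> n" "vars p \<subseteq> I" shows "polyfun I n (peval p)"
proof -
  have "polyfun I n (\<lambda>x. Poly_Mapping.lookup p m * mono_eval m x)" if m: "m \<in> Poly_Mapping.keys p" for m
  proof (rule polyfun_cmult)
    have "sum (Poly_Mapping.lookup m) (Poly_Mapping.keys m) \<le> n"
      using assms(1) m by (auto simp: tdeg_def)
    moreover have "polyfun I (sum (Poly_Mapping.lookup m) S) (\<lambda>x. \<Prod>j\<in>S. x j ^ Poly_Mapping.lookup m j)"
      if "S \<subseteq> Poly_Mapping.keys m" for S
      using finite_subset[OF that finite_keys] that
    proof (induction S rule: finite_induct)
      case (insert j S)
      have "j \<in> I" using insert m assms(2) by (auto simp: vars_def)
      then have "polyfun I (Poly_Mapping.lookup m j * 1) (\<lambda>x. x j ^ Poly_Mapping.lookup m j)"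
        by (intro polyfun_power polyfun_var) auto
      then show ?case using insert polyfun.mult[of I "Poly_Mapping.lookup m j"] by simp
    qed (auto intro: polyfun.const)
    ultimately show "polyfun I n (mono_eval m)"
      unfolding mono_eval_def[abs_def] by (blast intro: polyfun_mono)
  qed
  then show ?thesis unfolding peval_def mono_eval_def[symmetric] by (intro polyfun_sum) auto
qed

text \<open>Ties formal polynomials, whose variables are indexed by all naturals, to a nested
  univariate model in the variables \<open>I\<close>, where unique factorisation holds.\<close>

definition mpoly_model :: "nat set \<Rightarrow> ('r::comm_ring_1 \<Rightarrow> 'a::comm_ring_1 mpoly) \<Rightarrow> ('r \<Rightarrow> (nat \<Rightarrow> 'a) \<Rightarrow> 'a) \<Rightarrow> bool" where
  "mpoly_model I \<Psi> e \<longleftrightarrow> comm_ring_hom \<Psi> \<and> (\<forall>p x. peval (\<Psi> p) x = e p x) \<and>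
     (\<forall>P. vars P \<subseteq> I \<longrightarrow> (\<exists>p. \<Psi> p = P))"

lemma mpoly_model_const: "mpoly_model {} (Poly_Mapping.single 0) (\<lambda>c (_ :: nat \<Rightarrow> 'a::comm_ring_1). c)"
proof -
  have "Poly_Mapping.single 0 (Poly_Mapping.lookup P 0) = P" if "vars P \<subseteq> {}" for P :: "'a mpoly"
  proof (rule poly_mapping_eqI)
    fix m
    have "m = 0" if "m \<in> Poly_Mapping.keys P"
    proof -
      have "Poly_Mapping.keys m = {}" using \<open>vars P \<subseteq> {}\<close> that unfolding vars_def by blast
      then show ?thesis by (simp only: keys_eq_empty)
    qed
    then show "Poly_Mapping.lookup (Poly_Mapping.single 0 (Poly_Mapping.lookup P 0)) m = Poly_Mapping.lookup P m"
      by (auto simp: lookup_single when_def in_keys_iff)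
  qed
  moreover have "comm_ring_hom (Poly_Mapping.single 0 :: 'a \<Rightarrow> 'a mpoly)"
    by unfold_locales (auto simp: single_add mult_single)
  ultimately show ?thesis
    unfolding mpoly_model_def by (auto simp: peval_single mono_eval_def)
qed

lemma mpoly_model_step:
  assumes e: "mpoly_model I \<Psi> e"
  shows "mpoly_model (insert i I) (\<lambda>p. poly (map_poly \<Psi> p) (mpoly_var i)) (ev_step i e)"
proof -
  interpret h: comm_ring_hom \<Psi> using e by (simp add: mpoly_model_def)
  interpret m: map_poly_comm_ring_hom \<Psi> by unfold_locales
  let ?\<Psi> = "\<lambda>p. poly (map_poly \<Psi> p) (mpoly_var i)"
  interpret H: comm_ring_hom ?\<Psi> by unfold_locales (auto simp: hom_distribs)
  have pe: "peval (\<Psi> p) x = e p x" for p x using e by (simp add: mpoly_model_def)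
  have ee: "peval (?\<Psi> p) x = ev_step i e p x" for p x
  proof -
    interpret v: comm_ring_hom "\<lambda>p. peval p x" by (rule comm_ring_hom_peval)
    have "peval (?\<Psi> p) x = poly (map_poly (\<lambda>p. peval p x) (map_poly \<Psi> p)) (x i)"
      using v.poly_map_poly[of "map_poly \<Psi> p" "mpoly_var i"] by (simp add: peval_var)
    also have "map_poly (\<lambda>p. peval p x) (map_poly \<Psi> p) = map_poly (\<lambda>c. e c x) p"
      by (simp add: map_poly_map_poly o_def pe peval_0)
    finally show ?thesis by (simp add: ev_step_def)
  qed
  have single: "\<exists>p. ?\<Psi> p = Poly_Mapping.single m c" if m: "Poly_Mapping.keys m \<subseteq> insert i I" for m c
  proof -
    define k where "k = Poly_Mapping.lookup m i"
    define m' where "m' = m - Poly_Mapping.single i k"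
    have mm: "m = m' + Poly_Mapping.single i k"
      by (rule poly_mapping_eqI) (auto simp: m'_def lookup_add lookup_minus lookup_single when_def k_def)
    have "Poly_Mapping.keys m' \<subseteq> I"
    proof
      fix j assume "j \<in> Poly_Mapping.keys m'"
      then have "Poly_Mapping.lookup m' j \<noteq> 0" by (simp add: in_keys_iff)
      then have "j \<noteq> i" "Poly_Mapping.lookup m j \<noteq> 0"
        by (auto simp: m'_def lookup_minus lookup_single when_def k_def split: if_splits)
      then have "j \<in> Poly_Mapping.keys m" by (simp add: in_keys_iff)
      then show "j \<in> I" using m \<open>j \<noteq> i\<close> by blast
    qed
    then have "vars (Poly_Mapping.single m' c) \<subseteq> I" by (auto simp: vars_def)
    then obtain p where p: "\<Psi> p = Poly_Mapping.single m' c" using e unfolding mpoly_model_def by blast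
    have pow: "(mpoly_var i :: 'b mpoly) ^ k = Poly_Mapping.single (Poly_Mapping.single i k) 1" for k
    proof (induction k)
      case (Suc k)
      have "Poly_Mapping.single i 1 + Poly_Mapping.single i k = Poly_Mapping.single i (Suc k)"
        by (simp flip: single_add)
      then show ?case using Suc by (simp add: mpoly_var_def mult_single)
    qed simp
    have "?\<Psi> (monom p k) = Poly_Mapping.single m c"
      by (simp add: map_poly_monom poly_monom p pow mult_single mm[symmetric])
    then show ?thesis by blast
  qed
  have "\<exists>p. ?\<Psi> p = P" if P: "vars P \<subseteq> insert i I" for P
  proof -
    have "\<forall>m\<in>Poly_Mapping.keys P. \<exists>p. ?\<Psi> p = Poly_Mapping.single m (Poly_Mapping.lookup P m)"
      using P by (intro ballI single) (auto simp: vars_def)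
    then obtain q where q: "\<forall>m\<in>Poly_Mapping.keys P. ?\<Psi> (q m) = Poly_Mapping.single m (Poly_Mapping.lookup P m)"
      by metis
    have "?\<Psi> (\<Sum>m\<in>Poly_Mapping.keys P. q m) = (\<Sum>m\<in>Poly_Mapping.keys P. ?\<Psi> (q m))" by (rule H.hom_sum)
    also have "\<dots> = P" using q mpoly_sum_monomials[of P] by simp
    finally show ?thesis by blast
  qed
  then show ?thesis unfolding mpoly_model_def using H.comm_ring_hom_axioms ee by blast
qed

lemma mpoly_irreducible_model:
  fixes e :: "'r::idom \<Rightarrow> (nat \<Rightarrow> 'a::field_char_0) \<Rightarrow> 'a"
  assumes m: "mpoly_model I \<Psi> e" and e: "poly_model I e" and P: "irreducible P" "vars P \<subseteq> I"
  shows "\<exists>p. irreducible p \<and> e p = peval P"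
proof -
  interpret h: comm_ring_hom \<Psi> using m by (simp add: mpoly_model_def)
  have pe: "peval (\<Psi> p) x = e p x" for p x using m by (simp add: mpoly_model_def)
  obtain p where p: "\<Psi> p = P" using m P unfolding mpoly_model_def by blast
  have unit: "a dvd 1" if a: "\<Psi> a dvd 1" for a
  proof -
    obtain U where U: "1 = \<Psi> a * U" using a by (rule dvdE)
    \<comment> \<open>An inverse \<open>U\<close> of \<open>\<Psi> a\<close> could involve variables
      outside \<open>I\<close>. Setting these to 0 does not affect \<open>e a\<close> and turns the
      inverse into a polynomial function in \<open>I\<close>.\<close>
    let ?t = "\<lambda>x i. if i \<in> I then x i else (0::'a)"
    have "polyfun I (tdeg U) (\<lambda>x. peval U (?t x))"
      by (rule polyfun_truncate[of "vars U"]) (auto intro: polyfun_peval)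
    moreover have "e a x * peval U (?t x) = 1" for x
    proof -
      obtain n where "polyfun I n (e a)" using poly_modelD(3)[OF e] by blast
      then have "e a x = e a (?t x)" by (rule polyfun_cong_on) auto
      then have "e a x * peval U (?t x) = peval (\<Psi> a * U) (?t x)" by (simp add: peval_mult pe)
      then show ?thesis by (simp add: U[symmetric] peval_1)
    qed
    ultimately show ?thesis by (rule poly_model_unit[OF e])
  qed
  have "irreducible p"
  proof (rule irreducibleI)
    show "p \<noteq> 0" using p P by auto
    show "\<not> p dvd 1" using p P h.hom_dvd_1 by (auto simp: irreducible_def)
    fix a b assume "p = a * b"
    then have "P = \<Psi> a * \<Psi> b" using p by (simp add: h.hom_mult)
    then show "a dvd 1 \<or> b dvd 1" using P unit by (auto simp: irreducible_def)
  qed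
  moreover have "e p = peval P" using pe p by auto
  ultimately show ?thesis by blast
qed

section \<open>Discriminants and triangular systems\<close>

lemma resultant_irreducible_nonzero:
  fixes p q :: "'r::{factorial_ring_gcd,semiring_gcd_mult_normalize} poly"
  assumes "irreducible p" "\<not> p dvd q"
  shows "resultant p q \<noteq> 0"
proof -
  have "gcd p q dvd 1"
    using irreducibleD'[OF assms(1), of "gcd p q"] assms(2) by (meson dvd_trans gcd_dvd1 gcd_dvd2)
  then have "degree (gcd p q) = 0" by (auto simp: is_unit_poly_iff)
  then show ?thesis unfolding resultant_0_gcd by simp
qed

lemma resultant_common_root:
  fixes p q :: "'a::field_gcd poly"
  assumes "p \<noteq> 0" "poly p t = 0" "poly q t = 0"
  shows "resultant p q = 0"
proof -
  have "[:-t, 1:] dvd gcd p q" using assms by (simp add: poly_eq_0_iff_dvd)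
  moreover have "gcd p q \<noteq> 0" using assms by simp
  ultimately have "degree [:-t, 1:] \<le> degree (gcd p q)" by (rule dvd_imp_degree_le)
  then show ?thesis unfolding resultant_0_gcd by simp
qed

lemma poly_model_indep:
  assumes "poly_model I e" "i \<notin> I"
  shows "e c (x(i := t)) = e c x"
proof -
  obtain n where "polyfun I n (e c)" using poly_modelD(3)[OF assms(1)] by blast
  then show ?thesis by (rule polyfun_cong_on) (use assms in auto)
qed

text \<open>An irreducible \<open>p\<close> not dividing \<open>q\<close> is coprime to it, so their
  resultant is nonzero and eliminating \<open>x i\<close> yields a genuine relation between the
  remaining variables.\<close>

lemma poly_model_eliminate:
  fixes e :: "'r::{factorial_ring_gcd,semiring_gcd_mult_normalize} \<Rightarrow> (nat \<Rightarrow> 'a::{field_char_0,field_gcd}) \<Rightarrow> 'a"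
  assumes e: "poly_model I e" and p: "irreducible p" "\<not> p dvd q"
  shows "\<exists>r n. polyfun I n r \<and> (\<exists>x. r x \<noteq> 0) \<and>
    (\<forall>x. ev_step i e p x = 0 \<longrightarrow> ev_step i e q x = 0 \<longrightarrow> r x = 0)"
proof -
  interpret h: comm_ring_hom "\<lambda>c. e c x" for x using poly_modelD(1)[OF e] .
  \<comment> \<open>The resultant commutes with evaluation at \<open>x\<close> as long as both
    degrees survive. The leading coefficients are multiplied in so that they may be assumed nonzero
    at \<open>x\<close>.\<close>
  define c where "c = resultant p q * lead_coeff p * lead_coeff q"
  have "p \<noteq> 0" "q \<noteq> 0" using p by auto
  then have "c \<noteq> 0" using resultant_irreducible_nonzero[OF p] by (simp add: c_def)
  then have "\<exists>x. e c x \<noteq> 0" using poly_modelD(2)[OF e, of c] by auto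
  moreover obtain n where "polyfun I n (e c)" using poly_modelD(3)[OF e] by blast
  moreover have "e c x = 0" if z: "ev_step i e p x = 0" "ev_step i e q x = 0" for x
  proof (rule ccontr)
    assume "e c x \<noteq> 0"
    then have nz: "e (resultant p q) x \<noteq> 0" "e (lead_coeff p) x \<noteq> 0" "e (lead_coeff q) x \<noteq> 0"
      by (auto simp: c_def h.hom_mult)
    have deg: "degree (map_poly (\<lambda>c. e c x) r) = degree r" if "e (lead_coeff r) x \<noteq> 0" for r
      by (rule map_poly_degree_eq) (use that in simp)
    have "map_poly (\<lambda>c. e c x) p \<noteq> 0" using nz(2) by (metis coeff_0 coeff_map_poly h.hom_zero)
    then have "resultant (map_poly (\<lambda>c. e c x) p) (map_poly (\<lambda>c. e c x) q) = 0"
      using z unfolding ev_step_def by (rule resultant_common_root)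
    then show False using h.resultant_map_poly[OF deg deg, of p q] nz by simp
  qed
  ultimately show ?thesis by blast
qed

text \<open>Up to a nonzero constant \<open>R\<close> is the discriminant of the sheared polynomial.
  It is not identically zero because an irreducible polynomial cannot divide its derivative, which
  is nonzero of smaller degree. The Sylvester matrix has order at most \<open>2 * D\<close> and
  entries of degree at most \<open>D\<close>.\<close>

lemma discriminant_shear:
  fixes e :: "'r::{factorial_ring_gcd,semiring_gcd_mult_normalize} \<Rightarrow> (nat \<Rightarrow> real) \<Rightarrow> real"
  assumes e: "poly_model I e" and i: "i \<notin> I" and p: "irreducible p"
    and D: "polyfun (insert i I) D (ev_step i e p)"
  shows "\<exists>a d c g R. a i = 0 \<and> (\<forall>j. j \<notin> insert i I \<longrightarrow> a j = 0) \<and> d \<le> D \<and> c \<noteq> 0 \<and>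
    (\<forall>k. polyfun I D (g k)) \<and> (\<forall>x. ev_step i e p (shear i a x) = c * monic_fun i d g x) \<and>
    polyfun I (2 * D * D) R \<and> (\<exists>x. R x \<noteq> 0) \<and>
    (\<forall>x. monic_fun i d g x = 0 \<longrightarrow> poly (pderiv (monic_poly d g x)) (x i) = 0 \<longrightarrow> R x = 0)"
proof -
  interpret h: comm_ring_hom "\<lambda>c. e c x" for x using poly_modelD(1)[OF e] .
  have E: "poly_model (insert i I) (ev_step i e)" by (rule poly_model_step[OF e i])
  have "\<exists>x. ev_step i e p x \<noteq> 0" using poly_modelD(2)[OF E, of p] p by auto
  then obtain x0 where "ev_step i e p x0 \<noteq> 0" by blast
  then obtain a d c g where a: "a i = 0" "\<And>j. j \<notin> insert i I \<Longrightarrow> a j = 0" and d: "d \<le> D" and c: "c \<noteq> 0"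
    and g: "\<And>k. polyfun (insert i I - {i}) d (g k)"
    and eq: "\<And>x. ev_step i e p (shear i a x) = c * monic_fun i d g x"
    by (rule polyfun_shear_monic[OF D, of x0 i]) auto
  have gI: "polyfun (I - {i}) d (g k)" for k using g i by simp
  have gD: "polyfun I D (g k)" for k using g i d by (auto intro: polyfun_mono)
  have "polyfun (insert i I) D (\<lambda>x. ev_step i e p (shear i a x))"
    using polyfun_shear[OF D, of i a] by simp
  then obtain q where q: "ev_step i e q = (\<lambda>x. ev_step i e p (shear i a x))" using poly_modelD(4)[OF E] by metis
  have irr: "irreducible q"
    by (rule poly_model_irreducible_shear[OF E p, of q i a]) (use q a in auto)
  have mq: "map_poly (\<lambda>c. e c x) q = smult c (monic_poly d g x)" for x
  proof -
    have "poly (map_poly (\<lambda>c. e c x) q) t = poly (smult c (monic_poly d g x)) t" for t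
      using fun_cong[OF q, of "x(i := t)"] eq[of "x(i := t)"] poly_monic_poly[OF gI, where d=d and x=x and t=t]
      by (simp add: ev_step_def poly_model_indep[OF e i])
    then show ?thesis by (simp add: poly_eq_poly_eq_iff[symmetric] fun_eq_iff)
  qed
  have cq: "e (coeff q k) x = c * coeff (monic_poly d g x) k" for k x
    using arg_cong[OF mq[of x], of "\<lambda>p. coeff p k"] by (simp add: coeff_map_poly)
  have dq: "degree q = d"
  proof (rule antisym)
    have "coeff q k = 0" if "k > d" for k
      by (rule poly_modelD(2)[OF e]) (use that in \<open>simp add: cq coeff_monic_poly\<close>)
    then show "degree q \<le> d" by (intro degree_le) auto
    have "e (coeff q d) (\<lambda>_. 0) \<noteq> 0" using c by (simp add: cq coeff_monic_poly)
    then have "coeff q d \<noteq> 0" by auto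
    then show "d \<le> degree q" by (rule le_degree)
  qed
  \<comment> \<open>A constant would be a unit. Positive degree is what makes the derivative
    nonzero.\<close>
  have d0: "d > 0"
  proof (rule ccontr)
    assume "\<not> d > 0"
    then have "ev_step i e q x * inverse c = 1" for x
      using eq[of x] c unfolding q by (simp add: monic_fun_def)
    then have "q dvd 1" by (rule poly_model_unit[OF E polyfun.const[of _ 0 "inverse c"]])
    then show False using irr by (auto simp: irreducible_def)
  qed
  have mpd: "map_poly (\<lambda>c. e c x) (pderiv q) = pderiv (smult c (monic_poly d g x))" for x
    unfolding mq[symmetric]
    by (rule poly_eqI) (simp add: coeff_map_poly coeff_pderiv h.hom_mult h.hom_add h.hom_of_nat)
  have dpd: "degree (pderiv (smult c (monic_poly d g x))) = d - 1" for x
    using c by (simp add: degree_pderiv degree_monic_poly)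
  have dpq: "degree (pderiv q) = d - 1"
  proof (rule antisym)
    show "degree (pderiv q) \<le> d - 1" using degree_pderiv_le[of q] dq by simp
    have "degree (map_poly (\<lambda>c. e c (\<lambda>_. 0)) (pderiv q)) \<le> degree (pderiv q)" by (rule degree_map_poly_le)
    then show "d - 1 \<le> degree (pderiv q)" unfolding mpd dpd .
  qed
  have "\<not> q dvd pderiv q"
  proof
    assume dv: "q dvd pderiv q"
    have "pderiv (smult c (monic_poly d g (\<lambda>_. 0))) \<noteq> 0"
      using c d0 by (simp add: pderiv_eq_0_iff degree_monic_poly)
    then have "pderiv q \<noteq> 0" using mpd[of "\<lambda>_. 0"] by auto
    then have "degree q \<le> degree (pderiv q)" using dv by (rule dvd_imp_degree_le[rotated])
    then show False using dq dpq d0 by simp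
  qed
  then have "resultant q (pderiv q) \<noteq> 0" using irr by (rule resultant_irreducible_nonzero[rotated])
  then obtain x1 where x1: "e (resultant q (pderiv q)) x1 \<noteq> 0" using poly_modelD(2)[OF e] by blast
  define R where "R x = resultant (smult c (monic_poly d g x)) (pderiv (smult c (monic_poly d g x)))" for x
  have "R x1 = e (resultant q (pderiv q)) x1"
    using h.resultant_map_poly[of x1 q "pderiv q"] c
    unfolding R_def mq mpd dpd dq dpq by (simp add: degree_monic_poly)
  then have R1: "\<exists>x. R x \<noteq> 0" using x1 by (intro exI[of _ x1]) simp
  have pc: "polyfun I D (\<lambda>x. coeff (smult c (monic_poly d g x)) k)" for k
    unfolding coeff_smult by (intro polyfun_cmult polyfun_coeff_monic_poly gD)
  have "polyfun I ((d + (d - 1)) * D) R"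
    unfolding R_def
  proof (rule polyfun_resultant)
    show "polyfun I D (\<lambda>x. coeff (pderiv (smult c (monic_poly d g x))) k)" for k
      unfolding coeff_pderiv by (intro polyfun_cmult pc)
  qed (use pc c in \<open>auto simp: dpd degree_monic_poly\<close>)
  then have R2: "polyfun I (2 * D * D) R"
    by (rule polyfun_mono) (use d in auto)
  have R3: "R x = 0" if "monic_fun i d g x = 0" "poly (pderiv (monic_poly d g x)) (x i) = 0" for x
    unfolding R_def
    by (rule resultant_common_root[of _ "x i"])
      (use that c poly_monic_poly[OF gI, where d=d and x=x and t="x i"] in \<open>auto simp: monic_poly_nonzero pderiv_smult\<close>)
  show ?thesis
    by (intro exI[of _ a] exI[of _ d] exI[of _ c] exI[of _ g] exI[of _ R])
      (use a d c gD eq R1 R2 R3 in auto)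
qed

section \<open>The real triangular system and its complexification\<close>

lemma polyfun_complexify:
  assumes "polyfun I n (f :: (nat \<Rightarrow> real) \<Rightarrow> real)"
  shows "\<exists>F. polyfun I n F \<and> (\<forall>x. F (\<lambda>i. complex_of_real (x i)) = complex_of_real (f x))"
  using assms
proof (induction rule: polyfun.induct)
  case (const n c)
  then show ?case by (intro exI[of _ "\<lambda>_. of_real c"]) (auto intro: polyfun.const)
next
  case (var i n)
  then show ?case by (intro exI[of _ "\<lambda>x. x i"]) (auto intro: polyfun.var)
next
  case (add n f g)
  then obtain F G where "polyfun I n F" "\<forall>x. F (\<lambda>i. complex_of_real (x i)) = complex_of_real (f x)"
    "polyfun I n G" "\<forall>x. G (\<lambda>i. complex_of_real (x i)) = complex_of_real (g x)" by auto
  then show ?case by (intro exI[of _ "\<lambda>x. F x + G x"]) (auto intro: polyfun.add)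
next
  case (mult n f m g)
  then obtain F G where "polyfun I n F" "\<forall>x. F (\<lambda>i. complex_of_real (x i)) = complex_of_real (f x)"
    "polyfun I m G" "\<forall>x. G (\<lambda>i. complex_of_real (x i)) = complex_of_real (g x)" by auto
  then show ?case by (intro exI[of _ "\<lambda>x. F x * G x"]) (auto intro: polyfun.mult)
qed

abbreviation "ev3 \<equiv> ev_step 2 (ev_step 1 (ev_step 0 (\<lambda>c (_::nat \<Rightarrow> 'a::field_char_0). c)))"

lemma poly_model_ev3: "poly_model {2, 1, 0} (ev3 :: _ \<Rightarrow> (nat \<Rightarrow> 'a::field_char_0) \<Rightarrow> 'a)"
  by (intro poly_model_step poly_model_const) auto

text \<open>The directional derivative in question is the one along which \<open>P\<close> is monic
  after the first shear. Where it vanishes on the zero set, so does the discriminant, and it is the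
  discriminant, free of \<open>x 3\<close>, that the second shear makes monic in
  \<open>x 2\<close>.\<close>

lemma triangular_system_real:
  assumes P: "irreducible P" "vars P \<subseteq> {..<4}" "tdeg P \<le> D"
  shows "\<exists>(a1 :: nat \<Rightarrow> real) (a2 :: nat \<Rightarrow> real) d1 d2 G1 G2.
    a1 3 = 0 \<and> (\<forall>j\<ge>4. a1 j = 0) \<and> (\<forall>j\<ge>2. a2 j = 0) \<and> d1 \<le> D \<and> d2 \<le> 2 * D * D \<and>
    (\<forall>k. polyfun {0,1,2} D (G1 k)) \<and> (\<forall>k. polyfun {0,1} (2 * D * D) (G2 k)) \<and>
    (\<forall>x y. y = shear 3 a1 (shear 2 a2 x) \<longrightarrow> peval P y = 0 \<longrightarrow>
       (monic_fun 3 d1 G1 (\<lambda>i. complex_of_real (x i)) = 0 \<and> monic_fun 2 d2 G2 (\<lambda>i. complex_of_real (x i)) = 0) \<or>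
       (\<exists>v t. t \<noteq> 0 \<and> ((\<lambda>s. peval P (\<lambda>i. y i + s * v i)) has_real_derivative t) (at 0)))"
proof -
  have E: "poly_model {3, 2, 1, 0} (ev_step 3 (ev3 :: _ \<Rightarrow> (nat \<Rightarrow> real) \<Rightarrow> real))"
    by (rule poly_model_step[OF poly_model_ev3]) auto
  have M: "\<exists>\<Psi>. mpoly_model {3, 2, 1, 0} \<Psi> (ev_step 3 (ev3 :: _ \<Rightarrow> (nat \<Rightarrow> real) \<Rightarrow> real))"
    by (rule exI, rule mpoly_model_step[OF mpoly_model_step[OF mpoly_model_step[OF mpoly_model_step[OF mpoly_model_const]]]])
  have I4: "{..<4} = {3, 2, 1, 0::nat}" by auto
  obtain \<Psi> where \<Psi>: "mpoly_model {3, 2, 1, 0} \<Psi> (ev_step 3 (ev3 :: _ \<Rightarrow> (nat \<Rightarrow> real) \<Rightarrow> real))"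
    using M by (elim exE)
  obtain p where p: "irreducible p" "ev_step 3 ev3 p = peval P"
    using mpoly_irreducible_model[OF \<Psi> E P(1)] P(2) unfolding I4 by auto
  have D: "polyfun (insert 3 {2, 1, 0}) D (ev_step 3 ev3 p)"
    unfolding p(2) by (rule polyfun_peval) (use P I4 in auto)
  have i3: "3 \<notin> {2,1,0::nat}" by auto
  obtain a1 d1 c1 g R where H: "a1 3 = 0 \<and> (\<forall>j. j \<notin> insert 3 {2,1,0} \<longrightarrow> a1 j = 0) \<and> d1 \<le> D \<and> c1 \<noteq> 0 \<and>
    (\<forall>k. polyfun {2,1,0} D (g k)) \<and> (\<forall>x. peval P (shear 3 a1 x) = c1 * monic_fun 3 d1 g x) \<and>
    polyfun {2,1,0} (2 * D * D) R \<and> (\<exists>x. R x \<noteq> 0) \<and>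
    (\<forall>x. monic_fun 3 d1 g x = 0 \<longrightarrow> poly (pderiv (monic_poly d1 g x)) (x 3) = 0 \<longrightarrow> R x = 0)"
    using discriminant_shear[OF poly_model_ev3 i3 p(1) D, unfolded p(2)] by (elim exE) (rule that, assumption)
  then have a1: "a1 3 = 0" "\<forall>j. j \<notin> {3,2,1,0} \<longrightarrow> a1 j = 0" and d1: "d1 \<le> D" and c1: "c1 \<noteq> 0"
    and g: "\<forall>k. polyfun {2,1,0} D (g k)" and eq1: "\<forall>x. peval P (shear 3 a1 x) = c1 * monic_fun 3 d1 g x"
    and R: "polyfun {2,1,0} (2 * D * D) R" "\<exists>x. R x \<noteq> 0"
      "\<forall>x. monic_fun 3 d1 g x = 0 \<longrightarrow> poly (pderiv (monic_poly d1 g x)) (x 3) = 0 \<longrightarrow> R x = 0"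
    by blast+
  obtain x0 where x0: "R x0 \<noteq> 0" using R by auto
  obtain a2 d2 c2 h where a2: "a2 2 = 0" "\<And>j. j \<notin> {2,1,0} \<Longrightarrow> a2 j = 0" and d2: "d2 \<le> 2 * D * D" and c2: "c2 \<noteq> 0"
    and h: "\<And>k. polyfun ({2,1,0} - {2}) d2 (h k)" and eq2: "\<And>x. R (shear 2 a2 x) = c2 * monic_fun 2 d2 h x"
    by (rule polyfun_shear_monic[OF R(1) x0, of 2]) auto
  \<comment> \<open>The first equation is rewritten in the coordinates of the second shear; it stays
    monic in \<open>x 3\<close> because \<open>a2 3 = 0\<close>.\<close>
  define g' where "g' k x = g k (shear 2 a2 x)" for k x
  have g': "polyfun {0,1,2} D (g' k)" for k
    unfolding g'_def using polyfun_shear[OF g[rule_format], of 2] by (simp add: insert_commute)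
  have h': "polyfun {0,1} (2 * D * D) (h k)" for k
    by (rule polyfun_mono[OF h]) (use d2 in auto)
  have a23: "a2 3 = 0" "\<forall>j\<ge>2. a2 j = 0" using a2 by (auto simp: le_eq_less_or_eq)
  obtain G1 where G1: "\<And>k. polyfun {0,1,2} D (G1 k)" "\<And>k x. G1 k (\<lambda>i. complex_of_real (x i)) = of_real (g' k x)"
    using polyfun_complexify[OF g'] by metis
  obtain G2 where G2: "\<And>k. polyfun {0,1} (2 * D * D) (G2 k)" "\<And>k x. G2 k (\<lambda>i. complex_of_real (x i)) = of_real (h k x)"
    using polyfun_complexify[OF h'] by metis
  have main: "(monic_fun 3 d1 G1 (\<lambda>i. complex_of_real (x i)) = 0 \<and> monic_fun 2 d2 G2 (\<lambda>i. complex_of_real (x i)) = 0) \<or>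
       (\<exists>v t. t \<noteq> 0 \<and> ((\<lambda>s. peval P (\<lambda>i. y i + s * v i)) has_real_derivative t) (at 0))"
    if y: "y = shear 3 a1 (shear 2 a2 x)" "peval P y = 0" for x y
  proof -
    define x' where "x' = shear 2 a2 x"
    have x'3: "x' 3 = x 3" using a23 by (simp add: x'_def shear_def)
    have m1: "monic_fun 3 d1 g x' = 0" using eq1 y c1 by (simp add: x'_def)
    have "monic_fun 3 d1 G1 (\<lambda>i. complex_of_real (x i)) = of_real (monic_fun 3 d1 g x')"
      using x'3 by (simp add: monic_fun_def G1 g'_def x'_def)
    then have 1: "monic_fun 3 d1 G1 (\<lambda>i. complex_of_real (x i)) = 0" using m1 by simp
    have 2: "monic_fun 2 d2 G2 (\<lambda>i. complex_of_real (x i)) = of_real (monic_fun 2 d2 h x)"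
      by (simp add: monic_fun_def G2)
    define t where "t = c1 * poly (pderiv (monic_poly d1 g x')) (x' 3)"
    show ?thesis
    proof (cases "t = 0")
      case True
      then have "R x' = 0" using R(3) m1 c1 by (simp add: t_def)
      then have "monic_fun 2 d2 h x = 0" using eq2 c2 by (simp add: x'_def)
      then show ?thesis using 1 2 by simp
    next
      case False
      \<comment> \<open>The image of the unit vector in direction 3 under the first shear: moving
        \<open>y\<close> along \<open>v\<close> changes only the coordinate
        \<open>x' 3\<close>.\<close>
      define v where "v = a1(3 := 1)"
      have gi: "polyfun ({2,1,0,3} - {3}) D (g k)" for k by (rule polyfun_mono[OF g[rule_format]]) auto
      have "peval P (\<lambda>i. y i + s * v i) = c1 * poly (monic_poly d1 g x') (x' 3 + s)" for s
      proof -
        have "(\<lambda>i. y i + s * v i) = shear 3 a1 (x'(3 := x' 3 + s))"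
          unfolding y(1) x'_def[symmetric] using a1(1) by (auto simp: shear_def v_def fun_eq_iff algebra_simps)
        then show ?thesis using eq1 poly_monic_poly[OF gi, where d=d1 and x=x' and t="x' 3 + s"] by simp
      qed
      moreover have "((\<lambda>s. c1 * poly (monic_poly d1 g x') (x' 3 + s)) has_real_derivative t) (at 0)"
        unfolding t_def by (auto intro!: derivative_eq_intros simp: algebra_simps)
      ultimately have "((\<lambda>s. peval P (\<lambda>i. y i + s * v i)) has_real_derivative t) (at 0)" by (simp only:)
      then show ?thesis using False by blast
    qed
  qed
  show ?thesis
    by (intro exI[of _ a1] exI[of _ a2] exI[of _ d1] exI[of _ d2] exI[of _ G1] exI[of _ G2] conjI allI impI;
      (rule main; assumption | use a1 a23 d1 d2 G1(1) G2(1) in simp))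
qed

section \<open>Prime closed sets and finite planar sets\<close>

text \<open>The variables are indexed by literals; rewriting \<open>1\<close> to \<open>Suc 0\<close> would hide them from rewrite rules.\<close>

declare One_nat_def [simp del]

text \<open>In a direction where neither top form vanishes, the restrictions of \<open>f\<close> and
  \<open>g\<close> have exact degrees, and these add. Divisibility in the nested model says nothing
  about total degree, so bounds for factors come from here.\<close>

lemma polyfun_factor_degree:
  fixes f g :: "(nat \<Rightarrow> 'a::field_char_0) \<Rightarrow> 'a"
  assumes fg: "polyfun I n (\<lambda>x. f x * g x)" and f: "polyfun I m f" and g: "polyfun I k g" "g y \<noteq> 0"
  shows "polyfun I n f"
proof (cases "\<exists>x. f x \<noteq> 0")
  case False
  then have "f = (\<lambda>_. 0)" by auto
  then show ?thesis by (simp add: polyfun.const)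
next
  case True
  then obtain x where x: "f x \<noteq> 0" by auto
  obtain m' h where mh': "m' \<le> m \<and> polyfun I m' f \<and> polyfun I m' h \<and> (\<exists>v. h v \<noteq> 0) \<and>
    (\<forall>v s. h (\<lambda>i. s * v i) = s ^ m' * h v) \<and>
    (\<forall>v. \<exists>p. degree p \<le> m' \<and> coeff p m' = h v \<and> (\<forall>s. poly p s = f (\<lambda>i. s * v i)))"
    using polyfun_top_form[OF f x] by (elim exE) (rule that, assumption)
  then have mh: "polyfun I m' f" "polyfun I m' h" "\<exists>v. h v \<noteq> 0"
    "\<forall>v. \<exists>p. degree p \<le> m' \<and> coeff p m' = h v \<and> (\<forall>s. poly p s = f (\<lambda>i. s * v i))"
    by blast+
  obtain k' h' where kh': "k' \<le> k \<and> polyfun I k' g \<and> polyfun I k' h' \<and> (\<exists>v. h' v \<noteq> 0) \<and>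
    (\<forall>v s. h' (\<lambda>i. s * v i) = s ^ k' * h' v) \<and>
    (\<forall>v. \<exists>p. degree p \<le> k' \<and> coeff p k' = h' v \<and> (\<forall>s. poly p s = g (\<lambda>i. s * v i)))"
    using polyfun_top_form[OF g] by (elim exE) (rule that, assumption)
  then have kh: "polyfun I k' h'" "\<exists>v. h' v \<noteq> 0"
    "\<forall>v. \<exists>p. degree p \<le> k' \<and> coeff p k' = h' v \<and> (\<forall>s. poly p s = g (\<lambda>i. s * v i))"
    by blast+
  obtain v where v: "h v \<noteq> 0" "h' v \<noteq> 0"
    using polyfun_mult_nonzero[OF mh(2) kh(1)] mh(3) kh(2) by blast
  obtain p where p: "degree p \<le> m'" "coeff p m' = h v" "\<forall>s. poly p s = f (\<lambda>i. s * v i)" using mh(4) by blast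
  obtain q where q: "degree q \<le> k'" "coeff q k' = h' v" "\<forall>s. poly q s = g (\<lambda>i. s * v i)" using kh(3) by blast
  obtain r where r: "degree r \<le> n" "\<forall>s. poly r s = f (\<lambda>i. 0 + s * v i) * g (\<lambda>i. 0 + s * v i)"
    using polyfun_line[OF fg, of "\<lambda>_. 0" v] by auto
  have "poly (p * q) s = poly r s" for s using p(3) q(3) r(2) by simp
  then have pq: "p * q = r" by (simp add: poly_eq_poly_eq_iff[symmetric] fun_eq_iff)
  have "degree p = m'" using p v by (intro antisym le_degree) auto
  moreover have "p \<noteq> 0" "q \<noteq> 0" using p q v by auto
  ultimately have "m' \<le> n" using r(1) pq degree_mult_eq[of p q] by simp
  then show ?thesis using mh(1) by (auto intro: polyfun_mono)
qed

text \<open>A complex polynomial with no root other than 0 is a monomial.\<close>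

lemma complex_poly_two_coeffs_nonzero_root:
  fixes Q :: "complex poly"
  assumes "coeff Q k \<noteq> 0" "coeff Q l \<noteq> 0" "k \<noteq> l"
  shows "\<exists>t. poly Q t = 0 \<and> t \<noteq> 0"
proof (rule ccontr)
  assume no: "\<not> ?thesis"
  have "Q \<noteq> 0" using assms by auto
  then obtain R where R: "Q = [:-0, 1:] ^ order 0 Q * R" "\<not> [:-0, 1:] dvd R" using order_decomp by blast
  have "poly R 0 \<noteq> 0" using R(2) by (simp add: poly_eq_0_iff_dvd)
  have "degree R = 0"
  proof (rule ccontr)
    assume "degree R \<noteq> 0"
    then obtain t where t: "poly R t = 0" using alg_closed_imp_poly_has_root[of R] by auto
    then have "poly Q t = 0" by (subst R(1)) simp
    then show False using no t \<open>poly R 0 \<noteq> 0\<close> by auto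
  qed
  then obtain c where "R = [:c:]" by (elim degree_eq_zeroE)
  moreover have "[:0, 1::complex:] = monom 1 1" by (simp add: monom_altdef)
  ultimately have "Q = monom c (order 0 Q)" using R(1) by (simp add: monom_altdef)
  then show False using assms by (metis coeff_monom)
qed

lemma poly_sum_monom: "poly (\<Sum>k\<le>K. monom (c k) k) t = (\<Sum>k\<le>K. c k * (t :: 'a::comm_ring_1) ^ k)"
  by (simp add: poly_sum poly_monom)

section \<open>Closed and prime sets through polynomial functions\<close>

definition pf4 :: "((nat \<Rightarrow> complex) \<Rightarrow> complex) \<Rightarrow> bool" where
  "pf4 g \<longleftrightarrow> (\<exists>n. polyfun {..<4} n g)"

lemma pf4I: "polyfun I n g \<Longrightarrow> I \<subseteq> {..<4} \<Longrightarrow> pf4 g"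
  unfolding pf4_def by (blast intro: polyfun_mono)

lemma pf4_const: "pf4 (\<lambda>_. c)"
  by (rule pf4I[OF polyfun.const[of "{}" 0]]) auto

lemma pf4_mult: "pf4 f \<Longrightarrow> pf4 g \<Longrightarrow> pf4 (\<lambda>x. f x * g x)"
  unfolding pf4_def by (blast intro: polyfun.mult)

lemma pf4_add: assumes "pf4 f" "pf4 g" shows "pf4 (\<lambda>x. f x + g x)"
proof -
  obtain n m where "polyfun {..<4} n f" "polyfun {..<4} m g" using assms by (auto simp: pf4_def)
  then have "polyfun {..<4} (max n m) f" "polyfun {..<4} (max n m) g" by (auto intro: polyfun_mono)
  then show ?thesis unfolding pf4_def by (blast intro: polyfun.add)
qed

lemma pf4_sum: "(\<And>k. k \<in> S \<Longrightarrow> pf4 (f k)) \<Longrightarrow> pf4 (\<lambda>x. \<Sum>k\<in>S. f k x)"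
  by (induction S rule: infinite_finite_induct) (auto intro: pf4_const pf4_add)

lemma pf4_power: "pf4 f \<Longrightarrow> pf4 (\<lambda>x. f x ^ k)"
  by (induction k) (auto intro: pf4_const pf4_mult)

text \<open>Zariski closedness as separation of outside points by functions vanishing on
  \<open>V\<close>, so that no system of equations has to be carried along;
  \<open>zclosed_iff_pclosed\<close> identifies the two notions.\<close>

definition pclosed :: "(nat \<Rightarrow> complex) set \<Rightarrow> bool" where
  "pclosed V \<longleftrightarrow> V \<subseteq> aff 4 \<and> (\<forall>x\<in>aff 4 - V. \<exists>g. pf4 g \<and> (\<forall>v\<in>V. g v = 0) \<and> g x \<noteq> 0)"

text \<open>The vanishing ideal of \<open>V\<close> is prime. For closed \<open>V\<close> this is
  irreducibility, by \<open>zirred_iff_pprime\<close>.\<close>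

definition pprime :: "(nat \<Rightarrow> complex) set \<Rightarrow> bool" where
  "pprime V \<longleftrightarrow> V \<noteq> {} \<and> (\<forall>g h. pf4 g \<longrightarrow> pf4 h \<longrightarrow> (\<forall>v\<in>V. g v * h v = 0) \<longrightarrow>
     (\<forall>v\<in>V. g v = 0) \<or> (\<forall>v\<in>V. h v = 0))"

lemma pprimeD:
  assumes "pprime V" "pf4 g" "pf4 h" "\<And>v. v \<in> V \<Longrightarrow> g v * h v = 0"
  shows "(\<forall>v\<in>V. g v = 0) \<or> (\<forall>v\<in>V. h v = 0)"
proof -
  have "pf4 g \<longrightarrow> pf4 h \<longrightarrow> (\<forall>v\<in>V. g v * h v = 0) \<longrightarrow> (\<forall>v\<in>V. g v = 0) \<or> (\<forall>v\<in>V. h v = 0)"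
    using assms(1) unfolding pprime_def by (elim conjE allE)
  then show ?thesis using assms by blast
qed

lemma pprime_powerD:
  assumes "pprime V" "pf4 g" "pf4 h" "\<And>v. v \<in> V \<Longrightarrow> g v ^ k * h v = 0" "w \<in> V" "g w \<noteq> 0"
  shows "\<forall>v\<in>V. h v = 0"
  using pprimeD[OF assms(1) pf4_power[OF assms(2), of k] assms(3,4)] assms(5,6) by auto

text \<open>The incomparability argument for primes in an integral extension. If \<open>n k\<close>
  is the first coefficient not vanishing on all of \<open>V\<close>, the relation there reads
  \<open>h ^ k * r\<close>; primality cancels the power of \<open>h\<close>, and on
  \<open>U\<close>, where \<open>h\<close> vanishes, \<open>r\<close> reduces to \<open>n k\<close>.
  In this way \<open>h\<close> is replaced by a function of the fewer variables on which the
  coefficients depend.\<close>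

lemma lowest_coefficient:
  assumes V: "pprime V" and U: "U \<subseteq> V" and h: "pf4 h" "\<And>u. u \<in> U \<Longrightarrow> h u = 0" "w \<in> V" "h w \<noteq> 0"
    and n: "\<And>k. pf4 (n k)" "\<And>v. v \<in> V \<Longrightarrow> (\<Sum>k\<le>K. n k v * h v ^ k) = 0" "w' \<in> V" "k' \<le> K" "n k' w' \<noteq> 0"
  shows "\<exists>k. (\<forall>u\<in>U. n k u = 0) \<and> (\<exists>v\<in>V. n k v \<noteq> 0)"
proof -
  define k where "k = (LEAST k. k \<le> K \<and> (\<exists>v\<in>V. n k v \<noteq> 0))"
  have k: "k \<le> K" "\<exists>v\<in>V. n k v \<noteq> 0"
    using LeastI[of "\<lambda>k. k \<le> K \<and> (\<exists>v\<in>V. n k v \<noteq> 0)" k'] n unfolding k_def by blast+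
  have low: "n j v = 0" if "j < k" "v \<in> V" for j v
    using not_less_Least[of j "\<lambda>k. k \<le> K \<and> (\<exists>v\<in>V. n k v \<noteq> 0)"] that k(1) unfolding k_def[symmetric] by auto
  define r where "r v = (\<Sum>j\<le>K - k. n (j + k) v * h v ^ j)" for v
  have "pf4 r" unfolding r_def by (intro pf4_sum pf4_mult pf4_power n h)
  moreover have "h v ^ k * r v = 0" if v: "v \<in> V" for v
  proof -
    have "(\<Sum>j\<le>K. n j v * h v ^ j) = (\<Sum>j\<in>{k..K}. n j v * h v ^ j)"
      by (rule sum.mono_neutral_right) (use low v in auto)
    also have "\<dots> = (\<Sum>j\<in>{0+k..(K-k)+k}. n j v * h v ^ j)" using k by simp
    also have "\<dots> = (\<Sum>j\<in>{0..K-k}. n (j + k) v * h v ^ (j + k))"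
      by (rule sum.shift_bounds_cl_nat_ivl)
    also have "\<dots> = h v ^ k * r v"
      unfolding r_def sum_distrib_left atMost_atLeast0 by (rule sum.cong) (auto simp: power_add mult_ac)
    finally show ?thesis using n(2) v by simp
  qed
  ultimately have r: "\<forall>v\<in>V. r v = 0" using pprime_powerD[OF V h(1) _ _ h(3,4)] by blast
  have "n k u = 0" if "u \<in> U" for u
  proof -
    have "r u = (\<Sum>j\<in>{0}. n (j + k) u * h u ^ j)"
      unfolding r_def by (rule sum.mono_neutral_right) (use h that in \<open>auto simp: zero_power\<close>)
    moreover have "r u = 0" using r U that by blast
    ultimately show ?thesis by simp
  qed
  then show ?thesis using k by blast
qed

text \<open>The degree \<open>(2 * d + e + 1) * e\<close> of a norm in \<open>norm_exists\<close>,
  taken at the extreme case \<open>d = e\<close>.\<close>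

definition nbound :: "nat \<Rightarrow> nat" where "nbound e = (3 * e + 1) * e"

lemma nbound_ge: "e \<le> nbound e" by (simp add: nbound_def)

lemma norm_exists_bound:
  fixes g :: "(nat \<Rightarrow> complex) \<Rightarrow> complex"
  assumes "\<And>k. polyfun (I - {i}) e (a k)" "polyfun I e g" "d \<le> e"
  shows "\<exists>N. polyfun (I - {i}) (nbound e) N \<and>
    (\<forall>x. N x = 0 \<longleftrightarrow> (\<exists>t. monic_fun i d a (x(i := t)) = 0 \<and> g (x(i := t)) = 0))"
proof -
  have le: "(2 * d + e + 1) * e \<le> nbound e" unfolding nbound_def using assms(3) by (intro mult_right_mono) auto
  obtain N where N: "polyfun (I - {i}) ((2 * d + e + 1) * e) N"
    "\<forall>x. N x = 0 \<longleftrightarrow> (\<exists>t. monic_fun i d a (x(i := t)) = 0 \<and> g (x(i := t)) = 0)"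
    using norm_exists[where a=a and d=d, OF assms(1,2)] by auto
  show ?thesis using polyfun_mono[OF N(1) order.refl le] N(2) by (intro exI[of _ N] conjI)
qed

lemma monic_roots_card:
  fixes x :: "nat \<Rightarrow> complex"
  assumes "\<And>k. polyfun (I - {i}) e (a k)"
  shows "finite {t. monic_fun i d a (x(i := t)) = 0}" "card {t. monic_fun i d a (x(i := t)) = 0} \<le> d"
proof -
  have "{t. monic_fun i d a (x(i := t)) = 0} = {t. poly (monic_poly d a x) t = 0}"
    using poly_monic_poly[OF assms] by auto
  then show "finite {t. monic_fun i d a (x(i := t)) = 0}" "card {t. monic_fun i d a (x(i := t)) = 0} \<le> d"
    using poly_roots_finite[OF monic_poly_nonzero[of d a x]] card_poly_roots_bound[OF monic_poly_nonzero[of d a x]]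
    by (simp_all add: degree_monic_poly)
qed

text \<open>The variable \<open>i\<close> is auxiliary and carries a value \<open>T\<close>. As a
  polynomial in it, \<open>N\<close> has the root set \<open>Vals x\<close>, and finiteness of this
  set forbids all coefficients to vanish at the same point.\<close>

lemma polyfun_finite_values_relation:
  fixes N :: "(nat \<Rightarrow> complex) \<Rightarrow> complex"
  assumes N: "polyfun I e N" and v: "\<And>x. finite (Vals x)" "\<And>x T. N (x(i := T)) = 0 \<longleftrightarrow> T \<in> Vals x"
  shows "\<exists>n. (\<forall>k. polyfun (I - {i}) e (n k)) \<and> (\<forall>x. \<exists>k\<le>e. n k x \<noteq> 0) \<and>
    (\<forall>x T. (\<Sum>k\<le>e. n k x * T ^ k) = 0 \<longleftrightarrow> T \<in> Vals x)"
proof -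
  obtain n where n: "\<forall>k. polyfun (I - {i}) (e - k) (n k)" "\<forall>x. N x = (\<Sum>k\<le>e. n k x * x i ^ k)"
    using polyfun_expand[OF N] by blast
  have "n k (x(i := T)) = n k x" for k x T by (rule polyfun_cong_on[OF n(1)[rule_format]]) auto
  then have eq: "(\<Sum>k\<le>e. n k x * T ^ k) = 0 \<longleftrightarrow> T \<in> Vals x" for x T
    using n(2)[rule_format, of "x(i := T)"] v(2)[of x T] by simp
  have "\<exists>k\<le>e. n k x \<noteq> 0" for x
  proof (rule ccontr)
    assume "\<not> ?thesis"
    then have "Vals x = UNIV" using eq[of x] by auto
    then show False using v(1)[of x] infinite_UNIV_char_0[where 'a=complex] by simp
  qed
  then show ?thesis using n(1) eq by (intro exI[of _ n]) (auto intro: polyfun_mono)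
qed

text \<open>Noether normalisation of a plane curve: after a shear the curve is finite over one
  linear coordinate, so every polynomial function on it is algebraic over that coordinate. The
  number \<open>v\<close> depends on the curve only and serves all \<open>f\<close>.\<close>

lemma curve_relation:
  fixes a :: "(nat \<Rightarrow> complex) \<Rightarrow> complex"
  assumes a: "polyfun {0,1} m a" "a x0 \<noteq> 0"
  shows "\<exists>v. \<forall>e f. polyfun {0,1} e f \<longrightarrow> (\<exists>K n. (\<forall>k. polyfun {0} K (n k)) \<and> (\<forall>x. \<exists>k\<le>K. n k x \<noteq> 0) \<and>
     (\<forall>x. a x = 0 \<longrightarrow> (\<Sum>k\<le>K. n k (\<lambda>_. x 0 - v * x 1) * f x ^ k) = 0))"
proof -
  obtain w d c g where w: "w 1 = 0" "\<And>j. j \<notin> {0,1} \<Longrightarrow> w j = 0" and c: "c \<noteq> 0"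
    and g: "\<And>k. polyfun ({0,1} - {1}) d (g k)" and eq: "\<And>x. a (shear 1 w x) = c * monic_fun 1 d g x"
    by (rule polyfun_shear_monic[OF a, of 1]) auto
  show ?thesis
  proof (intro exI[of _ "w 0"] allI impI)
    fix e f assume f: "polyfun {0,1} e (f :: (nat \<Rightarrow> complex) \<Rightarrow> complex)"
    define E where "E = e + d + 1"
    \<comment> \<open>Variable 4 stands for the value of \<open>f\<close>: the norm of
      \<open>x 4 - f\<close> along the curve has as its roots the values of \<open>f\<close> over
      the given base coordinate.\<close>
    define f' where "f' x = x 4 - f (shear 1 w x)" for x
    have "polyfun {0,1} e (\<lambda>x. f (shear 1 w x))" using polyfun_shear[OF f, of 1 w] by simp
    then have f': "polyfun {0,1,4} E f'"
      unfolding f'_def E_def by (intro polyfun_diff polyfun_var) (auto intro: polyfun_mono)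
    have gE: "polyfun ({0,1,4} - {1}) E (g k)" for k
      by (rule polyfun_mono[OF g]) (auto simp: E_def)
    obtain N where N: "polyfun ({0,1,4} - {1}) (nbound E) N"
      "\<forall>x. N x = 0 \<longleftrightarrow> (\<exists>t. monic_fun 1 d g (x(1 := t)) = 0 \<and> f' (x(1 := t)) = 0)"
      using norm_exists_bound[where a=g and d=d, OF gE f'] by (auto simp: E_def)
    define Vals where "Vals x = (\<lambda>t. f (shear 1 w (x(1 := t)))) ` {t. monic_fun 1 d g (x(1 := t)) = 0}" for x
    have fin: "finite (Vals x)" for x unfolding Vals_def
      by (intro finite_imageI monic_roots_card[OF g])
    have m4: "monic_fun 1 d g (x(4 := T, 1 := t)) = monic_fun 1 d g (x(1 := t))" for x T t
    proof -
      have "g k (x(4 := T, 1 := t)) = g k (x(1 := t))" for k by (rule polyfun_cong_on[OF g]) auto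
      then show ?thesis by (simp add: monic_fun_def)
    qed
    have f4: "f (shear 1 w (x(4 := T, 1 := t))) = f (shear 1 w (x(1 := t)))" for x T t
      by (rule polyfun_cong_on[OF f]) (auto simp: shear_def)
    have val: "N (x(4 := T)) = 0 \<longleftrightarrow> T \<in> Vals x" for x T
      using N(2)[rule_format, of "x(4 := T)"] by (auto simp: m4 f'_def f4 Vals_def)
    obtain n where n: "\<forall>k. polyfun ({0,1,4} - {1} - {4}) (nbound E) (n k)" "\<forall>x. \<exists>k\<le>nbound E. n k x \<noteq> 0"
      "\<forall>x T. (\<Sum>k\<le>nbound E. n k x * T ^ k) = 0 \<longleftrightarrow> T \<in> Vals x"
      using polyfun_finite_values_relation[OF N(1) fin val] by blast
    have n0: "polyfun {0} (nbound E) (n k)" for k by (rule polyfun_mono[OF n(1)[rule_format]]) auto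
    have "(\<Sum>k\<le>nbound E. n k (\<lambda>_. x 0 - w 0 * x 1) * f x ^ k) = 0" if "a x = 0" for x
    proof -
      define y where "y = shear 1 (\<lambda>j. - w j) x"
      have xy: "shear 1 w y = x" unfolding y_def by (rule shear_inverse) (use w in simp)
      then have "monic_fun 1 d g y = 0" using eq[of y] c that by simp
      moreover have "y(1 := y 1) = y" by simp
      ultimately have "f x \<in> Vals y" unfolding Vals_def using xy by (intro image_eqI[of _ _ "y 1"]) auto
      then have "(\<Sum>k\<le>nbound E. n k y * f x ^ k) = 0" using n(3) by blast
      moreover have "n k y = n k (\<lambda>_. x 0 - w 0 * x 1)" for k
        by (rule polyfun_cong_on[OF n0]) (auto simp: y_def shear_def)
      ultimately show ?thesis by simp
    qed
    then show "\<exists>K n. (\<forall>k. polyfun {0} K (n k)) \<and> (\<forall>x. \<exists>k\<le>K. n k x \<noteq> 0) \<and>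
     (\<forall>x. a x = 0 \<longrightarrow> (\<Sum>k\<le>K. n k (\<lambda>_. x 0 - w 0 * x 1) * f x ^ k) = 0)"
      using n0 n(2) by blast
  qed
qed

text \<open>A complex univariate polynomial splits into linear factors, and primality places
  \<open>V\<close> in the zero set of one factor \<open>z - r\<close>.\<close>

lemma pprime_root:
  assumes V: "pprime V" and z: "pf4 z" and q: "q \<noteq> (0 :: complex poly)" "\<And>v. v \<in> V \<Longrightarrow> poly q (z v) = 0"
  shows "\<exists>r. \<forall>v\<in>V. z v = r"
  using q
proof (induction "degree q" arbitrary: q rule: less_induct)
  case less
  show ?case
  proof (cases "degree q = 0")
    case True
    then obtain c where "q = [:c:]" by (elim degree_eq_zeroE)
    moreover obtain v where "v \<in> V" using V by (auto simp: pprime_def)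
    ultimately have False using less.prems by auto
    then show ?thesis ..
  next
    case False
    then obtain r where "poly q r = 0" using alg_closed_imp_poly_has_root[of q] by auto
    then obtain q1 where q1: "q = [:-r, 1:] * q1" by (auto simp: poly_eq_0_iff_dvd elim: dvdE)
    have "q1 \<noteq> 0" using q1 less.prems by auto
    then have "degree q = degree [:-r, 1:] + degree q1" unfolding q1 by (intro degree_mult_eq) auto
    then have d: "degree q1 < degree q" by simp
    have p1: "pf4 (\<lambda>v. z v + - r)" by (intro pf4_add z pf4_const)
    have p2: "pf4 (\<lambda>v. poly q1 (z v))"
      unfolding poly_altdef by (intro pf4_sum pf4_mult pf4_const pf4_power z)
    have "(\<forall>v\<in>V. z v + - r = 0) \<or> (\<forall>v\<in>V. poly q1 (z v) = 0)"
      by (rule pprimeD[OF V p1 p2]) (use less.prems(2) in \<open>simp add: q1 algebra_simps\<close>)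
    then show ?thesis
    proof
      assume "\<forall>v\<in>V. z v + - r = 0"
      then show ?thesis by (intro exI[of _ r]) auto
    next
      assume "\<forall>v\<in>V. poly q1 (z v) = 0"
      then show ?thesis using less.hyps[OF d \<open>q1 \<noteq> 0\<close>] by blast
    qed
  qed
qed

section \<open>Finite planar sets cut out in bounded degree\<close>

lemma aff2_infinite: "infinite (aff 2 :: (nat \<Rightarrow> complex) set)"
proof
  assume "finite (aff 2 :: (nat \<Rightarrow> complex) set)"
  moreover have "inj (\<lambda>t::complex. (\<lambda>i::nat. if i = 0 then t else 0))"
    by (auto simp: inj_def fun_eq_iff split: if_splits)
  moreover have "range (\<lambda>t::complex. (\<lambda>i::nat. if i = 0 then t else 0)) \<subseteq> aff 2" by (auto simp: aff_def)
  ultimately show False using infinite_UNIV_char_0[where 'a=complex] by (metis finite_imageD finite_subset)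
qed

text \<open>If all norms of members of the family along \<open>g1\<close> vanished, then by
  \<open>avoid_finite_union\<close> every line \<open>u = const\<close> would contain a point of \<open>S\<close>.\<close>

lemma planar_finite_zero_set:
  fixes S :: "(nat \<Rightarrow> complex) set"
  assumes S: "finite S" "S \<subseteq> aff 2"
    and cut: "\<And>x. x \<in> aff 2 - S \<Longrightarrow> \<exists>g. polyfun {0,1} B g \<and> (\<forall>s\<in>S. g s = 0) \<and> g x \<noteq> 0"
  shows "card S \<le> nbound B * B"
proof -
  define \<G> where "\<G> = {g. polyfun {0,1} B g \<and> (\<forall>s\<in>S. g s = 0)}"
  have "aff 2 - S \<noteq> {}" using aff2_infinite S(1) finite_subset[of "aff 2" S] by auto
  then obtain x1 where "x1 \<in> aff 2 - S" by blast
  then obtain g1 where g1: "polyfun {0,1} B g1" "\<forall>s\<in>S. g1 s = 0" "g1 x1 \<noteq> 0" using cut by blast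
  obtain w d c g where w: "w 1 = 0" "\<And>j. j \<notin> {0,1} \<Longrightarrow> w j = 0" and d: "d \<le> B" and c: "c \<noteq> 0"
    and g: "\<And>k. polyfun ({0,1} - {1}) d (g k)" and eq: "\<And>x. g1 (shear 1 w x) = c * monic_fun 1 d g x"
    by (rule polyfun_shear_monic[OF g1(1,3), of 1]) auto
  have gB: "polyfun ({0,1} - {1}) B (g k)" for k by (rule polyfun_mono[OF g]) (use d in auto)
  define \<tau> where "\<tau> = shear 1 w"
  define \<tau>' where "\<tau>' = shear 1 (\<lambda>j. - w j)"
  have inv: "\<tau> (\<tau>' x) = x" "\<tau>' (\<tau> x) = x" for x unfolding \<tau>_def \<tau>'_def using shear_inverse[of w 1] w by auto
  have aff: "\<tau> x \<in> aff 2" "\<tau>' x \<in> aff 2" if "x \<in> aff 2" for x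
    using that w(2) by (auto simp: aff_def \<tau>_def \<tau>'_def shear_def)
  define pt where "pt u t = (\<lambda>i::nat. if i = 0 then u else if i = 1 then t else (0::complex))" for u t
  define Fib where "Fib u = (\<lambda>t. \<tau> (pt u t)) ` {t. monic_fun 1 d g ((pt u 0)(1 := t)) = 0}" for u
  have pt1: "(pt u s)(1 := t) = pt u t" for u s t by (auto simp: pt_def)
  have Fib_fin: "finite (Fib u)" and Fib_card: "card (Fib u) \<le> B" for u
  proof -
    show "finite (Fib u)" unfolding Fib_def by (intro finite_imageI monic_roots_card[OF g])
    have "card (Fib u) \<le> card {t. monic_fun 1 d g ((pt u 0)(1 := t)) = 0}"
      unfolding Fib_def by (rule card_image_le) (rule monic_roots_card[OF g])
    also have "\<dots> \<le> d" by (rule monic_roots_card[OF g])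
    finally show "card (Fib u) \<le> B" using d by simp
  qed
  have norm: "\<exists>N. polyfun ({0,1} - {1}) (nbound B) N \<and>
    (\<forall>x. N x = 0 \<longleftrightarrow> (\<exists>t. monic_fun 1 d g (x(1 := t)) = 0 \<and> f (\<tau> (x(1 := t))) = 0))" if "f \<in> \<G>" for f
  proof (rule norm_exists_bound[OF gB _ d])
    show "polyfun {0,1} B (\<lambda>x. f (\<tau> x))" unfolding \<tau>_def using that by (intro polyfun_shear) (auto simp: \<G>_def)
  qed
  have "\<exists>f\<in>\<G>. \<exists>u. \<forall>y\<in>Fib u. f y \<noteq> 0"
  proof (rule ccontr)
    assume no: "\<not> ?thesis"
    have "\<exists>y\<in>Fib u. y \<in> S" for u
    proof (rule ccontr)
      assume u: "\<not> (\<exists>y\<in>Fib u. y \<in> S)"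
      have "\<exists>f\<in>\<G>. \<forall>y\<in>Fib u. f y \<noteq> 0"
      proof (rule avoid_finite_union)
        show "(\<lambda>x. f x + c * g x) \<in> \<G>" if "f \<in> \<G>" "g \<in> \<G>" for f g c
          using that by (auto simp: \<G>_def intro!: polyfun.add polyfun_cmult)
        show "\<G> \<noteq> {}" using g1 by (auto simp: \<G>_def)
        show "finite (Fib u)" by (rule Fib_fin)
        fix y assume y: "y \<in> Fib u"
        then obtain t where "y = \<tau> (pt u t)" by (auto simp: Fib_def)
        moreover have "pt u t \<in> aff 2" by (auto simp: pt_def aff_def)
        ultimately have "y \<in> aff 2" using aff by simp
        then show "\<exists>g\<in>\<G>. g y \<noteq> 0" using cut[of y] u y by (auto simp: \<G>_def)
      qed
      then show False using no by blast
    qed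
    then obtain y where y: "\<And>u. y u \<in> Fib u" "\<And>u. y u \<in> S" by metis
    have "\<tau>' (y u) 0 = u" for u using y(1)[of u] by (auto simp: Fib_def inv pt_def)
    then have "inj y" by (metis injI)
    then have "infinite (range y)" using infinite_UNIV_char_0[where 'a=complex] by (metis finite_imageD)
    moreover have "range y \<subseteq> S" using y(2) by auto
    ultimately show False using S(1) finite_subset by blast
  qed
  then obtain f u where f: "f \<in> \<G>" and u: "\<forall>y\<in>Fib u. f y \<noteq> 0" by blast
  obtain N where N: "polyfun ({0,1} - {1}) (nbound B) N"
    "\<forall>x. N x = 0 \<longleftrightarrow> (\<exists>t. monic_fun 1 d g (x(1 := t)) = 0 \<and> f (\<tau> (x(1 := t))) = 0)"
    using norm[OF f] by blast
  have "N (pt u 0) \<noteq> 0" using N(2) u by (auto simp: Fib_def pt1)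
  moreover have ptu: "(pt 0 0)(0 := v) = pt v 0" for v by (auto simp: pt_def)
  ultimately have Z: "finite {v. N (pt v 0) = 0}" "card {v. N (pt v 0) = 0} \<le> nbound B"
    using polyfun_root_count[OF N(1), of "pt 0 0" 0 u] by simp_all
  \<comment> \<open>A point of \<open>S\<close> is a common zero of \<open>g1\<close> and
    \<open>f\<close>, so it lies over a root of \<open>N\<close>. There are at most
    \<open>nbound B\<close> roots, with at most \<open>B\<close> points of the curve above
    each.\<close>
  have "S \<subseteq> (\<Union>v\<in>{v. N (pt v 0) = 0}. Fib v)"
  proof
    fix s assume s: "s \<in> S"
    define y where "y = \<tau>' s"
    have y2: "y \<in> aff 2" using s S(2) aff by (auto simp: y_def)
    then have ypt: "y = pt (y 0) (y 1)" by (auto simp: pt_def aff_def fun_eq_iff)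
    have m: "monic_fun 1 d g y = 0" using eq[of y] g1(2) s c inv(1)[of s] by (simp add: y_def \<tau>_def)
    have "f (\<tau> y) = 0" using f s by (simp add: y_def inv \<G>_def)
    then have "N (pt (y 0) 0) = 0" using N(2) m by (subst (asm) (1 2) ypt) (auto simp: pt1)
    moreover have "s \<in> Fib (y 0)"
      unfolding Fib_def by (rule image_eqI[of _ _ "y 1"]) (use m ypt in \<open>auto simp: pt1 y_def inv simp flip: ypt\<close>)
    ultimately show "s \<in> (\<Union>v\<in>{v. N (pt v 0) = 0}. Fib v)" by blast
  qed
  then have "card S \<le> card (\<Union>v\<in>{v. N (pt v 0) = 0}. Fib v)"
    by (rule card_mono[rotated]) (use Z Fib_fin in auto)
  also have "\<dots> \<le> (\<Sum>v\<in>{v. N (pt v 0) = 0}. card (Fib v))" by (rule card_UN_le[OF Z(1)])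
  also have "\<dots> \<le> card {v. N (pt v 0) = 0} * B" using sum_bounded_above[of _ "\<lambda>v. card (Fib v)" B] Fib_card by simp
  also have "\<dots> \<le> nbound B * B" using Z(2) by (intro mult_right_mono) auto
  finally show ?thesis .
qed

section \<open>Surfaces finite over the plane\<close>

text \<open>The single number \<open>b\<close> bounds all degrees. Since both equations are monic,
  fibres are finite over every point of the plane and not merely over generic ones.\<close>

locale triangular =
  fixes d1 d2 b :: nat and G1 G2 :: "nat \<Rightarrow> (nat \<Rightarrow> complex) \<Rightarrow> complex"
  assumes G1: "\<And>k. polyfun {0,1,2} b (G1 k)" and G2: "\<And>k. polyfun {0,1} b (G2 k)"
    and d1: "d1 \<le> b" and d2: "d2 \<le> b"
begin

definition Y :: "(nat \<Rightarrow> complex) set" where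
  "Y = {x \<in> aff 4. monic_fun 3 d1 G1 x = 0 \<and> monic_fun 2 d2 G2 x = 0}"

definition fibre :: "(nat \<Rightarrow> complex) \<Rightarrow> (nat \<Rightarrow> complex) set" where
  "fibre x = {y \<in> Y. y 0 = x 0 \<and> y 1 = x 1}"

definition pt :: "(nat \<Rightarrow> complex) \<Rightarrow> complex \<Rightarrow> complex \<Rightarrow> nat \<Rightarrow> complex" where
  "pt x s t = (\<lambda>i. if i < 2 then x i else if i = 2 then s else if i = 3 then t else 0)"

lemma pt_simps: "pt x s t 0 = x 0" "pt x s t 1 = x 1" "pt x s t 2 = s" "pt x s t 3 = t" "pt x s t \<in> aff 4"
  by (auto simp: pt_def aff_def)

lemma pt_eq: "y \<in> aff 4 \<Longrightarrow> y 0 = x 0 \<Longrightarrow> y 1 = x 1 \<Longrightarrow> y = pt x (y 2) (y 3)"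
  by (auto simp: pt_def aff_def fun_eq_iff less_2_cases_iff not_less One_nat_def)

lemma G1_3: "polyfun ({0,1,2,3} - {3}) b (G1 k)" by (rule polyfun_mono[OF G1]) auto

lemma G2_2: "polyfun ({0,1,2} - {2}) b (G2 k)" by (rule polyfun_mono[OF G2]) auto

lemma monic_G1_cong: "x 0 = y 0 \<Longrightarrow> x 1 = y 1 \<Longrightarrow> x 2 = y 2 \<Longrightarrow> x 3 = y 3 \<Longrightarrow> monic_fun 3 d1 G1 x = monic_fun 3 d1 G1 y"
proof -
  assume a: "x 0 = y 0" "x 1 = y 1" "x 2 = y 2" "x 3 = y 3"
  have "G1 k x = G1 k y" for k by (rule polyfun_cong_on[OF G1]) (use a in auto)
  then show ?thesis using a by (simp add: monic_fun_def)
qed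

lemma monic_G2_cong: "x 0 = y 0 \<Longrightarrow> x 1 = y 1 \<Longrightarrow> x 2 = y 2 \<Longrightarrow> monic_fun 2 d2 G2 x = monic_fun 2 d2 G2 y"
proof -
  assume a: "x 0 = y 0" "x 1 = y 1" "x 2 = y 2"
  have "G2 k x = G2 k y" for k by (rule polyfun_cong_on[OF G2]) (use a in auto)
  then show ?thesis using a by (simp add: monic_fun_def)
qed

lemma fibre_eq: "fibre x = (\<lambda>(s, t). pt x s t) `
   (SIGMA s:{s. monic_fun 2 d2 G2 (x(2 := s)) = 0}. {t. monic_fun 3 d1 G1 ((x(2 := s))(3 := t)) = 0})"
proof -
  have m: "monic_fun 2 d2 G2 (x(2 := s)) = monic_fun 2 d2 G2 (pt x s t)"
    "monic_fun 3 d1 G1 ((x(2 := s))(3 := t)) = monic_fun 3 d1 G1 (pt x s t)" for s t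
    by (rule monic_G2_cong monic_G1_cong; simp add: pt_simps)+
  show ?thesis
  proof (intro equalityI subsetI)
    fix y assume y: "y \<in> fibre x"
    then have e: "y = pt x (y 2) (y 3)" by (intro pt_eq) (auto simp: fibre_def Y_def)
    have "monic_fun 2 d2 G2 (x(2 := y 2)) = 0" "monic_fun 3 d1 G1 ((x(2 := y 2))(3 := y 3)) = 0"
      using y e unfolding m[of "y 2" "y 3"] by (auto simp: fibre_def Y_def simp flip: e)
    then show "y \<in> (\<lambda>(s, t). pt x s t) `
      (SIGMA s:{s. monic_fun 2 d2 G2 (x(2 := s)) = 0}. {t. monic_fun 3 d1 G1 ((x(2 := s))(3 := t)) = 0})"
      using e by (intro image_eqI[of _ _ "(y 2, y 3)"]) auto
  next
    fix y assume "y \<in> (\<lambda>(s, t). pt x s t) `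
      (SIGMA s:{s. monic_fun 2 d2 G2 (x(2 := s)) = 0}. {t. monic_fun 3 d1 G1 ((x(2 := s))(3 := t)) = 0})"
    then obtain s t where "y = pt x s t" "monic_fun 2 d2 G2 (x(2 := s)) = 0" "monic_fun 3 d1 G1 ((x(2 := s))(3 := t)) = 0"
      by auto
    then show "y \<in> fibre x" by (simp add: fibre_def Y_def m[of s t] pt_simps)
  qed
qed

lemma fibre_finite: "finite (fibre x)" and fibre_card: "card (fibre x) \<le> b * b"
proof -
  let ?A = "{s. monic_fun 2 d2 G2 (x(2 := s)) = 0}"
  let ?B = "\<lambda>s. {t. monic_fun 3 d1 G1 ((x(2 := s))(3 := t)) = 0}"
  have A: "finite ?A" "card ?A \<le> d2" by (rule monic_roots_card[OF G2_2])+
  have B: "finite (?B s)" "card (?B s) \<le> d1" for s by (rule monic_roots_card[OF G1_3])+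
  show "finite (fibre x)" unfolding fibre_eq by (intro finite_imageI finite_SigmaI A B)
  have "card (fibre x) \<le> card (Sigma ?A ?B)" unfolding fibre_eq by (intro card_image_le finite_SigmaI A B)
  also have "\<dots> = (\<Sum>s\<in>?A. card (?B s))" by (rule card_SigmaI) (use A B in auto)
  also have "\<dots> \<le> card ?A * d1" using sum_bounded_above[of ?A "\<lambda>s. card (?B s)" d1] B by simp
  also have "\<dots> \<le> b * b" using A d1 d2 by (intro mult_mono) auto
  finally show "card (fibre x) \<le> b * b" .
qed

lemma fibre_cong: "x 0 = y 0 \<Longrightarrow> x 1 = y 1 \<Longrightarrow> fibre x = fibre y"
  by (simp add: fibre_def)

lemma fibre_self: "y \<in> Y \<Longrightarrow> y \<in> fibre y" by (simp add: fibre_def)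

text \<open>Two norms in succession eliminate \<open>x 3\<close> and then \<open>x 2\<close>, whence
  the iterated \<open>nbound\<close>. Variable 4 is a parameter, later used for the value of a
  function on the fibre.\<close>

lemma fibre_norm:
  assumes f: "polyfun {0,1,2,3,4} e f" and e: "b \<le> e"
  shows "\<exists>N. polyfun {0,1,4} (nbound (nbound e)) N \<and> (\<forall>x. N x = 0 \<longleftrightarrow> (\<exists>y\<in>fibre x. f (y(4 := x 4)) = 0))"
proof -
  have g1: "polyfun ({0,1,2,3,4} - {3}) e (G1 k)" for k by (rule polyfun_mono[OF G1]) (use e in auto)
  obtain N1 where N1: "polyfun ({0,1,2,3,4} - {3}) (nbound e) N1"
    "\<forall>x. N1 x = 0 \<longleftrightarrow> (\<exists>t. monic_fun 3 d1 G1 (x(3 := t)) = 0 \<and> f (x(3 := t)) = 0)"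
    using norm_exists_bound[where a=G1 and d=d1, OF g1 f] d1 e by auto
  have N1': "polyfun {0,1,2,4} (nbound e) N1" by (rule polyfun_mono[OF N1(1)]) auto
  have g2: "polyfun ({0,1,2,4} - {2}) (nbound e) (G2 k)" for k
    by (rule polyfun_mono[OF G2]) (use e nbound_ge[of e] in auto)
  obtain N where N: "polyfun ({0,1,2,4} - {2}) (nbound (nbound e)) N"
    "\<forall>x. N x = 0 \<longleftrightarrow> (\<exists>s. monic_fun 2 d2 G2 (x(2 := s)) = 0 \<and> N1 (x(2 := s)) = 0)"
    using norm_exists_bound[where a=G2 and d=d2, OF g2 N1'] d2 e nbound_ge[of e] by auto
  have "N x = 0 \<longleftrightarrow> (\<exists>y\<in>fibre x. f (y(4 := x 4)) = 0)" for x
  proof -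
    have "f ((pt x s t)(4 := x 4)) = f ((x(2 := s))(3 := t))" for s t
      by (rule polyfun_cong_on[OF f]) (auto simp: pt_simps)
    then show ?thesis unfolding fibre_eq using N(2) N1(2) by auto
  qed
  moreover have "polyfun {0,1,4} (nbound (nbound e)) N" by (rule polyfun_mono[OF N(1)]) auto
  ultimately show ?thesis by blast
qed

text \<open>The norm of \<open>x 4 - h\<close> stands in for the characteristic polynomial of
  \<open>h\<close> over the plane. Only its root set is controlled and it need not be monic, so
  nontriviality is asserted at every base point.\<close>

lemma fibre_values:
  assumes h: "pf4 h"
  shows "\<exists>K n. (\<forall>k. polyfun {0,1} K (n k)) \<and> (\<forall>x. \<exists>k\<le>K. n k x \<noteq> 0) \<and>
    (\<forall>x T. (\<Sum>k\<le>K. n k x * T ^ k) = 0 \<longleftrightarrow> T \<in> h ` fibre x)"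
proof -
  obtain m where m: "polyfun {..<4} m h" using h by (auto simp: pf4_def)
  define e where "e = m + b + 1"
  have f: "polyfun {0,1,2,3,4} e (\<lambda>x. x 4 - h x)"
    unfolding e_def by (intro polyfun_diff polyfun_var polyfun_mono[OF m]) auto
  obtain N where N: "polyfun {0,1,4} (nbound (nbound e)) N"
    "\<forall>x. N x = 0 \<longleftrightarrow> (\<exists>y\<in>fibre x. (y(4 := x 4)) 4 - h (y(4 := x 4)) = 0)"
    using fibre_norm[OF f] by (auto simp: e_def)
  have h4: "h (y(4 := T)) = h y" for y T by (rule polyfun_cong_on[OF m]) auto
  have val: "N (x(4 := T)) = 0 \<longleftrightarrow> T \<in> h ` fibre x" for x T
    using N(2)[rule_format, of "x(4 := T)"] fibre_cong[of "x(4 := T)" x] by (auto simp: h4)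
  have fin: "finite (h ` fibre x)" for x by (intro finite_imageI fibre_finite)
  obtain n where n: "\<forall>k. polyfun ({0,1,4} - {4}) (nbound (nbound e)) (n k)" "\<forall>x. \<exists>k\<le>nbound (nbound e). n k x \<noteq> 0"
    "\<forall>x T. (\<Sum>k\<le>nbound (nbound e). n k x * T ^ k) = 0 \<longleftrightarrow> T \<in> h ` fibre x"
    using polyfun_finite_values_relation[where Vals="\<lambda>x. h ` fibre x", OF N(1) fin val] by blast
  have "polyfun {0,1} (nbound (nbound e)) (n k)" for k by (rule polyfun_mono[OF n(1)[rule_format]]) auto
  then show ?thesis using n(2,3) by blast
qed

text \<open>A relation with the nonzero root \<open>h y0\<close> has two nonzero coefficients at
  \<open>y0\<close>. Wherever the same two coefficients are nonzero the relation again has a nonzero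
  root, which is a nonzero value of \<open>h\<close> on the fibre. Their product is the required
  \<open>a\<close>.\<close>

lemma generic_nonvanishing:
  assumes h: "pf4 h" and y0: "y0 \<in> Y" "h y0 \<noteq> 0"
  shows "\<exists>a m. polyfun {0,1} m a \<and> (\<exists>x. a x \<noteq> 0) \<and> (\<forall>x. a x \<noteq> 0 \<longrightarrow> (\<exists>y\<in>fibre x. h y \<noteq> 0))"
proof -
  obtain K n where n: "\<forall>k. polyfun {0,1} K (n k)" "\<forall>x. \<exists>k\<le>K. n k x \<noteq> 0"
    "\<forall>x T. (\<Sum>k\<le>K. n k x * T ^ k) = 0 \<longleftrightarrow> T \<in> h ` fibre x"
    using fibre_values[OF h] by blast
  obtain k where k: "k \<le> K" "n k y0 \<noteq> 0" using n(2) by blast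
  have "\<exists>l\<le>K. l \<noteq> k \<and> n l y0 \<noteq> 0"
  proof (rule ccontr)
    assume no: "\<not> ?thesis"
    have "(\<Sum>j\<le>K. n j y0 * h y0 ^ j) = (\<Sum>j\<in>{k}. n j y0 * h y0 ^ j)"
      by (rule sum.mono_neutral_right) (use no k in auto)
    moreover have "(\<Sum>j\<le>K. n j y0 * h y0 ^ j) = 0" using n(3) fibre_self[OF y0(1)] by blast
    ultimately show False using k y0 by simp
  qed
  then obtain l where l: "l \<le> K" "l \<noteq> k" "n l y0 \<noteq> 0" by blast
  have "\<exists>y\<in>fibre x. h y \<noteq> 0" if nz: "n k x * n l x \<noteq> 0" for x
  proof -
    define Q where "Q = (\<Sum>j\<le>K. monom (n j x) j)"
    have "coeff Q j = n j x" if "j \<le> K" for j using that by (simp add: Q_def coeff_sum)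
    then obtain t where t: "poly Q t = 0" "t \<noteq> 0"
      using complex_poly_two_coeffs_nonzero_root[of Q k l] nz k l by auto
    then have "t \<in> h ` fibre x" using n(3) by (simp add: Q_def poly_sum_monom)
    then show ?thesis using t by blast
  qed
  moreover have "polyfun {0,1} (K + K) (\<lambda>x. n k x * n l x)" using n(1) by (intro polyfun.mult) auto
  ultimately show ?thesis using k l by (intro exI[of _ "\<lambda>x. n k x * n l x"] exI[of _ "K + K"]) auto
qed

lemma fibre_base: "polyfun {0,1} m a \<Longrightarrow> y \<in> fibre x \<Longrightarrow> a y = a x"
  by (rule polyfun_cong_on) (auto simp: fibre_def)

text \<open>If \<open>h\<close> were nonzero somewhere on \<open>Y\<close>, then some generic fibre
  would contain a point where neither \<open>a\<close> nor \<open>h\<close> vanishes. Geometrically,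
  no component of \<open>Y\<close> lies over a plane curve.\<close>

lemma base_nonzerodivisor:
  assumes "polyfun {0,1} m a" "a x \<noteq> 0" "pf4 h" "\<And>y. y \<in> Y \<Longrightarrow> a y * h y = 0" "y \<in> Y"
  shows "h y = 0"
proof (rule ccontr)
  assume "h y \<noteq> 0"
  then obtain c k where c: "polyfun {0,1} k c" "\<exists>x. c x \<noteq> 0" "\<forall>x. c x \<noteq> 0 \<longrightarrow> (\<exists>y\<in>fibre x. h y \<noteq> 0)"
    using generic_nonvanishing[OF assms(3,5)] by blast
  obtain z where z: "a z \<noteq> 0" "c z \<noteq> 0" using polyfun_mult_nonzero[OF assms(1) c(1) assms(2)] c(2) by blast
  then obtain y where "y \<in> fibre z" "h y \<noteq> 0" using c(3) by blast
  then show False using fibre_base[OF assms(1), of y z] z assms(4)[of y] by (auto simp: fibre_def)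
qed

section \<open>Irreducible components from orthogonal families\<close>

definition orth :: "nat \<Rightarrow> (nat \<Rightarrow> (nat \<Rightarrow> complex) \<Rightarrow> complex) \<Rightarrow> bool" where
  "orth m f \<longleftrightarrow> (\<forall>i<m. pf4 (f i) \<and> (\<exists>y\<in>Y. f i y \<noteq> 0)) \<and>
     (\<forall>i<m. \<forall>j<m. i \<noteq> j \<longrightarrow> (\<forall>y\<in>Y. f i y * f j y = 0))"

text \<open>Over a generic base point each \<open>f i\<close> is nonzero somewhere in the fibre, and
  orthogonality forces these points to be distinct.\<close>

lemma orth_bound:
  assumes "orth m f" shows "m \<le> b * b"
proof -
  have "\<forall>i\<in>{..<m}. \<exists>a. (\<exists>k. polyfun {0,1} k a) \<and> (\<exists>x. a x \<noteq> 0) \<and> (\<forall>x. a x \<noteq> 0 \<longrightarrow> (\<exists>y\<in>fibre x. f i y \<noteq> 0))"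
  proof
    fix i assume "i \<in> {..<m}"
    then obtain y where "pf4 (f i)" "y \<in> Y" "f i y \<noteq> 0" using assms by (auto simp: orth_def)
    then show "\<exists>a. (\<exists>k. polyfun {0,1} k a) \<and> (\<exists>x. a x \<noteq> 0) \<and> (\<forall>x. a x \<noteq> 0 \<longrightarrow> (\<exists>y\<in>fibre x. f i y \<noteq> 0))"
      using generic_nonvanishing[of "f i" y] by blast
  qed
  from bchoice[OF this] obtain a where a: "\<forall>i\<in>{..<m}. (\<exists>k. polyfun {0,1} k (a i)) \<and> (\<exists>x. a i x \<noteq> 0) \<and>
    (\<forall>x. a i x \<noteq> 0 \<longrightarrow> (\<exists>y\<in>fibre x. f i y \<noteq> 0))" by blast
  obtain z where z: "\<forall>i\<in>{..<m}. a i z \<noteq> 0"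
    using polyfun_family_nonzero[of "{..<m}" "{0,1}" a] a by auto
  then have "\<forall>i\<in>{..<m}. \<exists>y. y \<in> fibre z \<and> f i y \<noteq> 0" using a by blast
  from bchoice[OF this] obtain y where y: "\<forall>i\<in>{..<m}. y i \<in> fibre z \<and> f i (y i) \<noteq> 0" by blast
  have "inj_on y {..<m}"
  proof (rule inj_onI, rule ccontr)
    fix i j assume ij: "i \<in> {..<m}" "j \<in> {..<m}" "y i = y j" "i \<noteq> j"
    then have yi: "y i \<in> Y" "f i (y i) \<noteq> 0" and "f j (y j) \<noteq> 0"
      using y[rule_format, OF ij(1)] y[rule_format, OF ij(2)] by (simp_all add: fibre_def)
    moreover have "f i (y i) * f j (y i) = 0"
      using assms ij(1,2,4) yi(1) unfolding orth_def lessThan_iff by blast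
    ultimately show False using ij(3) by simp
  qed
  moreover have "y ` {..<m} \<subseteq> fibre z" using y by auto
  ultimately have "card {..<m} \<le> card (fibre z)" by (metis card_inj_on_le fibre_finite)
  then show ?thesis using fibre_card[of z] by simp
qed

definition dominant :: "(nat \<Rightarrow> complex) set \<Rightarrow> bool" where
  "dominant W \<longleftrightarrow> (\<forall>a m. polyfun {0,1} m a \<longrightarrow> (\<forall>w\<in>W. a w = 0) \<longrightarrow> (\<forall>x. a x = 0))"

lemma Y_pclosed: "pclosed Y"
proof -
  have "pf4 (monic_fun 3 d1 G1)"
    unfolding monic_fun_def[abs_def]
    by (intro pf4_add pf4_sum pf4_mult pf4_power pf4I[OF polyfun_var[of 3 "{3}" 1]] pf4I[OF G1]) auto
  moreover have "pf4 (monic_fun 2 d2 G2)"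
    unfolding monic_fun_def[abs_def]
    by (intro pf4_add pf4_sum pf4_mult pf4_power pf4I[OF polyfun_var[of 2 "{2}" 1]] pf4I[OF G2]) auto
  ultimately show ?thesis unfolding pclosed_def Y_def by blast
qed

text \<open>A maximal family of pairwise annihilating functions takes the place of minimal primes:
  \<open>W i\<close> is the zero set in \<open>Y\<close> of the annihilator of \<open>f i\<close>.
  Maximality gives both covering and primality, because a failure of either would produce a larger
  family; dominance is \<open>base_nonzerodivisor\<close>.\<close>

lemma decomposition:
  "\<exists>m W. m \<le> b * b \<and> Y = (\<Union>i<m. W i) \<and> (\<forall>i<m. pclosed (W i) \<and> pprime (W i) \<and> dominant (W i))"
proof -
  define m where "m = (GREATEST m. \<exists>f. orth m f)"
  have ex: "\<exists>f. orth 0 f" by (simp add: orth_def)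
  have "\<exists>f. orth m f" unfolding m_def by (rule GreatestI_nat[of _ 0 "b * b"]) (use ex orth_bound in auto)
  then obtain f where f: "orth m f" by blast
  have no: "\<not> orth (Suc m) g" for g
  proof
    assume "orth (Suc m) g"
    then have "Suc m \<le> m" unfolding m_def by (intro Greatest_le_nat[of _ _ "b * b"]) (use orth_bound in auto)
    then show False by simp
  qed
  have f4: "pf4 (f i)" and fnz: "\<exists>y\<in>Y. f i y \<noteq> 0" if "i < m" for i using f that by (auto simp: orth_def)
  have forth: "f i y * f j y = 0" if "i < m" "j < m" "i \<noteq> j" "y \<in> Y" for i j y using f that by (auto simp: orth_def)
  define ann where "ann i g \<longleftrightarrow> pf4 g \<and> (\<forall>y\<in>Y. g y * f i y = 0)" for i g
  define W where "W i = {y \<in> Y. \<forall>g. ann i g \<longrightarrow> g y = 0}" for i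
  have Wsub: "W i \<subseteq> Y" for i by (auto simp: W_def)
  have inW: "y \<in> W i" if "y \<in> Y" "f i y \<noteq> 0" for i y using that by (auto simp: W_def ann_def)
  have annI: "ann i g" if "pf4 g" "\<And>w. w \<in> W i \<Longrightarrow> g w = 0" for i g
    using that inW unfolding ann_def by (metis mult_eq_0_iff)
  have cover: "Y \<subseteq> (\<Union>i<m. W i)"
  proof
    fix y assume y: "y \<in> Y"
    show "y \<in> (\<Union>i<m. W i)"
    proof (rule ccontr)
      assume n: "y \<notin> (\<Union>i<m. W i)"
      have "\<forall>i\<in>{..<m}. \<exists>g. ann i g \<and> g y \<noteq> 0"
      proof
        fix i assume i: "i \<in> {..<m}"
        then have "y \<notin> W i" using n by auto
        then show "\<exists>g. ann i g \<and> g y \<noteq> 0" using y unfolding W_def by auto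
      qed
      from bchoice[OF this] obtain g where g: "\<forall>i\<in>{..<m}. ann i (g i) \<and> g i y \<noteq> 0" by blast
      \<comment> \<open>At a point outside every \<open>W i\<close> the product of suitable
        annihilators is nonzero, yet it annihilates every \<open>f i\<close>, so it could be added
        to the family.\<close>
      define h where "h x = (\<Prod>i<m. g i x)" for x
      have hg: "h x = 0" if "i < m" "g i x = 0" for i x using that by (auto simp: h_def)
      have "pf4 (\<lambda>x. \<Prod>i<k. g i x)" if "k \<le> m" for k
        using that by (induction k) (use g in \<open>auto simp: ann_def intro!: pf4_const pf4_mult\<close>)
      then have h4: "pf4 h" unfolding h_def[abs_def] by blast
      have hy: "h y \<noteq> 0" using g by (auto simp: h_def)
      have ho: "h x * f i x = 0" if "i < m" "x \<in> Y" for i x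
        using g that hg[of i x] unfolding ann_def by (metis lessThan_iff mult_eq_0_iff)
      have "orth (Suc m) (f(m := h))"
        unfolding orth_def
      proof (intro conjI allI impI ballI)
        fix i assume "i < Suc m"
        then show "pf4 ((f(m := h)) i)" "\<exists>y\<in>Y. (f(m := h)) i y \<noteq> 0"
          using h4 hy y f4 fnz by (auto simp: less_Suc_eq)
      next
        fix i j x assume "i < Suc m" "j < Suc m" "i \<noteq> j" "x \<in> Y"
        then show "(f(m := h)) i x * (f(m := h)) j x = 0"
          using ho[of i x] ho[of j x] forth[of i j x] by (cases "i = m"; cases "j = m") auto
      qed
      then show False using no by blast
    qed
  qed
  have closed: "pclosed (W i)" for i
    unfolding pclosed_def
  proof (intro conjI ballI)
    show "W i \<subseteq> aff 4" using Wsub by (auto simp: Y_def)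
    fix x assume x: "x \<in> aff 4 - W i"
    show "\<exists>g. pf4 g \<and> (\<forall>v\<in>W i. g v = 0) \<and> g x \<noteq> 0"
    proof (cases "x \<in> Y")
      case True
      then obtain g where "ann i g" "g x \<noteq> 0" using x by (auto simp: W_def)
      then show ?thesis by (intro exI[of _ g]) (auto simp: W_def ann_def)
    next
      case False
      then obtain g where "pf4 g" "\<forall>v\<in>Y. g v = 0" "g x \<noteq> 0" using Y_pclosed x unfolding pclosed_def by blast
      then show ?thesis using Wsub by blast
    qed
  qed
  have prime: "pprime (W i)" if i: "i < m" for i
    unfolding pprime_def
  proof (intro conjI allI impI)
    show "W i \<noteq> {}" using fnz[OF i] inW by blast
    fix g h assume gh: "pf4 g" "pf4 h" "\<forall>v\<in>W i. g v * h v = 0"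
    show "(\<forall>v\<in>W i. g v = 0) \<or> (\<forall>v\<in>W i. h v = 0)"
    proof (rule ccontr)
      assume "\<not> ?thesis"
      then have "\<not> ann i g" "\<not> ann i h" unfolding W_def by blast+
      then have nz: "\<exists>y\<in>Y. g y * f i y \<noteq> 0" "\<exists>y\<in>Y. h y * f i y \<noteq> 0" using gh by (auto simp: ann_def)
      have z: "g y * f i y * (h y * f i y) = 0" if "y \<in> Y" for y
        using gh(3) inW[OF that, of i] by (cases "f i y = 0") auto
      \<comment> \<open>A failure of primality splits \<open>f i\<close> into two nonzero functions
        that annihilate each other and inherit orthogonality to the rest.\<close>
      let ?f = "f(i := \<lambda>x. g x * f i x, m := \<lambda>x. h x * f i x)"
      have "orth (Suc m) ?f"
        unfolding orth_def
      proof (intro conjI allI impI ballI)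
        fix j assume "j < Suc m"
        then show "pf4 (?f j)" "\<exists>y\<in>Y. ?f j y \<noteq> 0"
          using nz f4 fnz gh i by (auto simp: less_Suc_eq intro!: pf4_mult)
      next
        fix j k x assume jk: "j < Suc m" "k < Suc m" "j \<noteq> k" and x: "x \<in> Y"
        have o: "f i x * f l x = 0" if "l < m" "l \<noteq> i" for l using forth[OF i that(1) _ x] that by auto
        have o': "f i x = 0 \<or> f l x = 0" if "l < m" "l \<noteq> i" for l using o[OF that] by simp
        show "?f j x * ?f k x = 0"
          using jk z[OF x] o' forth[of j k x] x i by (auto simp: less_Suc_eq mult.commute)
      qed
      then show False using no by blast
    qed
  qed
  have dom: "dominant (W i)" if i: "i < m" for i
    unfolding dominant_def
  proof (intro allI impI)
    fix a k x assume a: "polyfun {0,1} k a" "\<forall>w\<in>W i. a w = 0"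
    show "a x = 0"
    proof (rule ccontr)
      assume "a x \<noteq> 0"
      have "a y * f i y = 0" if "y \<in> Y" for y using inW[OF that] a(2) by fastforce
      then have "f i y = 0" if "y \<in> Y" for y
        using base_nonzerodivisor[OF a(1) \<open>a x \<noteq> 0\<close> f4[OF i] _ that] by blast
      then show False using fnz[OF i] by blast
    qed
  qed
  show ?thesis
    by (intro exI[of _ m] exI[of _ W]) (use orth_bound[OF f] cover Wsub closed prime dom in auto)
qed

text \<open>A function separating \<open>U\<close> from \<open>V\<close> is algebraic over the
  plane, and \<open>lowest_coefficient\<close> passes from it to a coefficient that separates them
  as well. Strict inclusions inside \<open>Y\<close> are thus visible in the base variables.\<close>

lemma base_separation:
  assumes "pclosed U" "pprime V" "U \<subset> V" "V \<subseteq> Y"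
  shows "\<exists>a m. polyfun {0,1} m a \<and> (\<forall>u\<in>U. a u = 0) \<and> (\<exists>v\<in>V. a v \<noteq> 0)"
proof -
  obtain w where w: "w \<in> V" "w \<notin> U" using assms(3) by blast
  then have "w \<in> aff 4 - U" using assms(4) by (auto simp: Y_def)
  then obtain h where h: "pf4 h" "\<forall>u\<in>U. h u = 0" "h w \<noteq> 0" using assms(1) unfolding pclosed_def by blast
  obtain K n where n: "\<forall>k. polyfun {0,1} K (n k)" "\<forall>x. \<exists>k\<le>K. n k x \<noteq> 0"
    "\<forall>x T. (\<Sum>k\<le>K. n k x * T ^ k) = 0 \<longleftrightarrow> T \<in> h ` fibre x"
    using fibre_values[OF h(1)] by blast
  obtain k' where k': "k' \<le> K" "n k' w \<noteq> 0" using n(2) by blast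
  have "\<exists>k. (\<forall>u\<in>U. n k u = 0) \<and> (\<exists>v\<in>V. n k v \<noteq> 0)"
  proof (rule lowest_coefficient[where n=n and K=K and h=h and w=w and w'=w and k'=k', OF assms(2) _ h(1) _ w(1) h(3) _ _ w(1) k'])
    show "U \<subseteq> V" using assms by blast
    show "pf4 (n k)" for k by (rule pf4I[OF n(1)[rule_format]]) auto
    show "(\<Sum>k\<le>K. n k v * h v ^ k) = 0" if "v \<in> V" for v
      using n(3) fibre_self[of v] that assms(4) by blast
  qed (use h in auto)
  then show ?thesis using n(1) by blast
qed

text \<open>Here \<open>c 2\<close> lies over a plane curve, on which all base functions are
  algebraic over one linear coordinate \<open>z\<close>. A nonzero polynomial in \<open>z\<close>
  vanishing on \<open>c 1\<close> makes \<open>z\<close> constant there, so no polynomial in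
  \<open>z\<close> can separate \<open>c 0\<close> from \<open>c 1\<close>.\<close>

lemma no_long_chain:
  assumes c: "\<And>i. i \<le> 3 \<Longrightarrow> pclosed (c i) \<and> pprime (c i) \<and> c i \<subseteq> Y"
    and chain: "\<And>i::nat. i < 3 \<Longrightarrow> c i \<subset> c (Suc i)"
  shows False
proof -
  have sub: "c 0 \<subset> c 1" "c 1 \<subset> c 2" "c 2 \<subset> c 3"
    using chain[of 0] chain[of 1] chain[of 2] by (simp_all add: numeral_eq_Suc One_nat_def)
  obtain a0 m0 where a0: "polyfun {0,1} m0 a0" "\<forall>u\<in>c 0. a0 u = 0" "\<exists>v\<in>c 1. a0 v \<noteq> 0"
    using base_separation[of "c 0" "c 1"] c[of 0] c[of 1] sub by auto
  obtain a1 m1 where a1: "polyfun {0,1} m1 a1" "\<forall>u\<in>c 1. a1 u = 0" "\<exists>v\<in>c 2. a1 v \<noteq> 0"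
    using base_separation[of "c 1" "c 2"] c[of 1] c[of 2] sub by auto
  obtain a2 m2 where a2: "polyfun {0,1} m2 a2" "\<forall>u\<in>c 2. a2 u = 0" "\<exists>v\<in>c 3. a2 v \<noteq> 0"
    using base_separation[of "c 2" "c 3"] c[of 2] c[of 3] sub by auto
  obtain x0 where x0: "a2 x0 \<noteq> 0" using a2 by blast
  obtain v where v: "\<forall>e f. polyfun {0,1} e f \<longrightarrow> (\<exists>K n. (\<forall>k. polyfun {0} K (n k)) \<and> (\<forall>x. \<exists>k\<le>K. n k x \<noteq> 0) \<and>
     (\<forall>x. a2 x = 0 \<longrightarrow> (\<Sum>k\<le>K. n k (\<lambda>_. x 0 - v * x 1) * f x ^ k) = 0))"
    using curve_relation[OF a2(1) x0] by (elim exE) (rule that, assumption)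
  define z where "z x = x 0 - v * x 1" for x :: "nat \<Rightarrow> complex"
  have z1: "polyfun {0,1} 1 z" unfolding z_def[abs_def] by (intro polyfun_diff polyfun_cmult polyfun_var) auto
  then have z4: "pf4 z" by (rule pf4I) auto
  have sep: "\<exists>q K. polyfun {0} K q \<and> (\<forall>u\<in>U. q (\<lambda>_. z u) = 0) \<and> (\<exists>v\<in>V. q (\<lambda>_. z v) \<noteq> 0)"
    if U: "U \<subseteq> V" and V: "V \<subseteq> c 2" "pprime V" and f: "polyfun {0,1} e f" "\<forall>u\<in>U. f u = 0" "\<exists>v\<in>V. f v \<noteq> 0" for U V e f
  proof -
    obtain K n where n: "\<forall>k. polyfun {0} K (n k)" "\<forall>x. \<exists>k\<le>K. n k x \<noteq> 0"
     "\<forall>x. a2 x = 0 \<longrightarrow> (\<Sum>k\<le>K. n k (\<lambda>_. z x) * f x ^ k) = 0" using v[rule_format, OF f(1)] unfolding z_def by blast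
    obtain w where w: "w \<in> V" "f w \<noteq> 0" using f by blast
    obtain k' where k': "k' \<le> K" "n k' (\<lambda>_. z w) \<noteq> 0" using n(2) by blast
    have "\<exists>k. (\<forall>u\<in>U. n k (\<lambda>_. z u) = 0) \<and> (\<exists>v\<in>V. n k (\<lambda>_. z v) \<noteq> 0)"
    proof (rule lowest_coefficient[where n="\<lambda>k x. n k (\<lambda>_. z x)" and K=K and h=f and w=w and w'=w and k'=k',
          OF V(2) U _ _ w _ _ w(1) k'])
      show "pf4 f" by (rule pf4I[OF f(1)]) auto
      show "pf4 (\<lambda>x. n k (\<lambda>_. z x))" for k
        by (rule pf4I[OF polyfun_subst[OF n(1)[rule_format] z1]]) auto
      show "(\<Sum>k\<le>K. n k (\<lambda>_. z x) * f x ^ k) = 0" if "x \<in> V" for x using n(3) a2(2) V that by blast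
    qed (use f in auto)
    then show ?thesis using n(1) by blast
  qed
  obtain q1 K1 where q1: "polyfun {0} K1 q1" "\<forall>u\<in>c 1. q1 (\<lambda>_. z u) = 0" "\<exists>v\<in>c 2. q1 (\<lambda>_. z v) \<noteq> 0"
    using sep[of "c 1" "c 2" m1 a1] a1 sub c[of 2] by auto
  obtain q0 K0 where q0: "polyfun {0} K0 q0" "\<forall>u\<in>c 0. q0 (\<lambda>_. z u) = 0" "\<exists>v\<in>c 1. q0 (\<lambda>_. z v) \<noteq> 0"
    using sep[of "c 0" "c 1" m0 a0] a0 sub c[of 1] by auto
  obtain p where p: "\<forall>s. poly p s = q1 (\<lambda>_. 0 + s * 1)" using polyfun_line[OF q1(1), of "\<lambda>_. 0" "\<lambda>_. 1"] by blast
  have "p \<noteq> 0" using q1(3) p by force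
  moreover have "poly p (z u) = 0" if "u \<in> c 1" for u using p q1(2) that by simp
  ultimately obtain r where r: "\<forall>u\<in>c 1. z u = r" using pprime_root[OF _ z4, of "c 1" p] c[of 1] by auto
  obtain u0 where u0: "u0 \<in> c 0" using c[of 0] by (auto simp: pprime_def)
  then have "q0 (\<lambda>_. r) = 0" using q0(2) r sub by fastforce
  then show False using q0(3) r by auto
qed

end

section \<open>Images in three-space and finite linear sections\<close>

abbreviation "ev2 i j \<equiv> ev_step i (ev_step j (\<lambda>c (_::nat \<Rightarrow> 'a::field_char_0). c))"

lemma poly_model_ev2: "i \<noteq> j \<Longrightarrow> poly_model {i, j} (ev2 i j :: _ \<Rightarrow> (nat \<Rightarrow> 'a::field_char_0) \<Rightarrow> 'a)"
  by (intro poly_model_step poly_model_const) auto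

context triangular
begin

text \<open>The ideal of the image of \<open>W\<close> in \<open>\<complex>\<^sup>3\<close> is principal, and its generator divides the bounded
  polynomial \<open>H\<close>.  The image is closed because norms separate points from it.\<close>

lemma hypersurface_image:
  assumes W: "pclosed W" "pprime W" "dominant W" "W \<subseteq> Y" and l: "polyfun {..<4} 1 l"
  shows "\<exists>F. polyfun {0,1,4} (nbound (nbound (b + 1))) F \<and>
    (\<forall>x T. F (x(4 := T)) = 0 \<longleftrightarrow> (\<exists>w\<in>W. w 0 = x 0 \<and> w 1 = x 1 \<and> l w = T))"
proof -
  let ?B = "nbound (nbound (b + 1))"
  let ?E = "ev_step 4 (ev2 1 0) :: complex poly poly poly \<Rightarrow> (nat \<Rightarrow> complex) \<Rightarrow> complex"
  have E2: "poly_model {1, 0} (ev2 1 0 :: complex poly poly \<Rightarrow> (nat \<Rightarrow> complex) \<Rightarrow> complex)" by (rule poly_model_ev2) simp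
  have E: "poly_model {4, 1, 0} ?E" by (rule poly_model_step[OF E2]) simp
  interpret H: comm_ring_hom "\<lambda>p. ?E p x" for x by (rule poly_modelD(1)[OF E])
  have I: "{0,1,4} = {4,1,0::nat}" by auto
  \<comment> \<open>\<open>\<phi>\<close> records \<open>l w\<close> in variable 4, and
    \<open>K\<close> is the ideal of the image of \<open>W\<close> in the variables 0, 1 and
    4.\<close>
  define \<phi> where "\<phi> w = w(4 := l w)" for w
  define K where "K p \<longleftrightarrow> (\<forall>w\<in>W. ?E p (\<phi> w) = 0)" for p
  have K4: "pf4 (\<lambda>w. ?E p (\<phi> w))" for p
  proof -
    obtain n where n: "polyfun {4,1,0} n (?E p)" using poly_modelD(3)[OF E] by blast
    have "polyfun {..<4} (n * 1) (\<lambda>w. ?E p (\<phi> w))"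
      by (rule polyfun_subst[OF n]) (use l in \<open>auto simp: \<phi>_def intro!: polyfun_var\<close>)
    then show ?thesis unfolding pf4_def by blast
  qed
  have Kprime: "K p \<or> K q" if "K (p * q)" for p q
    unfolding K_def by (rule pprimeD[OF W(2) K4 K4]) (use that in \<open>auto simp: K_def H.hom_mult\<close>)
  have Kdvd: "K q" if "p dvd q" "K p" for p q
  proof -
    obtain r where "q = p * r" using \<open>p dvd q\<close> by (rule dvdE)
    then show ?thesis using \<open>K p\<close> by (simp add: K_def H.hom_mult)
  qed
  have K1: "\<not> K 1" using W(2) by (auto simp: K_def pprime_def)
  have l4: "l (y(4 := T)) = l y" for y T by (rule polyfun_cong_on[OF l]) auto
  have f: "polyfun {0,1,2,3,4} (b + 1) (\<lambda>x. x 4 - l x)"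
    by (intro polyfun_diff polyfun_var polyfun_mono[OF l]) auto
  obtain H where H: "polyfun {0,1,4} ?B H"
    "\<forall>x. H x = 0 \<longleftrightarrow> (\<exists>y\<in>fibre x. (y(4 := x 4)) 4 - l (y(4 := x 4)) = 0)"
    using fibre_norm[OF f] by auto
  obtain hn where hn: "?E hn = H" using poly_modelD(4)[OF E H(1)[unfolded I]] by blast
  have "hn \<noteq> 0"
  proof
    assume "hn = 0"
    then have "H x = 0" for x using hn by auto
    then have "T \<in> l ` fibre (\<lambda>_. 0)" for T
      using H(2)[rule_format, of "(\<lambda>_. 0)(4 := T)"] fibre_cong[of "(\<lambda>_. 0)(4 := T)" "\<lambda>_. 0"] by (auto simp: l4)
    then have "l ` fibre (\<lambda>_. 0) = UNIV" by blast
    then show False using fibre_finite infinite_UNIV_char_0[where 'a=complex] by (metis finite_imageI)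
  qed
  have fib: "w \<in> fibre (\<phi> w)" if "w \<in> W" for w
    using W(4) that by (auto simp: fibre_def \<phi>_def)
  have "K hn" unfolding K_def hn
  proof
    fix w assume w: "w \<in> W"
    show "H (\<phi> w) = 0" using H(2) fib[OF w] by (auto simp: \<phi>_def l4 intro!: bexI[of _ w])
  qed
  \<comment> \<open>\<open>K\<close> is a prime ideal containing the nonzero \<open>hn\<close>,
    hence it contains a prime factor of \<open>hn\<close>. This factor turns out to generate
    \<open>K\<close>.\<close>
  obtain A where A: "\<forall>x. x \<in># A \<longrightarrow> prime_elem x" "normalize (\<Prod>\<^sub># A) = normalize hn"
    using prime_factorization_exists[OF \<open>hn \<noteq> 0\<close>] by blast
  have "K (\<Prod>\<^sub># A)" by (rule Kdvd[OF _ \<open>K hn\<close>]) (rule associatedD2[OF A(2)])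
  moreover have "\<exists>p. p \<in># A \<and> K p" if "K (\<Prod>\<^sub># A)" for A
    using that
  proof (induction A)
    case empty
    then show ?case using K1 by simp
  next
    case (add p A)
    then show ?case using Kprime[of p "\<Prod>\<^sub># A"] by auto
  qed
  ultimately obtain p where p: "p \<in># A" "K p" by blast
  have irr: "irreducible p" using p A by (auto intro: prime_elem_imp_irreducible)
  have "p dvd hn" using dvd_prod_mset[OF p(1)] associatedD1[OF A(2)] by (rule dvd_trans)
  then obtain q where q: "hn = p * q" by (rule dvdE)
  have "q \<noteq> 0" using q \<open>hn \<noteq> 0\<close> by auto
  then obtain y where y: "?E q y \<noteq> 0" using poly_modelD(2)[OF E] by blast
  obtain n1 n2 where n12: "polyfun {4,1,0} n1 (?E p)" "polyfun {4,1,0} n2 (?E q)" using poly_modelD(3)[OF E] by metis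
  have "H = (\<lambda>x. ?E p x * ?E q x)" using hn q by (auto simp: H.hom_mult)
  then have "polyfun {4,1,0} ?B (\<lambda>x. ?E p x * ?E q x)" using H(1)[unfolded I] by simp
  then have FB: "polyfun {4,1,0} ?B (?E p)" by (rule polyfun_factor_degree[OF _ n12 y])
  \<comment> \<open>Otherwise eliminating variable 4 between \<open>p\<close> and \<open>g\<close>
    would leave a nonzero base polynomial vanishing on \<open>W\<close>, against dominance.\<close>
  have div: "p dvd g" if g: "K g" for g
  proof (rule ccontr)
    assume "\<not> p dvd g"
    then obtain r n where r: "polyfun {1,0} n r" "\<exists>x. r x \<noteq> 0" "\<forall>x. ?E p x = 0 \<longrightarrow> ?E g x = 0 \<longrightarrow> r x = 0"
      using poly_model_eliminate[OF E2 irr, of g 4] by blast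
    have "r w = 0" if "w \<in> W" for w
    proof -
      have "r w = r (\<phi> w)" by (rule polyfun_cong_on[OF r(1)]) (auto simp: \<phi>_def)
      then show ?thesis using r(3) p(2) g that by (auto simp: K_def)
    qed
    moreover have "polyfun {0,1} n r" using r(1) by (simp add: insert_commute)
    ultimately have "\<forall>x. r x = 0" using W(3) unfolding dominant_def by blast
    then show False using r(2) by blast
  qed
  have 1: "?E p (x(4 := T)) = 0" if "w \<in> W" "w 0 = x 0" "w 1 = x 1" "l w = T" for x T w
  proof -
    have "?E p (x(4 := T)) = ?E p (\<phi> w)" by (rule polyfun_cong_on[OF FB]) (use that in \<open>auto simp: \<phi>_def\<close>)
    then show ?thesis using p(2) that by (simp add: K_def)
  qed
  have 2: "\<exists>w\<in>W. w 0 = x 0 \<and> w 1 = x 1 \<and> l w = T" if z: "?E p (x(4 := T)) = 0" for x T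
  proof (rule ccontr)
    assume no: "\<not> ?thesis"
    \<comment> \<open>The ideal of \<open>W\<close> together with the constant multiples of
      \<open>l - T\<close>. No point of the fibre lies in \<open>W\<close> with
      \<open>l = T\<close>, so each fibre point is missed by some member, and therefore one member
      is nonzero on the whole fibre.\<close>
    define V where "V = {\<lambda>y. f y + c * (l y - T) | f c. pf4 f \<and> (\<forall>w\<in>W. f w = 0)}"
    have Vi: "(\<lambda>y. f y + c * (l y - T)) \<in> V" if "pf4 f" "\<forall>w\<in>W. f w = 0" for f c using that by (auto simp: V_def)
    have "\<exists>g\<in>V. \<forall>y\<in>fibre x. g y \<noteq> 0"
    proof (rule avoid_finite_union)
      fix g h and k :: complex assume "g \<in> V" "h \<in> V"
      then obtain f1 c1 f2 c2 where *: "g = (\<lambda>y. f1 y + c1 * (l y - T))" "h = (\<lambda>y. f2 y + c2 * (l y - T))"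
        "pf4 f1" "\<forall>w\<in>W. f1 w = 0" "pf4 f2" "\<forall>w\<in>W. f2 w = 0" by (auto simp: V_def)
      have "(\<lambda>y. (f1 y + k * f2 y) + (c1 + k * c2) * (l y - T)) \<in> V"
        by (rule Vi) (use * in \<open>auto intro!: pf4_add pf4_mult pf4_const\<close>)
      then show "(\<lambda>y. g y + k * h y) \<in> V" by (simp add: * algebra_simps)
    next
      show "V \<noteq> {}" using Vi[OF pf4_const[of 0], of 0] by auto
      show "finite (fibre x)" by (rule fibre_finite)
      fix y assume y: "y \<in> fibre x"
      show "\<exists>g\<in>V. g y \<noteq> 0"
      proof (cases "y \<in> W")
        case True
        then have "l y \<noteq> T" using no y by (auto simp: fibre_def)
        then show ?thesis using Vi[OF pf4_const[of 0], of 1] by (intro bexI[of _ "\<lambda>y. 0 + 1 * (l y - T)"]) auto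
      next
        case False
        moreover have "y \<in> aff 4" using y by (auto simp: fibre_def Y_def)
        ultimately obtain f where "pf4 f" "\<forall>w\<in>W. f w = 0" "f y \<noteq> 0" using W(1) unfolding pclosed_def by blast
        then show ?thesis using Vi[of f 0] by (intro bexI[of _ "\<lambda>y. f y + 0 * (l y - T)"]) auto
      qed
    qed
    then obtain f c where f: "pf4 f" "\<forall>w\<in>W. f w = 0" and nz: "\<forall>y\<in>fibre x. f y + c * (l y - T) \<noteq> 0"
      by (auto simp: V_def)
    obtain n where n: "polyfun {..<4} n f" using f(1) by (auto simp: pf4_def)
    have f4: "f (y(4 := T)) = f y" for y T by (rule polyfun_cong_on[OF n]) auto
    define e where "e = n + b + 1"
    \<comment> \<open>With \<open>T\<close> turned into variable 4 the chosen function vanishes on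
      the image of \<open>W\<close>, so its norm belongs to \<open>K\<close> and is divisible by
      \<open>p\<close>. At height \<open>T\<close> over \<open>x\<close>, however, the norm is
      nonzero by the choice of \<open>f\<close> and \<open>c\<close>.\<close>
    have "polyfun {0,1,2,3,4} e (\<lambda>x. f x + c * (l x - x 4))"
      unfolding e_def
      by (intro polyfun.add polyfun_diff polyfun_cmult polyfun_var polyfun_mono[OF l] polyfun_mono[OF n]) auto
    from fibre_norm[OF this] obtain N where N: "polyfun {0,1,4} (nbound (nbound e)) N"
      "\<forall>x. N x = 0 \<longleftrightarrow> (\<exists>y\<in>fibre x. f (y(4 := x 4)) + c * (l (y(4 := x 4)) - (y(4 := x 4)) 4) = 0)"
      by (auto simp: e_def)
    obtain nn where nn: "?E nn = N" using poly_modelD(4)[OF E N(1)[unfolded I]] by blast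
    have "K nn" unfolding K_def nn
    proof
      fix w assume w: "w \<in> W"
      show "N (\<phi> w) = 0" using N(2) fib[OF w] f(2) w by (auto simp: \<phi>_def l4 f4 intro!: bexI[of _ w])
    qed
    then obtain s where "nn = p * s" using div by (blast elim: dvdE)
    then have "N (x(4 := T)) = 0" using z nn H.hom_mult[of p s "x(4 := T)"] by simp
    then show False using N(2) nz fibre_cong[of "x(4 := T)" x] by (auto simp: l4 f4)
  qed
  show ?thesis
    by (rule exI[of _ "?E p"]) (use FB I 1 2 in auto)
qed

text \<open>Over a point \<open>x\<close> off the projection of the section, a suitable combination
  of \<open>m1\<close> and \<open>m2\<close> has no zero on \<open>W\<close> in the fibre. The image
  hypersurface of this linear form, cut at height 0, is a planar polynomial of bounded degree that
  vanishes on the projection but not at \<open>x\<close>. The factor \<open>b * b\<close> accounts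
  for the points in one fibre.\<close>

lemma finite_section_card:
  assumes W: "pclosed W" "pprime W" "dominant W" "W \<subseteq> Y"
    and m: "polyfun {..<4} 1 m1" "polyfun {..<4} 1 m2" and fin: "finite {w \<in> W. m1 w = 0 \<and> m2 w = 0}"
  shows "card {w \<in> W. m1 w = 0 \<and> m2 w = 0} \<le> nbound (nbound (nbound (b + 1))) * nbound (nbound (b + 1)) * (b * b)"
proof -
  let ?B = "nbound (nbound (b + 1))"
  define S where "S = {w \<in> W. m1 w = 0 \<and> m2 w = 0}"
  define tr where "tr w = (\<lambda>i. if i < 2 then w i else 0)" for w :: "nat \<Rightarrow> complex"
  have tr01: "tr w 0 = w 0" "tr w 1 = w 1" for w by (auto simp: tr_def)
  have treq: "tr w = x" if "x \<in> aff 2" "w 0 = x 0" "w 1 = x 1" for w x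
    using that by (auto simp: tr_def aff_def fun_eq_iff less_2_cases_iff One_nat_def)
  have "card (tr ` S) \<le> nbound ?B * ?B"
  proof (rule planar_finite_zero_set)
    show "finite (tr ` S)" using fin by (simp add: S_def)
    show "tr ` S \<subseteq> aff 2" by (auto simp: tr_def aff_def)
    fix x assume x: "x \<in> aff 2 - tr ` S"
    define V where "V = {\<lambda>y. \<alpha> * m1 y + \<beta> * m2 y | \<alpha> \<beta>. True}"
    have Vi: "(\<lambda>y. \<alpha> * m1 y + \<beta> * m2 y) \<in> V" for \<alpha> \<beta> by (auto simp: V_def)
    have "\<exists>g\<in>V. \<forall>w\<in>W \<inter> fibre x. g w \<noteq> 0"
    proof (rule avoid_finite_union)
      fix g h and k :: complex assume "g \<in> V" "h \<in> V"
      then obtain a b c d where *: "g = (\<lambda>y. a * m1 y + b * m2 y)" "h = (\<lambda>y. c * m1 y + d * m2 y)" by (auto simp: V_def)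
      show "(\<lambda>y. g y + k * h y) \<in> V" using Vi[of "a + k * c" "b + k * d"] by (simp add: * algebra_simps)
    next
      show "V \<noteq> {}" using Vi by blast
      show "finite (W \<inter> fibre x)" using fibre_finite by simp
      fix w assume w: "w \<in> W \<inter> fibre x"
      have "m1 w \<noteq> 0 \<or> m2 w \<noteq> 0"
      proof (rule ccontr)
        assume "\<not> ?thesis"
        then have "w \<in> S" using w by (auto simp: S_def)
        moreover have "tr w = x" by (rule treq) (use x w in \<open>auto simp: fibre_def\<close>)
        ultimately show False using x by blast
      qed
      then show "\<exists>g\<in>V. g w \<noteq> 0"
      proof
        assume "m1 w \<noteq> 0"
        then show ?thesis using Vi[of 1 0] by (intro bexI[of _ "\<lambda>y. 1 * m1 y + 0 * m2 y"]) auto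
      next
        assume "m2 w \<noteq> 0"
        then show ?thesis using Vi[of 0 1] by (intro bexI[of _ "\<lambda>y. 0 * m1 y + 1 * m2 y"]) auto
      qed
    qed
    then obtain \<alpha> \<beta> where nz: "\<forall>w\<in>W \<inter> fibre x. \<alpha> * m1 w + \<beta> * m2 w \<noteq> 0" by (auto simp: V_def)
    have "polyfun {..<4} 1 (\<lambda>w. \<alpha> * m1 w + \<beta> * m2 w)" by (intro polyfun.add polyfun_cmult m)
    from hypersurface_image[OF W this] obtain F where F: "polyfun {0,1,4} ?B F"
      "\<forall>x T. F (x(4 := T)) = 0 \<longleftrightarrow> (\<exists>w\<in>W. w 0 = x 0 \<and> w 1 = x 1 \<and> \<alpha> * m1 w + \<beta> * m2 w = T)" by blast
    have "polyfun {0,1} (?B * 1) (\<lambda>y. F (y(4 := 0)))"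
      by (rule polyfun_subst[OF F(1)]) (auto intro: polyfun.const polyfun_var)
    moreover have "F (s(4 := 0)) = 0" if "s \<in> tr ` S" for s
      using that F(2) by (auto simp: S_def tr01)
    moreover have "F (x(4 := 0)) \<noteq> 0" using F(2) nz W(4) by (auto simp: fibre_def)
    ultimately show "\<exists>g. polyfun {0,1} ?B g \<and> (\<forall>s\<in>tr ` S. g s = 0) \<and> g x \<noteq> 0"
      by (intro exI[of _ "\<lambda>y. F (y(4 := 0))"]) auto
  qed
  moreover have "S \<subseteq> (\<Union>x\<in>tr ` S. fibre x)" using W(4) by (auto simp: S_def fibre_def tr01)
  then have "card S \<le> card (\<Union>x\<in>tr ` S. fibre x)"
    by (rule card_mono[rotated]) (use fin fibre_finite in \<open>auto simp: S_def\<close>)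
  then have "card S \<le> (\<Sum>x\<in>tr ` S. card (fibre x))"
    by (rule order.trans) (rule card_UN_le, use fin in \<open>simp add: S_def\<close>)
  then have "card S \<le> card (tr ` S) * (b * b)"
    by (rule order.trans) (use sum_bounded_above[of "tr ` S" "\<lambda>x. card (fibre x)" "b * b"] fibre_card in simp)
  ultimately have "card S \<le> nbound ?B * ?B * (b * b)" by (meson mult_right_mono order.trans zero_le)
  then show ?thesis by (simp add: S_def)
qed

end

section \<open>Local uniqueness of complex curves\<close>

lemma polyfun_derivative:
  fixes f :: "(nat \<Rightarrow> real) \<Rightarrow> real"
  assumes "polyfun {..<N} n f"
  shows "\<exists>df. (\<forall>i. \<exists>m. polyfun {..<N} m (df i)) \<and>
    (\<forall>\<theta> \<theta>' t. (\<forall>i<N. ((\<lambda>s. \<theta> s i) has_real_derivative \<theta>' i) (at t)) \<longrightarrow>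
      ((\<lambda>s. f (\<theta> s)) has_real_derivative (\<Sum>i<N. df i (\<theta> t) * \<theta>' i)) (at t))"
  using assms
proof (induction rule: polyfun.induct)
  case (const n c)
  then show ?case by (intro exI[of _ "\<lambda>_ _. 0"]) (auto intro: polyfun.const)
next
  case (var j n)
  have "polyfun {..<N} 0 (\<lambda>_. if i = j then 1 else 0 :: real)" for i by (rule polyfun.const)
  moreover have "(\<Sum>i<N. (if i = j then 1 else 0) * \<theta>' i) = \<theta>' j" for \<theta>' :: "nat \<Rightarrow> real"
    using var by (simp add: if_distrib[where f="\<lambda>a. a * _"] cong: if_cong)
  ultimately show ?case using var
    by (intro exI[of _ "\<lambda>i _. if i = j then 1 else 0"] conjI allI impI exI[of _ 0]) simp_all
next
  case (add n f g)
  obtain df where df: "\<forall>i. \<exists>m. polyfun {..<N} m (df i)"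
    "\<forall>\<theta> \<theta>' t. (\<forall>i<N. ((\<lambda>s. \<theta> s i) has_real_derivative \<theta>' i) (at t)) \<longrightarrow>
      ((\<lambda>s. f (\<theta> s)) has_real_derivative (\<Sum>i<N. df i (\<theta> t) * \<theta>' i)) (at t)" using add.IH(1) by auto
  obtain dg where dg: "\<forall>i. \<exists>m. polyfun {..<N} m (dg i)"
    "\<forall>\<theta> \<theta>' t. (\<forall>i<N. ((\<lambda>s. \<theta> s i) has_real_derivative \<theta>' i) (at t)) \<longrightarrow>
      ((\<lambda>s. g (\<theta> s)) has_real_derivative (\<Sum>i<N. dg i (\<theta> t) * \<theta>' i)) (at t)" using add.IH(2) by auto
  show ?case
  proof (intro exI[of _ "\<lambda>i x. df i x + dg i x"] conjI allI impI)
    fix i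
    obtain m k where "polyfun {..<N} m (df i)" "polyfun {..<N} k (dg i)" using df(1) dg(1) by blast
    then have "polyfun {..<N} (max m k) (\<lambda>x. df i x + dg i x)" by (intro polyfun.add) (auto intro: polyfun_mono)
    then show "\<exists>m. polyfun {..<N} m (\<lambda>x. df i x + dg i x)" by blast
  next
    fix \<theta> \<theta>' t assume *: "\<forall>i<N. ((\<lambda>s. \<theta> s i) has_real_derivative \<theta>' i) (at t)"
    show "((\<lambda>s. f (\<theta> s) + g (\<theta> s)) has_real_derivative (\<Sum>i<N. (df i (\<theta> t) + dg i (\<theta> t)) * \<theta>' i)) (at t)"
      using DERIV_add[OF df(2)[rule_format, of \<theta> \<theta>' t] dg(2)[rule_format, of \<theta> \<theta>' t]] *
      by (simp add: distrib_right sum.distrib)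
  qed
next
  case (mult n f m' g)
  obtain df where df: "\<forall>i. \<exists>m. polyfun {..<N} m (df i)"
    "\<forall>\<theta> \<theta>' t. (\<forall>i<N. ((\<lambda>s. \<theta> s i) has_real_derivative \<theta>' i) (at t)) \<longrightarrow>
      ((\<lambda>s. f (\<theta> s)) has_real_derivative (\<Sum>i<N. df i (\<theta> t) * \<theta>' i)) (at t)" using mult.IH(1) by auto
  obtain dg where dg: "\<forall>i. \<exists>m. polyfun {..<N} m (dg i)"
    "\<forall>\<theta> \<theta>' t. (\<forall>i<N. ((\<lambda>s. \<theta> s i) has_real_derivative \<theta>' i) (at t)) \<longrightarrow>
      ((\<lambda>s. g (\<theta> s)) has_real_derivative (\<Sum>i<N. dg i (\<theta> t) * \<theta>' i)) (at t)" using mult.IH(2) by auto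
  show ?case
  proof (intro exI[of _ "\<lambda>i x. df i x * g x + dg i x * f x"] conjI allI impI)
    fix i
    obtain m k where mk: "polyfun {..<N} m (df i)" "polyfun {..<N} k (dg i)" using df(1) dg(1) by blast
    have "polyfun {..<N} (m + m' + k + n) (\<lambda>x. df i x * g x + dg i x * f x)"
      by (intro polyfun.add polyfun_mult_le[OF mk(1) mult.hyps(2)] polyfun_mult_le[OF mk(2) mult.hyps(1)]) auto
    then show "\<exists>m. polyfun {..<N} m (\<lambda>x. df i x * g x + dg i x * f x)" by blast
  next
    fix \<theta> \<theta>' t assume *: "\<forall>i<N. ((\<lambda>s. \<theta> s i) has_real_derivative \<theta>' i) (at t)"
    show "((\<lambda>s. f (\<theta> s) * g (\<theta> s)) has_real_derivative
        (\<Sum>i<N. (df i (\<theta> t) * g (\<theta> t) + dg i (\<theta> t) * f (\<theta> t)) * \<theta>' i)) (at t)"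
      using DERIV_mult[OF df(2)[rule_format, of \<theta> \<theta>' t] dg(2)[rule_format, of \<theta> \<theta>' t]] *
      by (simp add: algebra_simps sum.distrib sum_distrib_left sum_distrib_right)
  qed
qed

text \<open>Values and increments are bounded together because the product rule for increments needs
  both.\<close>

lemma polyfun_lipschitz:
  fixes f :: "(nat \<Rightarrow> real) \<Rightarrow> real"
  assumes "polyfun {..<N} n f" "R \<ge> 0"
  shows "\<exists>C\<ge>0. \<forall>x y. (\<forall>i<N. \<bar>x i\<bar> \<le> R \<and> \<bar>y i\<bar> \<le> R) \<longrightarrow>
    \<bar>f x\<bar> \<le> C \<and> \<bar>f x - f y\<bar> \<le> C * (\<Sum>i<N. \<bar>x i - y i\<bar>)"
  using assms(1)
proof (induction rule: polyfun.induct)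
  case (const n c)
  then show ?case by (intro exI[of _ "\<bar>c\<bar>"]) (auto intro!: mult_nonneg_nonneg sum_nonneg)
next
  case (var j n)
  have "\<bar>x j - y j\<bar> \<le> (\<Sum>i<N. \<bar>x i - y i\<bar>)" for x y :: "nat \<Rightarrow> real"
    using var by (intro member_le_sum) auto
  moreover have "(\<Sum>i<N. \<bar>x i - y i\<bar>) \<le> (R + 1) * (\<Sum>i<N. \<bar>x i - y i\<bar>)" for x y :: "nat \<Rightarrow> real"
    using mult_right_mono[of 1 "R + 1" "\<Sum>i<N. \<bar>x i - y i\<bar>"] assms(2) by (simp add: sum_nonneg)
  ultimately have "\<bar>x j - y j\<bar> \<le> (R + 1) * (\<Sum>i<N. \<bar>x i - y i\<bar>)" for x y :: "nat \<Rightarrow> real" by (rule order.trans)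
  moreover have "\<bar>x j\<bar> \<le> R + 1" if "\<forall>i<N. \<bar>x i\<bar> \<le> R \<and> \<bar>y i\<bar> \<le> R" for x y :: "nat \<Rightarrow> real"
    using that[rule_format, of j] var by simp
  ultimately show ?case using assms(2) by (intro exI[of _ "R + 1"]) auto
next
  case (add n f g)
  obtain C where C: "C \<ge> 0" "\<forall>x y. (\<forall>i<N. \<bar>x i\<bar> \<le> R \<and> \<bar>y i\<bar> \<le> R) \<longrightarrow> \<bar>f x\<bar> \<le> C \<and> \<bar>f x - f y\<bar> \<le> C * (\<Sum>i<N. \<bar>x i - y i\<bar>)"
    using add.IH(1) by auto
  obtain D where D: "D \<ge> 0" "\<forall>x y. (\<forall>i<N. \<bar>x i\<bar> \<le> R \<and> \<bar>y i\<bar> \<le> R) \<longrightarrow> \<bar>g x\<bar> \<le> D \<and> \<bar>g x - g y\<bar> \<le> D * (\<Sum>i<N. \<bar>x i - y i\<bar>)"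
    using add.IH(2) by auto
  show ?case
  proof (intro exI[of _ "C + D"] conjI allI impI)
    fix x y :: "nat \<Rightarrow> real" assume xy: "\<forall>i<N. \<bar>x i\<bar> \<le> R \<and> \<bar>y i\<bar> \<le> R"
    have fx: "\<bar>f x\<bar> \<le> C" "\<bar>f x - f y\<bar> \<le> C * (\<Sum>i<N. \<bar>x i - y i\<bar>)" using C(2) xy by blast+
    have gx: "\<bar>g x\<bar> \<le> D" "\<bar>g x - g y\<bar> \<le> D * (\<Sum>i<N. \<bar>x i - y i\<bar>)" using D(2) xy by blast+
    show "\<bar>f x + g x\<bar> \<le> C + D" using fx gx by linarith
    show "\<bar>f x + g x - (f y + g y)\<bar> \<le> (C + D) * (\<Sum>i<N. \<bar>x i - y i\<bar>)"
      unfolding distrib_right using fx gx by linarith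
  qed (use C D in auto)
next
  case (mult n f m g)
  obtain C where C: "C \<ge> 0" "\<forall>x y. (\<forall>i<N. \<bar>x i\<bar> \<le> R \<and> \<bar>y i\<bar> \<le> R) \<longrightarrow> \<bar>f x\<bar> \<le> C \<and> \<bar>f x - f y\<bar> \<le> C * (\<Sum>i<N. \<bar>x i - y i\<bar>)"
    using mult.IH(1) by auto
  obtain D where D: "D \<ge> 0" "\<forall>x y. (\<forall>i<N. \<bar>x i\<bar> \<le> R \<and> \<bar>y i\<bar> \<le> R) \<longrightarrow> \<bar>g x\<bar> \<le> D \<and> \<bar>g x - g y\<bar> \<le> D * (\<Sum>i<N. \<bar>x i - y i\<bar>)"
    using mult.IH(2) by auto
  show ?case
  proof (intro exI[of _ "2 * (C * D)"] conjI allI impI)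
    fix x y :: "nat \<Rightarrow> real" assume xy: "\<forall>i<N. \<bar>x i\<bar> \<le> R \<and> \<bar>y i\<bar> \<le> R"
    let ?S = "\<Sum>i<N. \<bar>x i - y i\<bar>"
    have fx: "\<bar>f x\<bar> \<le> C" "\<bar>f x - f y\<bar> \<le> C * ?S" using C(2) xy by blast+
    have gx: "\<bar>g x\<bar> \<le> D" "\<bar>g x - g y\<bar> \<le> D * ?S" using D(2) xy by blast+
    have gy: "\<bar>g y\<bar> \<le> D" using D(2)[rule_format, of y y] xy by auto
    have "\<bar>f x * g x\<bar> \<le> C * D" unfolding abs_mult using fx gx C D by (intro mult_mono) auto
    then show "\<bar>f x * g x\<bar> \<le> 2 * (C * D)" using C D by (smt (verit) mult_nonneg_nonneg)
    have "\<bar>f x * g x - f y * g y\<bar> = \<bar>f x * (g x - g y) + (f x - f y) * g y\<bar>" by (simp add: algebra_simps)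
    also have "\<dots> \<le> \<bar>f x\<bar> * \<bar>g x - g y\<bar> + \<bar>f x - f y\<bar> * \<bar>g y\<bar>"
      using abs_triangle_ineq[of "f x * (g x - g y)" "(f x - f y) * g y"] by (simp add: abs_mult)
    also have "\<dots> \<le> C * (D * ?S) + (C * ?S) * D"
      using fx gx gy C D by (intro add_mono mult_mono) (auto intro!: mult_nonneg_nonneg sum_nonneg)
    finally show "\<bar>f x * g x - f y * g y\<bar> \<le> 2 * (C * D) * ?S" by (simp add: algebra_simps)
  qed (use C D in auto)
qed

lemma polyfun_continuous_on:
  fixes f :: "(nat \<Rightarrow> 'a::real_normed_field) \<Rightarrow> 'a"
  assumes "polyfun I n f" "\<And>i. i \<in> I \<Longrightarrow> continuous_on S (\<lambda>x. \<theta> x i)"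
  shows "continuous_on S (\<lambda>x. f (\<theta> x))"
  using assms by (induction rule: polyfun.induct) (auto intro!: continuous_intros)

lemma has_derivative_peval_pdiff:
  fixes p :: "'a::real_normed_field mpoly"
  shows "((\<lambda>t. peval p (x(i := t))) has_field_derivative peval_pdiff i p x) (at (x i))"
proof -
  have "((\<lambda>t. Poly_Mapping.lookup p m * (\<Prod>j\<in>Poly_Mapping.keys m. (x(i := t)) j ^ Poly_Mapping.lookup m j))
      has_field_derivative Poly_Mapping.lookup p m * of_nat (Poly_Mapping.lookup m i) *
      (\<Prod>j\<in>Poly_Mapping.keys m. x j ^ (if j = i then Poly_Mapping.lookup m j - 1 else Poly_Mapping.lookup m j))) (at (x i))" for m
  proof (cases "i \<in> Poly_Mapping.keys m")
    case False
    then have "Poly_Mapping.lookup m i = 0" by (simp add: in_keys_iff)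
    moreover have "(\<Prod>j\<in>Poly_Mapping.keys m. (x(i := t)) j ^ Poly_Mapping.lookup m j) =
      (\<Prod>j\<in>Poly_Mapping.keys m. x j ^ Poly_Mapping.lookup m j)" for t
      by (rule prod.cong) (use False in auto)
    ultimately show ?thesis by simp
  next
    case True
    let ?r = "\<Prod>j\<in>Poly_Mapping.keys m - {i}. x j ^ Poly_Mapping.lookup m j"
    have 1: "(\<Prod>j\<in>Poly_Mapping.keys m. (x(i := t)) j ^ Poly_Mapping.lookup m j) = t ^ Poly_Mapping.lookup m i * ?r" for t
      by (subst prod.remove[OF finite_keys True]) (auto intro!: arg_cong2[of _ _ _ _ "(*)"] prod.cong)
    have 2: "(\<Prod>j\<in>Poly_Mapping.keys m. x j ^ (if j = i then Poly_Mapping.lookup m j - 1 else Poly_Mapping.lookup m j)) =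
        x i ^ (Poly_Mapping.lookup m i - 1) * ?r"
      by (subst prod.remove[OF finite_keys True]) (auto intro!: arg_cong2[of _ _ _ _ "(*)"] prod.cong)
    show ?thesis unfolding 1 2
      by (auto intro!: derivative_eq_intros simp: algebra_simps One_nat_def)
  qed
  then show ?thesis unfolding peval_def peval_pdiff_def by (intro DERIV_sum) auto
qed

section \<open>Implicit functions from difference quotients\<close>

definition mk :: "complex \<Rightarrow> complex \<Rightarrow> nat \<Rightarrow> complex" where
  "mk z w = (\<lambda>i. if i = 0 then z else if i = 1 then w else 0)"

text \<open>On the diagonal \<open>A\<close> and \<open>B\<close> are the partial derivatives of \<open>F\<close>.\<close>

definition diff_quot :: "(complex \<Rightarrow> complex \<Rightarrow> complex) \<Rightarrow> (complex \<times> complex \<times> complex \<times> complex \<Rightarrow> complex) \<Rightarrow>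
    (complex \<times> complex \<times> complex \<times> complex \<Rightarrow> complex) \<Rightarrow> bool" where
  "diff_quot F A B \<longleftrightarrow> continuous_on UNIV A \<and> continuous_on UNIV B \<and>
     (\<forall>z w z' w'. F z w - F z' w' = A (z, w, z', w') * (z - z') + B (z, w, z', w') * (w - w'))"

lemma polyfun_continuous_mk:
  assumes "polyfun {0,1} n f" "continuous_on S z" "continuous_on S w"
  shows "continuous_on S (\<lambda>x. f (mk (z x) (w x)))"
  by (rule polyfun_continuous_on[OF assms(1)]) (use assms in \<open>auto simp: mk_def\<close>)

lemma polyfun_diff_quot:
  assumes "polyfun {0,1} n f"
  shows "\<exists>A B. diff_quot (\<lambda>z w. f (mk z w)) A B"
  using assms
proof (induction rule: polyfun.induct)
  case (const n c)
  then show ?case by (intro exI[of _ "\<lambda>_. 0"]) (auto simp: diff_quot_def)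
next
  case (var i n)
  then consider "i = 0" | "i = 1" by auto
  then show ?case
  proof cases
    case 1
    then show ?thesis by (intro exI[of _ "\<lambda>_. 1"] exI[of _ "\<lambda>_. 0"]) (auto simp: diff_quot_def mk_def)
  next
    case 2
    then show ?thesis by (intro exI[of _ "\<lambda>_. 0"] exI[of _ "\<lambda>_. 1"]) (auto simp: diff_quot_def mk_def)
  qed
next
  case (add n f g)
  then obtain A B A' B' where *: "diff_quot (\<lambda>z w. f (mk z w)) A B" "diff_quot (\<lambda>z w. g (mk z w)) A' B'" by blast
  have eqs: "g (mk z w) - g (mk z' w') = A' (z, w, z', w') * (z - z') + B' (z, w, z', w') * (w - w')"
    "f (mk z w) - f (mk z' w') = A (z, w, z', w') * (z - z') + B (z, w, z', w') * (w - w')" for z w z' w'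
    using * by (auto simp: diff_quot_def)
  have eq0: "f (mk z w) + g (mk z w) - (f (mk z' w') + g (mk z' w')) =
     (f (mk z w) - f (mk z' w')) + (g (mk z w) - g (mk z' w'))" for z w z' w' by simp
  have "f (mk z w) + g (mk z w) - (f (mk z' w') + g (mk z' w')) =
     (A (z, w, z', w') + A' (z, w, z', w')) * (z - z') + (B (z, w, z', w') + B' (z, w, z', w')) * (w - w')" for z w z' w'
    unfolding eq0 eqs by (simp add: algebra_simps)
  then have "diff_quot (\<lambda>z w. f (mk z w) + g (mk z w)) (\<lambda>x. A x + A' x) (\<lambda>x. B x + B' x)"
    using * by (simp add: diff_quot_def continuous_on_add)
  then show ?case by blast
next
  case (mult n f m g)
  then obtain A B A' B' where *: "diff_quot (\<lambda>z w. f (mk z w)) A B" "diff_quot (\<lambda>z w. g (mk z w)) A' B'" by blast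
  have cf: "continuous_on UNIV (\<lambda>x. f (mk (fst x) (fst (snd x))))"
    by (intro polyfun_continuous_mk[OF mult.hyps(1)] continuous_intros)
  have cg: "continuous_on UNIV (\<lambda>x. g (mk (fst (snd (snd x))) (snd (snd (snd x)))))"
    by (intro polyfun_continuous_mk[OF mult.hyps(2)] continuous_intros)
  have eqs: "g (mk z w) - g (mk z' w') = A' (z, w, z', w') * (z - z') + B' (z, w, z', w') * (w - w')"
    "f (mk z w) - f (mk z' w') = A (z, w, z', w') * (z - z') + B (z, w, z', w') * (w - w')" for z w z' w'
    using * by (auto simp: diff_quot_def)
  have eq0: "f (mk z w) * g (mk z w) - f (mk z' w') * g (mk z' w') =
     f (mk z w) * (g (mk z w) - g (mk z' w')) + (f (mk z w) - f (mk z' w')) * g (mk z' w')" for z w z' w'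
    by (simp add: algebra_simps)
  have eq: "f (mk z w) * g (mk z w) - f (mk z' w') * g (mk z' w') =
     (f (mk z w) * A' (z, w, z', w') + A (z, w, z', w') * g (mk z' w')) * (z - z') +
     (f (mk z w) * B' (z, w, z', w') + B (z, w, z', w') * g (mk z' w')) * (w - w')" for z w z' w'
    unfolding eq0 eqs by (simp add: algebra_simps)
  have "diff_quot (\<lambda>z w. f (mk z w) * g (mk z w))
      (\<lambda>x. f (mk (fst x) (fst (snd x))) * A' x + A x * g (mk (fst (snd (snd x))) (snd (snd (snd x)))))
      (\<lambda>x. f (mk (fst x) (fst (snd x))) * B' x + B x * g (mk (fst (snd (snd x))) (snd (snd (snd x)))))"
    unfolding diff_quot_def
  proof (intro conjI allI)
    show "continuous_on UNIV (\<lambda>x. f (mk (fst x) (fst (snd x))) * A' x + A x * g (mk (fst (snd (snd x))) (snd (snd (snd x)))))"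
      by (intro continuous_on_add continuous_on_mult cf cg) (use * in \<open>auto simp: diff_quot_def\<close>)
    show "continuous_on UNIV (\<lambda>x. f (mk (fst x) (fst (snd x))) * B' x + B x * g (mk (fst (snd (snd x))) (snd (snd (snd x)))))"
      by (intro continuous_on_add continuous_on_mult cf cg) (use * in \<open>auto simp: diff_quot_def\<close>)
  qed (simp add: eq)
  then show ?case by blast
qed

lemma diff_quot_swap:
  assumes "diff_quot F A B"
  shows "diff_quot (\<lambda>w z. F z w) (\<lambda>x. B (fst (snd x), fst x, snd (snd (snd x)), fst (snd (snd x))))
    (\<lambda>x. A (fst (snd x), fst x, snd (snd (snd x)), fst (snd (snd x))))"
proof -
  have A: "continuous_on UNIV A" and B: "continuous_on UNIV B"
    and eq: "\<forall>z w z' w'. F z w - F z' w' = A (z, w, z', w') * (z - z') + B (z, w, z', w') * (w - w')"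
    using assms by (auto simp: diff_quot_def)
  have c: "continuous_on UNIV (\<lambda>x :: complex \<times> complex \<times> complex \<times> complex. (fst (snd x), fst x, snd (snd (snd x)), fst (snd (snd x))))"
    by (intro continuous_intros)
  have "F z w - F z' w' = B (z, w, z', w') * (w - w') + A (z, w, z', w') * (z - z')" for z w z' w'
    using eq by simp
  then show ?thesis
    unfolding diff_quot_def
    using continuous_on_compose2[OF A c subset_UNIV] continuous_on_compose2[OF B c subset_UNIV] by simp
qed

lemma dist_Pair_le: "dist (a, b) (a', b') \<le> dist a a' + dist b b'"
  unfolding dist_Pair_Pair by (rule sqrt_sum_squares_le_sum) auto

text \<open>A Newton map with frozen slope \<open>\<beta>\<close> is a contraction. The difference
  identity stands in for differentiability of \<open>F\<close>: applied to two points of the zero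
  set it expresses the increment of \<open>u\<close> exactly, from which continuity and then the
  derivative follow.\<close>

lemma diff_quot_implicit:
  assumes F: "diff_quot F A B" and q: "F q0 q1 = 0" "B (q0, q1, q0, q1) \<noteq> 0"
  shows "\<exists>r u. r > 0 \<and> u q0 = q1 \<and> (\<forall>z\<in>ball q0 r. F z (u z) = 0) \<and>
    (\<forall>z\<in>ball q0 r. (u has_field_derivative - A (z, u z, z, u z) / B (z, u z, z, u z)) (at z))"
proof -
  define \<beta> where "\<beta> = B (q0, q1, q0, q1)"
  have \<beta>: "\<beta> \<noteq> 0" using q by (simp add: \<beta>_def)
  have cA: "continuous_on UNIV A" and cB: "continuous_on UNIV B"
    and dq: "\<And>z w z' w'. F z w - F z' w' = A (z, w, z', w') * (z - z') + B (z, w, z', w') * (w - w')"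
    using F by (auto simp: diff_quot_def)
  have "isCont (\<lambda>x. 1 - B x / \<beta>) (q0, q1, q0, q1)"
    using cB \<beta> by (intro continuous_intros) (auto simp: continuous_on_eq_continuous_at)
  then have "\<exists>\<delta>>0. \<forall>x. dist x (q0, q1, q0, q1) < \<delta> \<longrightarrow> dist (1 - B x / \<beta>) (1 - B (q0, q1, q0, q1) / \<beta>) < 1 / 2"
    unfolding continuous_at_eps_delta by (elim allE[of _ "1 / 2"]) auto
  then obtain \<delta> where \<delta>: "\<delta> > 0" "\<And>x. dist x (q0, q1, q0, q1) < \<delta> \<Longrightarrow> dist (1 - B x / \<beta>) (1 - B (q0, q1, q0, q1) / \<beta>) < 1 / 2"
    by blast
  \<comment> \<open>Four coordinates, each off by at most \<open>\<epsilon>\<close>, stay within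
    \<open>4 * \<epsilon> < \<delta>\<close>.\<close>
  define \<epsilon> where "\<epsilon> = \<delta> / 5"
  have \<epsilon>: "\<epsilon> > 0" using \<delta> by (simp add: \<epsilon>_def)
  have Bs: "norm (1 - B (z, w, z', w') / \<beta>) \<le> 1 / 2"
    if "z \<in> cball q0 \<epsilon>" "w \<in> cball q1 \<epsilon>" "z' \<in> cball q0 \<epsilon>" "w' \<in> cball q1 \<epsilon>" for z w z' w'
  proof -
    have "dist (z, w, z', w') (q0, q1, q0, q1) \<le> dist z q0 + (dist w q1 + (dist z' q0 + dist w' q1))"
      using dist_Pair_le[of z "(w, z', w')" q0 "(q1, q0, q1)"] dist_Pair_le[of w "(z', w')" q1 "(q0, q1)"]
        dist_Pair_le[of z' w' q0 q1] by linarith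
    also have "\<dots> \<le> 4 * \<epsilon>" using that by (simp add: dist_commute)
    also have "\<dots> < \<delta>" using \<delta> by (simp add: \<epsilon>_def)
    finally show ?thesis using \<delta>(2)[of "(z, w, z', w')"] \<beta> by (simp add: \<beta>_def[symmetric] dist_norm)
  qed
  have Bnz: "B (z, w, z', w') \<noteq> 0"
    if "z \<in> cball q0 \<epsilon>" "w \<in> cball q1 \<epsilon>" "z' \<in> cball q0 \<epsilon>" "w' \<in> cball q1 \<epsilon>" for z w z' w'
    using Bs[OF that] by auto
  have "continuous_on UNIV (\<lambda>z. A (z, q1, q0, q1))"
    by (intro continuous_on_compose2[OF cA] continuous_intros) auto
  then have "continuous_on UNIV (\<lambda>z. A (z, q1, q0, q1) * (z - q0))" by (intro continuous_intros)
  moreover have eqF: "F z q1 = A (z, q1, q0, q1) * (z - q0)" for z using dq[of z q1 q0 q1] q by simp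
  ultimately have "isCont (\<lambda>z. F z q1) q0" by (simp add: continuous_on_eq_continuous_at)
  \<comment> \<open>With this threshold the Newton map moves the centre \<open>q1\<close> by at most
    \<open>\<epsilon> / 2\<close>; together with the contraction factor 1/2 it preserves the closed
    ball.\<close>
  moreover have "norm \<beta> * \<epsilon> / 2 > 0" using \<beta> \<epsilon> by simp
  ultimately have "\<exists>\<eta>>0. \<forall>z. dist z q0 < \<eta> \<longrightarrow> dist (F z q1) (F q0 q1) < norm \<beta> * \<epsilon> / 2"
    unfolding continuous_at_eps_delta by (elim allE[of _ "norm \<beta> * \<epsilon> / 2"]) auto
  then obtain \<eta> where \<eta>: "\<eta> > 0" "\<And>z. dist z q0 < \<eta> \<Longrightarrow> dist (F z q1) (F q0 q1) < norm \<beta> * \<epsilon> / 2"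
    by blast
  define r where "r = min \<eta> \<epsilon>"
  have r: "r > 0" using \<eta> \<epsilon> by (simp add: r_def)
  have zr: "z \<in> cball q0 \<epsilon>" if "z \<in> ball q0 r" for z using that by (auto simp: r_def)
  have q1c: "q1 \<in> cball q1 \<epsilon>" and q0c: "q0 \<in> cball q0 \<epsilon>" using \<epsilon> by auto
  have ex: "\<exists>w\<in>cball q1 \<epsilon>. F z w = 0" if z: "z \<in> ball q0 r" for z
  proof -
    define T where "T w = w - F z w / \<beta>" for w
    have Td: "T w - T w' = (1 - B (z, w, z, w') / \<beta>) * (w - w')" for w w'
    proof -
      have "T w - T w' = (w - w') - (F z w - F z w') / \<beta>" by (simp add: T_def diff_divide_distrib)
      also have "F z w - F z w' = B (z, w, z, w') * (w - w')" using dq[of z w z w'] by simp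
      finally show ?thesis by (simp add: algebra_simps)
    qed
    have Tl: "dist (T w) (T w') \<le> 1 / 2 * dist w w'" if "w \<in> cball q1 \<epsilon>" "w' \<in> cball q1 \<epsilon>" for w w'
      unfolding dist_norm Td norm_mult by (intro mult_right_mono Bs zr z that) auto
    have Tq: "dist (T q1) q1 \<le> \<epsilon> / 2"
    proof -
      have "dist (T q1) q1 = norm (F z q1) / norm \<beta>" by (simp add: T_def dist_norm norm_divide)
      also have "norm (F z q1) \<le> norm \<beta> * \<epsilon> / 2" using \<eta>(2)[of z] z q by (simp add: r_def dist_commute)
      then have "norm (F z q1) / norm \<beta> \<le> \<epsilon> / 2" using \<beta> by (simp add: field_simps)
      finally show ?thesis .
    qed
    have "\<exists>!w\<in>cball q1 \<epsilon>. T w = w"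
    proof (rule Banach_fix[where c="1 / 2"])
      show "complete (cball q1 \<epsilon>)" by (simp add: compact_imp_complete)
      show "cball q1 \<epsilon> \<noteq> {}" using q1c by blast
      show "T ` cball q1 \<epsilon> \<subseteq> cball q1 \<epsilon>"
      proof safe
        fix w assume w: "w \<in> cball q1 \<epsilon>"
        have "dist (T w) q1 \<le> dist (T w) (T q1) + dist (T q1) q1" by (rule dist_triangle)
        also have "\<dots> \<le> 1 / 2 * dist w q1 + \<epsilon> / 2" using Tl[OF w q1c] Tq by (intro add_mono) auto
        also have "\<dots> \<le> \<epsilon>" using w by (simp add: dist_commute)
        finally show "T w \<in> cball q1 \<epsilon>" by (simp add: dist_commute)
      qed
    qed (use Tl in auto)
    then obtain w where "w \<in> cball q1 \<epsilon>" "T w = w" by blast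
    then show ?thesis using \<beta> by (intro bexI[of _ w]) (auto simp: T_def)
  qed
  define u where "u z = (if z \<in> ball q0 r then SOME w. w \<in> cball q1 \<epsilon> \<and> F z w = 0 else q1)" for z
  have u: "u z \<in> cball q1 \<epsilon>" "F z (u z) = 0" if "z \<in> ball q0 r" for z
  proof -
    have "u z = (SOME w. w \<in> cball q1 \<epsilon> \<and> F z w = 0)" using that by (simp add: u_def)
    then show "u z \<in> cball q1 \<epsilon>" "F z (u z) = 0" using someI_ex[OF ex[OF that, unfolded Bex_def]] by simp_all
  qed
  have uq: "u q0 = q1"
  proof -
    have "q0 \<in> ball q0 r" using r by simp
    then have "B (q0, u q0, q0, q1) * (u q0 - q1) = 0" using dq[of q0 "u q0" q0 q1] u(2)[of q0] q by simp
    then show ?thesis using Bnz[OF q0c u(1) q0c q1c] \<open>q0 \<in> ball q0 r\<close> by auto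
  qed
  have step: "u z' - u z = - (A (z', u z', z, u z) / B (z', u z', z, u z)) * (z' - z)"
    if "z \<in> ball q0 r" "z' \<in> ball q0 r" for z z'
  proof -
    have "B (z', u z', z, u z) \<noteq> 0" by (rule Bnz[OF zr u(1) zr u(1)]) (use that in auto)
    moreover have "A (z', u z', z, u z) * (z' - z) + B (z', u z', z, u z) * (u z' - u z) = 0"
      using dq[of z' "u z'" z "u z"] u(2) that by simp
    ultimately show ?thesis by (simp add: field_simps add_eq_0_iff)
  qed
  have cont: "isCont u z" if z: "z \<in> ball q0 r" for z
  proof -
    have "compact (cball q0 \<epsilon> \<times> cball q1 \<epsilon> \<times> cball q0 \<epsilon> \<times> cball q1 \<epsilon>)" by (intro compact_Times compact_cball)
    moreover have "continuous_on (cball q0 \<epsilon> \<times> cball q1 \<epsilon> \<times> cball q0 \<epsilon> \<times> cball q1 \<epsilon>) (\<lambda>x. A x / B x)"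
      using Bnz by (intro continuous_intros continuous_on_subset[OF cA] continuous_on_subset[OF cB]) auto
    ultimately have "bounded ((\<lambda>x. A x / B x) ` (cball q0 \<epsilon> \<times> cball q1 \<epsilon> \<times> cball q0 \<epsilon> \<times> cball q1 \<epsilon>))"
      by (intro compact_imp_bounded compact_continuous_image)
    then obtain L where L: "\<And>x. x \<in> cball q0 \<epsilon> \<times> cball q1 \<epsilon> \<times> cball q0 \<epsilon> \<times> cball q1 \<epsilon> \<Longrightarrow> norm (A x / B x) \<le> L"
      unfolding bounded_iff by blast
    have le: "norm (u z' - u z) \<le> L * norm (z' - z)" if "z' \<in> ball q0 r" for z'
      unfolding step[OF z that] norm_mult norm_minus_cancel
      by (intro mult_right_mono L) (use zr[OF z] zr[OF that] u(1)[OF z] u(1)[OF that] in auto)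
    have "((\<lambda>z'. u z' - u z) \<longlongrightarrow> 0) (at z)"
    proof (rule Lim_null_comparison)
      show "\<forall>\<^sub>F z' in at z. norm (u z' - u z) \<le> L * norm (z' - z)"
        using eventually_at_in_open'[of "ball q0 r" z] z le by (auto elim: eventually_mono)
      have "((\<lambda>z'. L * norm (z' - z)) \<longlongrightarrow> L * norm (z - z)) (at z)" by (intro tendsto_intros)
      then show "((\<lambda>z'. L * norm (z' - z)) \<longlongrightarrow> 0) (at z)" by simp
    qed
    then show ?thesis unfolding isCont_def by (simp add: LIM_zero_iff)
  qed
  have der: "(u has_field_derivative - A (z, u z, z, u z) / B (z, u z, z, u z)) (at z)" if z: "z \<in> ball q0 r" for z
  proof -
    have "isCont (\<lambda>z'. (z', u z', z, u z)) z" using cont[OF z] by (intro continuous_intros)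
    then have "isCont (\<lambda>z'. A (z', u z', z, u z)) z" "isCont (\<lambda>z'. B (z', u z', z, u z)) z"
      using isCont_o2[of z "\<lambda>z'. (z', u z', z, u z)" A] isCont_o2[of z "\<lambda>z'. (z', u z', z, u z)" B] cA cB
      by (simp_all add: continuous_on_eq_continuous_at)
    moreover have "B (z, u z, z, u z) \<noteq> 0" by (rule Bnz[OF zr[OF z] u(1)[OF z] zr[OF z] u(1)[OF z]])
    ultimately have "isCont (\<lambda>z'. - (A (z', u z', z, u z) / B (z', u z', z, u z))) z" by (intro continuous_intros)
    then have lim: "((\<lambda>z'. - (A (z', u z', z, u z) / B (z', u z', z, u z))) \<longlongrightarrow> - (A (z, u z, z, u z) / B (z, u z, z, u z))) (at z)"
      by (simp add: isCont_def)
    have "((\<lambda>z'. (u z' - u z) / (z' - z)) \<longlongrightarrow> - (A (z, u z, z, u z) / B (z, u z, z, u z))) (at z)"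
    proof (rule Lim_transform_eventually[OF lim])
      have "\<forall>\<^sub>F z' in at z. z' \<in> ball q0 r - {z}" using z by (intro eventually_at_in_open) auto
      then show "\<forall>\<^sub>F z' in at z. - (A (z', u z', z, u z) / B (z', u z', z, u z)) = (u z' - u z) / (z' - z)"
        by (rule eventually_mono) (use step[OF z] in auto)
    qed
    then show ?thesis by (simp add: has_field_derivative_iff)
  qed
  show ?thesis
    by (intro exI[of _ r] exI[of _ u] conjI ballI r uq u(2) der)
qed

text \<open>Two solutions \<open>u1\<close>, \<open>u2\<close> of the same equation \<open>A + B u' = 0\<close> with Lipschitz coefficients
  satisfy \<open>\<bar>(u1 - u2)'\<bar> \<le> C \<bar>u1 - u2\<bar>\<close>, which on a small disc forces \<open>u1 = u2\<close>.\<close>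

lemma holomorphic_gronwall:
  fixes w :: "complex \<Rightarrow> complex"
  assumes "r > 0" "w q = 0" "C \<ge> 0"
    and der: "\<And>z. z \<in> ball q r \<Longrightarrow> (w has_field_derivative w' z) (at z)"
    and le: "\<And>z. z \<in> ball q r \<Longrightarrow> norm (w' z) \<le> C * norm (w z)"
  shows "\<exists>\<rho>>0. \<forall>z\<in>ball q \<rho>. w z = 0"
proof -
  \<comment> \<open>A radius with \<open>C * \<rho> \<le> 1 / 2\<close>: the mean value bound at a
    maximum of \<open>norm (w z)\<close> is then at most half that maximum, which must be 0.\<close>
  define \<rho> where "\<rho> = min (r / 2) (1 / (2 * (C + 1)))"
  have \<rho>: "\<rho> > 0" "cball q \<rho> \<subseteq> ball q r" using assms by (auto simp: \<rho>_def)
  have C\<rho>: "C * \<rho> \<le> 1 / 2"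
  proof -
    have "C * \<rho> \<le> C * (1 / (2 * (C + 1)))" using assms by (intro mult_left_mono) (auto simp: \<rho>_def)
    also have "\<dots> \<le> 1 / 2" using assms by (simp add: field_simps)
    finally show ?thesis .
  qed
  have "continuous_on (cball q \<rho>) (\<lambda>z. norm (w z))"
    by (intro continuous_on_norm continuous_at_imp_continuous_on ballI, rule DERIV_isCont, rule der) (use \<rho>(2) in blast)
  moreover have "cball q \<rho> \<noteq> {}" using \<rho> by auto
  ultimately obtain z0 where z0: "z0 \<in> cball q \<rho>" "\<forall>z\<in>cball q \<rho>. norm (w z) \<le> norm (w z0)"
    using continuous_attains_sup[OF compact_cball, of q \<rho> "\<lambda>z. norm (w z)"] by auto
  have "norm (w z0 - w q) \<le> (C * norm (w z0)) * norm (z0 - q)"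
  proof (rule field_differentiable_bound[of "cball q \<rho>"])
    show "(w has_field_derivative w' z) (at z within cball q \<rho>)" if "z \<in> cball q \<rho>" for z
      by (rule has_field_derivative_at_within, rule der) (use \<rho>(2) that in blast)
    show "norm (w' z) \<le> C * norm (w z0)" if "z \<in> cball q \<rho>" for z
    proof -
      have "norm (w' z) \<le> C * norm (w z)" using le \<rho>(2) that by blast
      also have "\<dots> \<le> C * norm (w z0)" using z0 that assms by (intro mult_left_mono) auto
      finally show ?thesis .
    qed
  qed (use z0 \<rho> in auto)
  also have "\<dots> \<le> (C * norm (w z0)) * \<rho>"
    using z0 assms by (intro mult_left_mono) (auto simp: dist_norm norm_minus_commute)
  also have "\<dots> = (C * \<rho>) * norm (w z0)" by simp
  also have "\<dots> \<le> 1 / 2 * norm (w z0)" using C\<rho> by (intro mult_right_mono) auto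
  finally have "norm (w z0) = 0" using assms(2) by simp
  then have "norm (w z) \<le> 0" if "z \<in> ball q \<rho>" for z using z0(2)[rule_format, of z] that by simp
  then show ?thesis using \<rho>(1) by auto
qed

text \<open>\<open>A\<close> and \<open>B\<close> model twice the Wirtinger derivatives of the real
  function \<open>R\<close> in \<open>z\<close> and \<open>w\<close>. By \<open>chain\<close>, the
  tangent of a holomorphic curve in the zero set of \<open>R\<close> is annihilated by this pair;
  where the pair is nonzero only one complex direction remains.\<close>

locale complex_gradient =
  fixes R :: "complex \<Rightarrow> complex \<Rightarrow> real" and A B :: "complex \<Rightarrow> complex \<Rightarrow> complex"
  assumes chain: "\<And>a b a' b' z. (a has_field_derivative a') (at z) \<Longrightarrow> (b has_field_derivative b') (at z) \<Longrightarrow>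
      \<forall>\<^sub>F s in nhds z. R (a s) (b s) = 0 \<Longrightarrow> A (a z) (b z) * a' + B (a z) (b z) * b' = 0"
    and lipschitz: "\<And>K. K \<ge> 0 \<Longrightarrow> \<exists>C\<ge>0. \<forall>z w z' w'. norm z \<le> K \<longrightarrow> norm w \<le> K \<longrightarrow> norm z' \<le> K \<longrightarrow> norm w' \<le> K \<longrightarrow>
      norm (A z w - A z' w') \<le> C * (norm (z - z') + norm (w - w')) \<and> norm (B z w - B z' w') \<le> C * (norm (z - z') + norm (w - w'))"

lemma complex_gradient_swap:
  assumes "complex_gradient R A B"
  shows "complex_gradient (\<lambda>w z. R z w) (\<lambda>w z. B z w) (\<lambda>w z. A z w)"
proof -
  interpret complex_gradient R A B by fact
  show ?thesis
  proof
    fix a b :: "complex \<Rightarrow> complex" and a' b' z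
    assume "(a has_field_derivative a') (at z)" "(b has_field_derivative b') (at z)" "\<forall>\<^sub>F s in nhds z. R (b s) (a s) = 0"
    then show "B (b z) (a z) * a' + A (b z) (a z) * b' = 0" using chain[of b b' z a a'] by (simp add: add.commute)
  next
    fix K :: real assume "K \<ge> 0"
    obtain C where C: "C \<ge> 0" "\<forall>z w z' w'. norm z \<le> K \<longrightarrow> norm w \<le> K \<longrightarrow> norm z' \<le> K \<longrightarrow> norm w' \<le> K \<longrightarrow>
      norm (A z w - A z' w') \<le> C * (norm (z - z') + norm (w - w')) \<and> norm (B z w - B z' w') \<le> C * (norm (z - z') + norm (w - w'))"
      using lipschitz[OF \<open>K \<ge> 0\<close>] by (elim exE conjE) (rule that; assumption)
    show "\<exists>C\<ge>0. \<forall>z w z' w'. norm z \<le> K \<longrightarrow> norm w \<le> K \<longrightarrow> norm z' \<le> K \<longrightarrow> norm w' \<le> K \<longrightarrow>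
      norm (B w z - B w' z') \<le> C * (norm (z - z') + norm (w - w')) \<and> norm (A w z - A w' z') \<le> C * (norm (z - z') + norm (w - w'))"
    proof (intro exI[of _ C] conjI allI impI)
      fix z w z' w' :: complex assume n: "norm z \<le> K" "norm w \<le> K" "norm z' \<le> K" "norm w' \<le> K"
      have "norm (A w z - A w' z') \<le> C * (norm (w - w') + norm (z - z')) \<and> norm (B w z - B w' z') \<le> C * (norm (w - w') + norm (z - z'))"
        using C(2) n by blast
      then show "norm (B w z - B w' z') \<le> C * (norm (z - z') + norm (w - w'))" "norm (A w z - A w' z') \<le> C * (norm (z - z') + norm (w - w'))"
        by (simp_all add: add.commute)
    qed (rule C)
  qed
qed

context complex_gradient
begin

text \<open>Near the base point \<open>B\<close> stays away from 0, so subtracting the two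
  differential equations bounds the difference of the derivatives by a multiple of
  \<open>norm (u1 z - u2 z)\<close>, and \<open>holomorphic_gronwall\<close> applies.\<close>

lemma ode_unique:
  assumes q: "B q0 q1 \<noteq> 0" and r: "r > 0" and u: "u1 q0 = q1" "u2 q0 = q1"
    and d1: "\<And>z. z \<in> ball q0 r \<Longrightarrow> (u1 has_field_derivative u1' z) (at z)"
    and d2: "\<And>z. z \<in> ball q0 r \<Longrightarrow> (u2 has_field_derivative u2' z) (at z)"
    and e1: "\<And>z. z \<in> ball q0 r \<Longrightarrow> R z (u1 z) = 0" and e2: "\<And>z. z \<in> ball q0 r \<Longrightarrow> R z (u2 z) = 0"
  shows "\<exists>\<rho>>0. \<rho> \<le> r \<and> (\<forall>z\<in>ball q0 \<rho>. u1 z = u2 z)"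
proof -
  have ode: "A z (v z) + B z (v z) * v' = 0"
    if "z \<in> ball q0 r" "(v has_field_derivative v') (at z)" "\<And>z. z \<in> ball q0 r \<Longrightarrow> R z (v z) = 0" for z v v'
  proof -
    have "\<forall>\<^sub>F s in nhds z. s \<in> ball q0 r" using that(1) by (intro eventually_nhds_in_open) auto
    then have "\<forall>\<^sub>F s in nhds z. R s (v s) = 0" by (rule eventually_mono) (use that(3) in auto)
    from chain[OF DERIV_ident that(2) this] show ?thesis by simp
  qed
  define K where "K = norm q0 + norm q1 + 1"
  have K0: "K \<ge> 0" by (simp add: K_def add_nonneg_nonneg)
  obtain C where C: "C \<ge> 0" "\<forall>z w z' w'. norm z \<le> K \<longrightarrow> norm w \<le> K \<longrightarrow> norm z' \<le> K \<longrightarrow> norm w' \<le> K \<longrightarrow>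
      norm (A z w - A z' w') \<le> C * (norm (z - z') + norm (w - w')) \<and> norm (B z w - B z' w') \<le> C * (norm (z - z') + norm (w - w'))"
    using lipschitz[OF K0] by (elim exE conjE) (rule that; assumption)
  define \<beta> where "\<beta> = norm (B q0 q1)"
  have \<beta>: "\<beta> > 0" using q by (simp add: \<beta>_def)
  \<comment> \<open>Chosen so that the Lipschitz bound moves \<open>A\<close> and \<open>B\<close>
    by at most \<open>\<beta> / 2\<close>; in particular \<open>norm B\<close> stays at least
    \<open>\<beta> / 2\<close>.\<close>
  define \<epsilon> where "\<epsilon> = min 1 (\<beta> / (4 * (C + 1)))"
  have \<epsilon>: "\<epsilon> > 0" "\<epsilon> \<le> 1" using \<beta> C by (auto simp: \<epsilon>_def)
  have C\<epsilon>: "C * (\<epsilon> + \<epsilon>) \<le> \<beta> / 2"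
  proof -
    have "(C + 1) * \<epsilon> \<le> (C + 1) * (\<beta> / (4 * (C + 1)))" using C by (intro mult_left_mono) (auto simp: \<epsilon>_def)
    also have "\<dots> = \<beta> / 4" using C by (simp add: field_simps)
    finally show ?thesis using \<epsilon> by (simp add: algebra_simps)
  qed
  have "isCont u1 q0" "isCont u2 q0" using d1[of q0] d2[of q0] r by (auto intro: DERIV_isCont)
  then have ex: "\<exists>\<eta>>0. \<forall>z. dist z q0 < \<eta> \<longrightarrow> dist (u1 z) q1 < \<epsilon>" "\<exists>\<eta>>0. \<forall>z. dist z q0 < \<eta> \<longrightarrow> dist (u2 z) q1 < \<epsilon>"
    unfolding continuous_at_eps_delta u using \<epsilon> by simp_all
  obtain \<eta>1 where \<eta>1: "\<eta>1 > 0" "\<forall>z. dist z q0 < \<eta>1 \<longrightarrow> dist (u1 z) q1 < \<epsilon>" using ex(1) by blast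
  obtain \<eta>2 where \<eta>2: "\<eta>2 > 0" "\<forall>z. dist z q0 < \<eta>2 \<longrightarrow> dist (u2 z) q1 < \<epsilon>" using ex(2) by blast
  note \<eta> = \<eta>1 \<eta>2
  define s where "s = min r (min \<epsilon> (min \<eta>1 \<eta>2))"
  have s: "s > 0" "s \<le> r" using r \<epsilon> \<eta> by (auto simp: s_def)
  have near: "norm (z - q0) \<le> \<epsilon>" "norm (u1 z - q1) \<le> \<epsilon>" "norm (u2 z - q1) \<le> \<epsilon>" "z \<in> ball q0 r" if "z \<in> ball q0 s" for z
  proof -
    have d: "dist z q0 < r" "dist z q0 < \<epsilon>" "dist z q0 < \<eta>1" "dist z q0 < \<eta>2"
      using that by (simp_all add: s_def dist_commute)
    show "norm (z - q0) \<le> \<epsilon>" "z \<in> ball q0 r" using d by (simp_all add: dist_norm norm_minus_commute)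
    show "norm (u1 z - q1) \<le> \<epsilon>" "norm (u2 z - q1) \<le> \<epsilon>"
      using \<eta>1(2)[rule_format, OF d(3)] \<eta>2(2)[rule_format, OF d(4)] by (simp_all add: dist_norm)
  qed
  have K: "norm z \<le> K" "norm (u1 z) \<le> K" "norm (u2 z) \<le> K" if "z \<in> ball q0 s" for z
    using near[OF that] \<epsilon> norm_triangle_sub[of z q0] norm_triangle_sub[of "u1 z" q1] norm_triangle_sub[of "u2 z" q1]
      norm_ge_zero[of q0] norm_ge_zero[of q1]
    unfolding K_def by linarith+
  have Kq: "norm q0 \<le> K" "norm q1 \<le> K" by (auto simp: K_def)
  have Bl: "norm (B z (v z)) \<ge> \<beta> / 2" if "z \<in> ball q0 s" "norm (v z - q1) \<le> \<epsilon>" "norm (v z) \<le> K" for z v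
  proof -
    have "norm (B z (v z) - B q0 q1) \<le> C * (norm (z - q0) + norm (v z - q1))" using C(2) K(1)[OF that(1)] Kq that by blast
    also have "\<dots> \<le> C * (\<epsilon> + \<epsilon>)" using near(1)[OF that(1)] that C by (intro mult_left_mono add_mono) auto
    finally have "norm (B z (v z) - B q0 q1) \<le> \<beta> / 2" using C\<epsilon> by simp
    then show ?thesis using norm_triangle_ineq2[of "B q0 q1" "B z (v z)"] by (simp add: \<beta>_def norm_minus_commute)
  qed
  have Al: "norm (A z (u2 z)) \<le> norm (A q0 q1) + \<beta> / 2" if "z \<in> ball q0 s" for z
  proof -
    have "norm (A z (u2 z) - A q0 q1) \<le> C * (norm (z - q0) + norm (u2 z - q1))" using C(2) K[OF that] Kq by blast
    also have "\<dots> \<le> C * (\<epsilon> + \<epsilon>)" using near[OF that] C by (intro mult_left_mono add_mono) auto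
    finally have "norm (A z (u2 z) - A q0 q1) \<le> \<beta> / 2" using C\<epsilon> by simp
    then show ?thesis using norm_triangle_sub[of "A z (u2 z)" "A q0 q1"] by simp
  qed
  define D where "D = (norm (A q0 q1) + \<beta> / 2) / (\<beta> / 2)"
  have D0: "D \<ge> 0" using \<beta> by (simp add: D_def)
  have u2': "norm (u2' z) \<le> D" if z: "z \<in> ball q0 s" for z
  proof -
    have "A z (u2 z) + B z (u2 z) * u2' z = 0" using ode[OF near(4)[OF z] d2 e2] near(4)[OF z] by blast
    then have "A z (u2 z) = - (B z (u2 z) * u2' z)" by (simp add: eq_neg_iff_add_eq_0)
    then have "norm (B z (u2 z)) * norm (u2' z) = norm (A z (u2 z))" by (simp add: norm_mult)
    then have "\<beta> / 2 * norm (u2' z) \<le> norm (A q0 q1) + \<beta> / 2"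
      using mult_right_mono[OF Bl[where v=u2, OF z near(3)[OF z] K(3)[OF z]] norm_ge_zero, of "u2' z"] Al[OF z] by linarith
    moreover have "\<beta> / 2 > 0" using \<beta> by simp
    ultimately show ?thesis unfolding D_def by (subst pos_le_divide_eq) (simp_all add: mult.commute)
  qed
  define C' where "C' = (C + C * D) / (\<beta> / 2)"
  have C': "C' \<ge> 0" using C D0 \<beta> by (simp add: C'_def)
  have le: "norm (u1' z - u2' z) \<le> C' * norm (u1 z - u2 z)" if z: "z \<in> ball q0 s" for z
  proof -
    have o1: "A z (u1 z) + B z (u1 z) * u1' z = 0" using ode[OF near(4)[OF z] d1 e1] near(4)[OF z] by blast
    have o2: "A z (u2 z) + B z (u2 z) * u2' z = 0" using ode[OF near(4)[OF z] d2 e2] near(4)[OF z] by blast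
    \<comment> \<open>The derivatives are compared with \<open>B\<close> taken along
      \<open>u1\<close>. The increment of \<open>B\<close> is then multiplied by \<open>u2'\<close>,
      which is why that derivative was bounded first.\<close>
    have "B z (u1 z) * (u1' z - u2' z) = (A z (u1 z) + B z (u1 z) * u1' z) - (A z (u2 z) + B z (u2 z) * u2' z)
        - (A z (u1 z) - A z (u2 z)) - (B z (u1 z) - B z (u2 z)) * u2' z" by (simp add: algebra_simps)
    then have "B z (u1 z) * (u1' z - u2' z) = - (A z (u1 z) - A z (u2 z)) - (B z (u1 z) - B z (u2 z)) * u2' z"
      unfolding o1 o2 by simp
    then have "norm (B z (u1 z)) * norm (u1' z - u2' z) = norm (- (A z (u1 z) - A z (u2 z)) - (B z (u1 z) - B z (u2 z)) * u2' z)"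
      by (simp flip: norm_mult)
    also have "\<dots> \<le> norm (A z (u1 z) - A z (u2 z)) + norm (B z (u1 z) - B z (u2 z)) * norm (u2' z)"
      by (rule order.trans[OF norm_triangle_ineq4]) (simp only: norm_minus_cancel norm_mult order.refl)
    also have "\<dots> \<le> C * norm (u1 z - u2 z) + (C * norm (u1 z - u2 z)) * D"
    proof -
      have "norm (A z (u1 z) - A z (u2 z)) \<le> C * (norm (z - z) + norm (u1 z - u2 z)) \<and>
        norm (B z (u1 z) - B z (u2 z)) \<le> C * (norm (z - z) + norm (u1 z - u2 z))"
        using C(2) K[OF z] by blast
      then show ?thesis using u2'[OF z] C by (intro add_mono mult_mono) auto
    qed
    finally have "norm (B z (u1 z)) * norm (u1' z - u2' z) \<le> (C + C * D) * norm (u1 z - u2 z)" by (simp add: algebra_simps)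
    moreover have "\<beta> / 2 * norm (u1' z - u2' z) \<le> norm (B z (u1 z)) * norm (u1' z - u2' z)"
      using Bl[of z u1] near[OF z] K[OF z] z by (intro mult_right_mono) auto
    ultimately have "\<beta> / 2 * norm (u1' z - u2' z) \<le> (C + C * D) * norm (u1 z - u2 z)" by linarith
    moreover have "\<beta> / 2 > 0" using \<beta> by simp
    ultimately have "norm (u1' z - u2' z) \<le> (C + C * D) * norm (u1 z - u2 z) / (\<beta> / 2)"
      by (subst pos_le_divide_eq) (simp_all add: mult.commute)
    then show ?thesis by (simp only: C'_def times_divide_eq_left)
  qed
  have dd: "((\<lambda>z. u1 z - u2 z) has_field_derivative u1' z - u2' z) (at z)" if "z \<in> ball q0 s" for z
    using near(4)[OF that] by (intro DERIV_diff d1 d2)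
  have "u1 q0 - u2 q0 = 0" using u by simp
  from holomorphic_gronwall[OF s(1) this C' dd le]
  obtain \<rho> where \<rho>: "\<rho> > 0" "\<forall>z\<in>ball q0 \<rho>. u1 z - u2 z = 0" by blast
  show ?thesis by (rule exI[of _ "min \<rho> r"]) (use \<rho> r in auto)
qed

text \<open>The first curve is a graph over \<open>z\<close>, so \<open>B q0 q1 = 0\<close> would
  force \<open>A q0 q1 = 0\<close> too. If \<open>B2\<close> vanished, the second curve would be a
  graph over \<open>w\<close> with tangent direction \<open>(0, 1)\<close>, and \<open>chain\<close>
  would give \<open>B q0 q1 = 0\<close>. Hence both are graphs over \<open>z\<close> and
  \<open>ode_unique\<close> identifies them.\<close>

lemma common_graph:
  assumes F1: "diff_quot F1 A1 B1" "F1 q0 q1 = 0" "B1 (q0, q1, q0, q1) \<noteq> 0" "\<And>z w. F1 z w = 0 \<Longrightarrow> R z w = 0"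
    and F2: "diff_quot F2 A2 B2" "F2 q0 q1 = 0" "A2 (q0, q1, q0, q1) \<noteq> 0 \<or> B2 (q0, q1, q0, q1) \<noteq> 0"
      "\<And>z w. F2 z w = 0 \<Longrightarrow> R z w = 0"
    and grad: "A q0 q1 \<noteq> 0 \<or> B q0 q1 \<noteq> 0"
  shows "\<exists>r>0. \<exists>u. \<forall>z\<in>ball q0 r. F1 z (u z) = 0 \<and> F2 z (u z) = 0"
proof -
  have ev: "\<forall>\<^sub>F s in nhds q. s \<in> ball q r" if "r > 0" for q :: complex and r
    using that by (intro eventually_nhds_in_open) auto
  obtain r1 u1 where u1: "r1 > 0" "u1 q0 = q1" "\<forall>z\<in>ball q0 r1. F1 z (u1 z) = 0"
    "\<forall>z\<in>ball q0 r1. (u1 has_field_derivative - A1 (z, u1 z, z, u1 z) / B1 (z, u1 z, z, u1 z)) (at z)"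
    using diff_quot_implicit[OF F1(1-3)] by (elim exE conjE) (rule that; assumption)
  have "\<forall>\<^sub>F s in nhds q0. R s (u1 s) = 0"
    using ev[OF u1(1)] by (rule eventually_mono) (use u1 F1 in auto)
  from chain[OF DERIV_ident u1(4)[rule_format] this] have "A q0 q1 + B q0 q1 * (- A1 (q0, q1, q0, q1) / B1 (q0, q1, q0, q1)) = 0"
    using u1 by simp
  then have Bq: "B q0 q1 \<noteq> 0" using grad by auto
  have B2nz: "B2 (q0, q1, q0, q1) \<noteq> 0"
  proof
    assume z: "B2 (q0, q1, q0, q1) = 0"
    let ?A = "\<lambda>x. B2 (fst (snd x), fst x, snd (snd (snd x)), fst (snd (snd x)))"
    let ?B = "\<lambda>x. A2 (fst (snd x), fst x, snd (snd (snd x)), fst (snd (snd x)))"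
    have sw: "diff_quot (\<lambda>w z. F2 z w) ?A ?B" by (rule diff_quot_swap[OF F2(1)])
    have nz: "?B (q1, q0, q1, q0) \<noteq> 0" using F2(3) z by simp
    obtain r v where v: "r > 0" "v q1 = q0" "\<forall>w\<in>ball q1 r. F2 (v w) w = 0"
      "\<forall>w\<in>ball q1 r. (v has_field_derivative - ?A (w, v w, w, v w) / ?B (w, v w, w, v w)) (at w)"
      using diff_quot_implicit[OF sw F2(2) nz] by (elim exE conjE) (rule that; assumption)
    have "\<forall>\<^sub>F s in nhds q1. R (v s) s = 0"
      using ev[OF v(1)] by (rule eventually_mono) (use v F2 in auto)
    from chain[OF v(4)[rule_format] DERIV_ident this] have "B q0 q1 = 0" using v z by simp
    then show False using Bq by simp
  qed
  obtain r2 u2 where u2: "r2 > 0" "u2 q0 = q1" "\<forall>z\<in>ball q0 r2. F2 z (u2 z) = 0"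
    "\<forall>z\<in>ball q0 r2. (u2 has_field_derivative - A2 (z, u2 z, z, u2 z) / B2 (z, u2 z, z, u2 z)) (at z)"
    using diff_quot_implicit[OF F2(1,2) B2nz] by (elim exE conjE) (rule that; assumption)
  define r where "r = min r1 r2"
  have "\<exists>\<rho>>0. \<rho> \<le> r \<and> (\<forall>z\<in>ball q0 \<rho>. u1 z = u2 z)"
  proof (rule ode_unique[OF Bq _ u1(2) u2(2) u1(4)[rule_format] u2(4)[rule_format]])
    show "R z (u1 z) = 0" "R z (u2 z) = 0" if "z \<in> ball q0 r" for z
      using that u1(3) u2(3) F1(4) F2(4) by (auto simp: r_def)
  qed (use u1 u2 in \<open>auto simp: r_def\<close>)
  then obtain \<rho> where \<rho>: "\<rho> > 0" "\<rho> \<le> r" "\<forall>z\<in>ball q0 \<rho>. u1 z = u2 z" by blast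
  show ?thesis
  proof (intro exI[of _ \<rho>] conjI exI[of _ u1] ballI)
    fix z assume z: "z \<in> ball q0 \<rho>"
    then have "z \<in> ball q0 r1" "z \<in> ball q0 r2" using \<rho>(2) by (auto simp: r_def)
    then have F: "F1 z (u1 z) = 0" "F2 z (u2 z) = 0" using u1(3) u2(3) by blast+
    moreover have "u1 z = u2 z" using \<rho>(3) z by blast
    ultimately show "F1 z (u1 z) = 0" "F2 z (u1 z) = 0" by simp_all
  qed (use \<rho> in auto)
qed

end

section \<open>The complex gradient of a real polynomial\<close>

lemma directional_derivative_zero:
  fixes f :: "(nat \<Rightarrow> real) \<Rightarrow> real" and a b :: "complex \<Rightarrow> complex"
  assumes df: "\<And>\<theta> \<theta>' t. (\<forall>i<4. ((\<lambda>s. \<theta> s i) has_real_derivative \<theta>' i) (at t)) \<Longrightarrow>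
      ((\<lambda>s. f (\<theta> s)) has_real_derivative (\<Sum>i<4. df i (\<theta> t) * \<theta>' i)) (at t)"
    and a: "(a has_field_derivative a') (at z)" and b: "(b has_field_derivative b') (at z)"
    and z: "\<forall>\<^sub>F s in nhds z. f (iota (mk (a s) (b s))) = 0"
  shows "df 0 (iota (mk (a z) (b z))) * Re (a' * h) + df 1 (iota (mk (a z) (b z))) * Im (a' * h) +
    df 2 (iota (mk (a z) (b z))) * Re (b' * h) + df 3 (iota (mk (a z) (b z))) * Im (b' * h) = 0"
proof -
  define \<theta> where "\<theta> s = iota (mk (a (z + of_real s * h)) (b (z + of_real s * h)))" for s :: real
  define \<theta>' where "\<theta>' i = (if i = 0 then Re (a' * h) else if i = 1 then Im (a' * h)
    else if i = 2 then Re (b' * h) else Im (b' * h))" for i :: nat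
  have line: "((\<lambda>s. z + of_real s * h) has_vector_derivative h) (at 0)"
    by (auto intro!: derivative_eq_intros has_vector_derivative_real_field simp: has_vector_derivative_def scaleR_conv_of_real)
  have vd: "((\<lambda>s. g (z + of_real s * h)) has_vector_derivative (g' * h)) (at 0)"
    if "(g has_field_derivative g') (at z)" for g :: "complex \<Rightarrow> complex" and g'
    using field_vector_diff_chain_at[OF line, of g g'] that by (simp add: o_def mult.commute)
  have "((\<lambda>s. \<theta> s i) has_real_derivative \<theta>' i) (at 0)" if i: "i < 4" for i
  proof -
    consider "i = 0" | "i = 1" | "i = 2" | "i = 3" using i by linarith
    then show ?thesis
      by cases (use has_field_derivative_Re[OF vd[OF a]] has_field_derivative_Im[OF vd[OF a]]
        has_field_derivative_Re[OF vd[OF b]] has_field_derivative_Im[OF vd[OF b]]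
        in \<open>simp_all add: \<theta>_def \<theta>'_def iota_def mk_def\<close>)
  qed
  then have D: "((\<lambda>s. f (\<theta> s)) has_real_derivative (\<Sum>i<4. df i (\<theta> 0) * \<theta>' i)) (at 0)" using df by blast
  have "isCont (\<lambda>s. z + of_real s * h) (0::real)" by (intro continuous_intros)
  then have "((\<lambda>s::real. z + of_real s * h) \<longlongrightarrow> z) (nhds 0)" by (simp add: tendsto_nhds_iff isCont_def)
  then have "\<forall>\<^sub>F s in nhds 0. f (\<theta> s) = 0" using z unfolding \<theta>_def by (rule eventually_compose_filterlim[rotated])
  then have "((\<lambda>s. f (\<theta> s)) has_real_derivative 0) (at 0)" by (subst DERIV_cong_ev[OF refl _ refl]) auto
  then have "(\<Sum>i<4. df i (\<theta> 0) * \<theta>' i) = 0" using D DERIV_unique by blast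
  moreover have "\<theta> 0 = iota (mk (a z) (b z))" by (simp add: \<theta>_def)
  moreover have "{..<4} = {0, 1, 2, 3::nat}" by auto
  ultimately show ?thesis by (simp add: \<theta>'_def algebra_simps)
qed

lemma iota_mk_bound: "\<bar>iota (mk z w) i\<bar> \<le> K" if "norm z \<le> K" "norm w \<le> K"
proof -
  have "0 \<le> K" using that norm_ge_zero order.trans by blast
  then show ?thesis
    using that abs_Re_le_cmod[of z] abs_Im_le_cmod[of z] abs_Re_le_cmod[of w] abs_Im_le_cmod[of w]
    by (auto simp: iota_def mk_def)
qed

lemma complex_gradient_exists:
  assumes P: "polyfun {..<4} n f"
    and der: "t \<noteq> 0" "((\<lambda>s. f (\<lambda>i. iota (mk q0 q1) i + s * v i)) has_real_derivative t) (at 0)"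
  shows "\<exists>A B. complex_gradient (\<lambda>z w. f (iota (mk z w))) A B \<and> (A q0 q1 \<noteq> 0 \<or> B q0 q1 \<noteq> 0)"
proof -
  obtain df where df0: "(\<forall>i. \<exists>m. polyfun {..<4} m (df i)) \<and>
    (\<forall>\<theta> \<theta>' t. (\<forall>i<4. ((\<lambda>s. \<theta> s i) has_real_derivative \<theta>' i) (at t)) \<longrightarrow>
      ((\<lambda>s. f (\<theta> s)) has_real_derivative (\<Sum>i<4. df i (\<theta> t) * \<theta>' i)) (at t))"
    using polyfun_derivative[OF P] by (elim exE) (rule that, assumption)
  have df: "((\<lambda>s. f (\<theta> s)) has_real_derivative (\<Sum>i<4. df i (\<theta> t) * \<theta>' i)) (at t)"
    if "\<forall>i<4. ((\<lambda>s. \<theta> s i) has_real_derivative \<theta>' i) (at t)" for \<theta> \<theta>' t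
    using df0[THEN conjunct2, rule_format, of \<theta> \<theta>' t] that by blast
  \<comment> \<open>For real functions vanishing along a holomorphic curve, differentiation in the
    direction 1 gives the real part of \<open>A * a' + B * b'\<close>, and in the direction of the
    imaginary unit minus its imaginary part.\<close>
  let ?A = "\<lambda>z w. Complex (df 0 (iota (mk z w))) (- df 1 (iota (mk z w)))"
  let ?B = "\<lambda>z w. Complex (df 2 (iota (mk z w))) (- df 3 (iota (mk z w)))"
  have "complex_gradient (\<lambda>z w. f (iota (mk z w))) ?A ?B"
  proof
    fix a b :: "complex \<Rightarrow> complex" and a' b' z
    assume a: "(a has_field_derivative a') (at z)" and b: "(b has_field_derivative b') (at z)"
      and ev: "\<forall>\<^sub>F s in nhds z. f (iota (mk (a s) (b s))) = 0"
    show "?A (a z) (b z) * a' + ?B (a z) (b z) * b' = 0"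
      using directional_derivative_zero[of f df, OF df a b ev, of 1] directional_derivative_zero[of f df, OF df a b ev, of \<i>]
      by (simp add: complex_eq_iff algebra_simps)
  next
    fix K :: real assume K: "K \<ge> 0"
    have "\<exists>C\<ge>0. \<forall>x y. (\<forall>i<4. \<bar>x i\<bar> \<le> K \<and> \<bar>y i\<bar> \<le> K) \<longrightarrow>
      \<bar>df j x\<bar> \<le> C \<and> \<bar>df j x - df j y\<bar> \<le> C * (\<Sum>i<4. \<bar>x i - y i\<bar>)" for j
      using polyfun_lipschitz[OF _ K, of 4 _ "df j"] df0 by blast
    then obtain c where c: "\<And>j. c j \<ge> 0" "\<And>j x y. (\<forall>i<4. \<bar>x i\<bar> \<le> K \<and> \<bar>y i\<bar> \<le> K) \<Longrightarrow>
      \<bar>df j x - df j y\<bar> \<le> c j * (\<Sum>i<4. \<bar>x i - y i\<bar>)" by metis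
    \<comment> \<open>The factor 2 compares four real differences with two complex norms; summing
      all \<open>c j\<close> serves \<open>A\<close> and \<open>B\<close> at once.\<close>
    define C where "C = 2 * (c 0 + c 1 + c 2 + c 3)"
    have C: "C \<ge> 0" unfolding C_def using c(1) by (simp add: add_nonneg_nonneg)
    have lip: "\<bar>df j (iota (mk z w)) - df j (iota (mk z' w'))\<bar> \<le> 2 * c j * (norm (z - z') + norm (w - w'))"
      if "norm z \<le> K" "norm w \<le> K" "norm z' \<le> K" "norm w' \<le> K" for z w z' w' j
    proof -
      have "(\<Sum>i<4. \<bar>iota (mk z w) i - iota (mk z' w') i\<bar>) =
          \<bar>Re (z - z')\<bar> + \<bar>Im (z - z')\<bar> + \<bar>Re (w - w')\<bar> + \<bar>Im (w - w')\<bar>"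
        by (simp add: lessThan_nat_numeral lessThan_Suc numeral_eq_Suc iota_def mk_def One_nat_def)
      also have "\<dots> \<le> 2 * (norm (z - z') + norm (w - w'))"
      proof -
        have "a + b + c + d \<le> 2 * (k + l)" if "a \<le> k" "b \<le> k" "c \<le> l" "d \<le> l" for a b c d k l :: real
          unfolding distrib_left using that by linarith
        then show ?thesis using abs_Re_le_cmod abs_Im_le_cmod by blast
      qed
      finally have "c j * (\<Sum>i<4. \<bar>iota (mk z w) i - iota (mk z' w') i\<bar>) \<le> c j * (2 * (norm (z - z') + norm (w - w')))"
        using c(1) by (intro mult_left_mono)
      moreover have "\<bar>df j (iota (mk z w)) - df j (iota (mk z' w'))\<bar> \<le> c j * (\<Sum>i<4. \<bar>iota (mk z w) i - iota (mk z' w') i\<bar>)"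
        by (intro c(2) allI impI conjI iota_mk_bound that)
      ultimately show ?thesis by (simp add: mult_ac)
    qed
    have nm: "norm (Complex x y - Complex x' y') \<le> \<bar>x - x'\<bar> + \<bar>y - y'\<bar>" for x y x' y'
      using cmod_le[of "Complex x y - Complex x' y'"] by simp
    show "\<exists>C\<ge>0. \<forall>z w z' w'. norm z \<le> K \<longrightarrow> norm w \<le> K \<longrightarrow> norm z' \<le> K \<longrightarrow> norm w' \<le> K \<longrightarrow>
      norm (?A z w - ?A z' w') \<le> C * (norm (z - z') + norm (w - w')) \<and> norm (?B z w - ?B z' w') \<le> C * (norm (z - z') + norm (w - w'))"
    proof (intro exI[of _ C] conjI allI impI C)
      fix z w z' w' :: complex assume n: "norm z \<le> K" "norm w \<le> K" "norm z' \<le> K" "norm w' \<le> K"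
      let ?s = "norm (z - z') + norm (w - w')"
      have s: "c j * ?s \<ge> 0" for j using c(1) by (intro mult_nonneg_nonneg) auto
      have "norm (?A z w - ?A z' w') \<le> 2 * c 0 * ?s + 2 * c 1 * ?s"
        by (rule order.trans[OF nm]) (use lip[OF n, of 0] lip[OF n, of 1] in linarith)
      then show "norm (?A z w - ?A z' w') \<le> C * ?s" using s[of 2] s[of 3] by (simp add: C_def algebra_simps)
      have "norm (?B z w - ?B z' w') \<le> 2 * c 2 * ?s + 2 * c 3 * ?s"
        by (rule order.trans[OF nm]) (use lip[OF n, of 2] lip[OF n, of 3] in linarith)
      then show "norm (?B z w - ?B z' w') \<le> C * ?s" using s[of 0] s[of 1] by (simp add: C_def algebra_simps)
    qed
  qed
  moreover have "?A q0 q1 \<noteq> 0 \<or> ?B q0 q1 \<noteq> 0"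
  proof (rule ccontr)
    assume "\<not> ?thesis"
    then have z: "df i (iota (mk q0 q1)) = 0" if "i \<in> {0,1,2,3}" for i using that by (auto simp: complex_eq_iff)
    have "((\<lambda>s. f (\<lambda>i. iota (mk q0 q1) i + s * v i)) has_real_derivative
        (\<Sum>i<4. df i (\<lambda>i. iota (mk q0 q1) i + 0 * v i) * v i)) (at 0)"
      by (rule df) (auto intro!: derivative_eq_intros)
    moreover have "{..<4} = {0, 1, 2, 3::nat}" by auto
    ultimately have "((\<lambda>s. f (\<lambda>i. iota (mk q0 q1) i + s * v i)) has_real_derivative 0) (at 0)"
      using z by simp
    then show False using der DERIV_unique by blast
  qed
  ultimately show ?thesis by (intro exI[of _ ?A] exI[of _ ?B] conjI)
qed

lemma diff_quot_partials:
  assumes F: "diff_quot (\<lambda>z w. peval f (mk z w)) A B"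
  shows "A (q0, q1, q0, q1) = peval_pdiff 0 f (mk q0 q1)" "B (q0, q1, q0, q1) = peval_pdiff 1 f (mk q0 q1)"
proof -
  have cA: "continuous_on UNIV A" and cB: "continuous_on UNIV B"
    and dq: "\<And>z w z' w'. peval f (mk z w) - peval f (mk z' w') = A (z, w, z', w') * (z - z') + B (z, w, z', w') * (w - w')"
    using F by (auto simp: diff_quot_def)
  have "continuous_on UNIV (\<lambda>z. A (z, q1, q0, q1))" "continuous_on UNIV (\<lambda>w. B (q0, w, q0, q1))"
    by (intro continuous_on_compose2[OF cA] continuous_on_compose2[OF cB] continuous_intros; auto)+
  then have c: "isCont (\<lambda>z. A (z, q1, q0, q1)) q0" "isCont (\<lambda>w. B (q0, w, q0, q1)) q1"
    by (auto simp: continuous_on_eq_continuous_at)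
  have "DERIV (\<lambda>z. peval f (mk z q1)) q0 :> A (q0, q1, q0, q1)"
    unfolding CARAT_DERIV using c(1) dq[of _ q1 q0 q1] by (intro exI[of _ "\<lambda>z. A (z, q1, q0, q1)"]) auto
  moreover have "(mk q0 q1)(0 := z) = mk z q1" "(mk q0 q1)(1 := w) = mk q0 w" for z w by (auto simp: mk_def)
  moreover have "mk q0 q1 0 = q0" "mk q0 q1 1 = q1" by (auto simp: mk_def)
  moreover have "DERIV (\<lambda>w. peval f (mk q0 w)) q1 :> B (q0, q1, q0, q1)"
    unfolding CARAT_DERIV using c(2) dq[of q0 _ q0 q1] by (intro exI[of _ "\<lambda>w. B (q0, w, q0, q1)"]) auto
  ultimately show "A (q0, q1, q0, q1) = peval_pdiff 0 f (mk q0 q1)" "B (q0, q1, q0, q1) = peval_pdiff 1 f (mk q0 q1)"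
    using has_derivative_peval_pdiff[of f "mk q0 q1" 0] has_derivative_peval_pdiff[of f "mk q0 q1" 1]
    by (auto intro: DERIV_unique)
qed

text \<open>If one polynomial did not divide the other, elimination would leave a nonzero polynomial
  in \<open>x j\<close> vanishing on a whole disc. So the two are associated, and local agreement
  becomes global.\<close>

lemma irreducible_zeros_eq:
  fixes f1 f2 :: "complex mpoly"
  assumes f: "irreducible f1" "irreducible f2" "vars f1 \<subseteq> {i, j}" "vars f2 \<subseteq> {i, j}" and ij: "i \<noteq> j" and r: "r > 0"
    and z: "\<And>z. z \<in> ball c r \<Longrightarrow> \<exists>x. x j = z \<and> peval f1 x = 0 \<and> peval f2 x = 0"
  shows "peval f1 y = 0 \<longleftrightarrow> peval f2 y = 0"
proof -
  let ?e = "ev_step j (\<lambda>c (_::nat \<Rightarrow> complex). c)"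
  let ?E = "ev2 i j :: complex poly poly \<Rightarrow> (nat \<Rightarrow> complex) \<Rightarrow> complex"
  have e: "poly_model {j} ?e" using poly_model_step[OF poly_model_const, of j] by simp
  have E: "poly_model {i, j} ?E" by (rule poly_model_ev2[OF ij])
  interpret H: comm_ring_hom "\<lambda>p. ?E p x" for x by (rule poly_modelD(1)[OF E])
  have M: "\<exists>\<Psi>. mpoly_model {i, j} \<Psi> ?E"
    by (rule exI, rule mpoly_model_step[OF mpoly_model_step[OF mpoly_model_const]])
  then obtain \<Psi> where \<Psi>: "mpoly_model {i, j} \<Psi> ?E" by (elim exE)
  obtain p1 where p1: "irreducible p1" "?E p1 = peval f1" using mpoly_irreducible_model[OF \<Psi> E f(1,3)] by blast
  obtain p2 where p2: "irreducible p2" "?E p2 = peval f2" using mpoly_irreducible_model[OF \<Psi> E f(2,4)] by blast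
  have dvd: "p dvd q" if p: "irreducible p" and z: "\<And>z. z \<in> ball c r \<Longrightarrow> \<exists>x. x j = z \<and> ?E p x = 0 \<and> ?E q x = 0" for p q
  proof (rule ccontr)
    assume "\<not> p dvd q"
    then obtain s n where s: "polyfun {j} n s" "\<exists>x. s x \<noteq> 0" "\<forall>x. ?E p x = 0 \<longrightarrow> ?E q x = 0 \<longrightarrow> s x = 0"
      using poly_model_eliminate[OF e p, of q i] by blast
    obtain x1 where x1: "s x1 \<noteq> 0" using s(2) by blast
    have "ball c r \<subseteq> {t. s (x1(j := t)) = 0}"
    proof
      fix t assume "t \<in> ball c r"
      then obtain x where x: "x j = t" "?E p x = 0" "?E q x = 0" using z by blast
      have "s (x1(j := t)) = s x" by (rule polyfun_cong_on[OF s(1)]) (use x in auto)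
      then show "t \<in> {t. s (x1(j := t)) = 0}" using s(3) x by simp
    qed
    moreover have "finite {t. s (x1(j := t)) = 0}"
      using polyfun_root_count[OF s(1), of x1 j "x1 j"] x1 by simp
    moreover have "infinite (ball c r)" by (rule uncountable_infinite) (rule uncountable_ball[OF r])
    ultimately show False using finite_subset by blast
  qed
  have "p1 dvd p2" by (rule dvd[OF p1(1)]) (use z p1 p2 in auto)
  moreover have "p2 dvd p1" by (rule dvd[OF p2(1)]) (use z p1 p2 in auto)
  ultimately obtain s t where st: "p2 = p1 * s" "p1 = p2 * t" by (meson dvdE)
  have "?E p2 y = ?E p1 y * ?E s y" by (subst st(1)) (rule H.hom_mult)
  moreover have "?E p1 y = ?E p2 y * ?E t y" by (subst st(2)) (rule H.hom_mult)
  ultimately have "peval f2 y = peval f1 y * ?E s y" "peval f1 y = peval f2 y * ?E t y"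
    unfolding p1(2) p2(2) .
  then show ?thesis by (metis mult_zero_left)
qed

section \<open>Uniqueness of the curve through a point with nonzero gradient\<close>

lemma iota_inj: "q \<in> aff 2 \<Longrightarrow> q' \<in> aff 2 \<Longrightarrow> iota q = iota q' \<Longrightarrow> q = q'"
proof (rule ext)
  fix i assume q: "q \<in> aff 2" "q' \<in> aff 2" "iota q = iota q'"
  have "iota q 0 = iota q' 0" "iota q 1 = iota q' 1" "iota q 2 = iota q' 2" "iota q 3 = iota q' 3" using q by auto
  then have "q 0 = q' 0" "q 1 = q' 1" by (auto simp: iota_def complex_eq_iff)
  then show "q i = q' i" using q by (cases "i < 2") (auto simp: aff_def less_2_cases_iff One_nat_def)
qed

lemma curve_through_regular_point_unique:
  assumes P: "vars P \<subseteq> {..<4}" and der: "t \<noteq> 0" "((\<lambda>s. peval P (\<lambda>i. p i + s * v i)) has_real_derivative t) (at 0)"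
    and g1: "p \<in> iota ` curve_reg \<gamma>1" "iota ` \<gamma>1 \<subseteq> realZ P"
    and g2: "p \<in> iota ` curve_reg \<gamma>2" "iota ` \<gamma>2 \<subseteq> realZ P"
  shows "\<gamma>1 = \<gamma>2"
proof -
  obtain q f1 where f1: "p = iota q" "q \<in> \<gamma>1" "vars f1 \<subseteq> {..<2}" "irreducible f1" "zeros 2 {f1} = \<gamma>1"
    "peval_pdiff 0 f1 q \<noteq> 0 \<or> peval_pdiff 1 f1 q \<noteq> 0" using g1(1) by (auto simp: curve_reg_def)
  obtain q' f2 where f2: "p = iota q'" "q' \<in> \<gamma>2" "vars f2 \<subseteq> {..<2}" "irreducible f2" "zeros 2 {f2} = \<gamma>2"
    "peval_pdiff 0 f2 q' \<noteq> 0 \<or> peval_pdiff 1 f2 q' \<noteq> 0" using g2(1) by (auto simp: curve_reg_def)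
  have qa: "q \<in> aff 2" "q' \<in> aff 2" using f1(2,5) f2(2,5) by (auto simp: zeros_def)
  then have qq: "q' = q" using f1(1) f2(1) iota_inj by metis
  define q0 where "q0 = q 0"
  define q1 where "q1 = q 1"
  have q: "q = mk q0 q1" using qa(1) by (auto simp: mk_def aff_def q0_def q1_def fun_eq_iff)
  have mk2: "mk z w \<in> aff 2" for z w by (auto simp: mk_def aff_def)
  have I2: "{..<2} = {0,1::nat}" by auto
  obtain A1 B1 where dq1: "diff_quot (\<lambda>z w. peval f1 (mk z w)) A1 B1"
    using polyfun_diff_quot polyfun_peval[OF order.refl f1(3)] unfolding I2 by blast
  obtain A2 B2 where dq2: "diff_quot (\<lambda>z w. peval f2 (mk z w)) A2 B2"
    using polyfun_diff_quot polyfun_peval[OF order.refl f2(3)] unfolding I2 by blast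
  have z1: "peval P (iota (mk z w)) = 0" if "peval f1 (mk z w) = 0" for z w
  proof -
    have "mk z w \<in> \<gamma>1" using that mk2 f1(5) by (auto simp: zeros_def)
    then show ?thesis using g1(2) by (auto simp: realZ_def zeros_def)
  qed
  have z2: "peval P (iota (mk z w)) = 0" if "peval f2 (mk z w) = 0" for z w
  proof -
    have "mk z w \<in> \<gamma>2" using that mk2 f2(5) by (auto simp: zeros_def)
    then show ?thesis using g2(2) by (auto simp: realZ_def zeros_def)
  qed
  have v1: "peval f1 (mk q0 q1) = 0" using f1(2,5) q by (auto simp: zeros_def)
  have v2: "peval f2 (mk q0 q1) = 0" using f2(2,5) q qq by (auto simp: zeros_def)
  have AB1: "A1 (q0, q1, q0, q1) \<noteq> 0 \<or> B1 (q0, q1, q0, q1) \<noteq> 0"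
    using f1(6) unfolding diff_quot_partials[OF dq1] q .
  have AB2: "A2 (q0, q1, q0, q1) \<noteq> 0 \<or> B2 (q0, q1, q0, q1) \<noteq> 0"
    using f2(6) unfolding diff_quot_partials[OF dq2] qq q .
  obtain A B where G: "complex_gradient (\<lambda>z w. peval P (iota (mk z w))) A B" and grad: "A q0 q1 \<noteq> 0 \<or> B q0 q1 \<noteq> 0"
    using complex_gradient_exists[OF polyfun_peval[OF order.refl P], of t q0 q1 v] der f1(1) q by auto
  have "peval f1 x = 0 \<longleftrightarrow> peval f2 x = 0" for x
  proof (cases "B1 (q0, q1, q0, q1) = 0")
    case False
    from complex_gradient.common_graph[OF G dq1 v1 this z1 dq2 v2 AB2 z2 grad]
    obtain r u where ru: "r > 0" "\<forall>z\<in>ball q0 r. peval f1 (mk z (u z)) = 0 \<and> peval f2 (mk z (u z)) = 0" by blast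
    show ?thesis
    proof (rule irreducible_zeros_eq[OF f1(4) f2(4), of 1 0 r q0])
      fix z assume "z \<in> ball q0 r"
      then show "\<exists>x. x 0 = z \<and> peval f1 x = 0 \<and> peval f2 x = 0"
        using ru(2) by (intro exI[of _ "mk z (u z)"]) (auto simp: mk_def)
    qed (use f1 f2 I2 ru in auto)
  next
    case True
    \<comment> \<open>Here the first curve is a graph over the second coordinate, so the argument
      runs with the two coordinates exchanged.\<close>
    then have A1: "A1 (q0, q1, q0, q1) \<noteq> 0" using AB1 by simp
    have "\<exists>r>0. \<exists>u. \<forall>w\<in>ball q1 r. peval f1 (mk (u w) w) = 0 \<and> peval f2 (mk (u w) w) = 0"
      by (rule complex_gradient.common_graph[OF complex_gradient_swap[OF G] diff_quot_swap[OF dq1] _ _ _ diff_quot_swap[OF dq2]])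
        (use A1 v1 v2 AB2 z1 z2 grad in auto)
    then obtain r u where ru: "r > 0" "\<forall>w\<in>ball q1 r. peval f1 (mk (u w) w) = 0 \<and> peval f2 (mk (u w) w) = 0" by blast
    show ?thesis
    proof (rule irreducible_zeros_eq[OF f1(4) f2(4), of 0 1 r q1])
      fix w assume "w \<in> ball q1 r"
      then show "\<exists>x. x 1 = w \<and> peval f1 x = 0 \<and> peval f2 x = 0"
        using ru(2) by (intro exI[of _ "mk (u w) w"]) (auto simp: mk_def)
    qed (use f1 f2 I2 ru in auto)
  qed
  then show ?thesis using f1(5) f2(5) by (auto simp: zeros_def)
qed

section \<open>Zariski geometry of the exceptional surface\<close>

lemma vars_add: "vars (p + q) \<subseteq> vars p \<union> vars q"
  using Poly_Mapping.keys_add[of p q] unfolding vars_def by blast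

lemma vars_mult: "vars (p * q) \<subseteq> vars p \<union> vars (q :: 'a::comm_ring_1 mpoly)"
proof
  fix i assume "i \<in> vars (p * q)"
  then obtain m where m: "m \<in> Poly_Mapping.keys (p * q)" "i \<in> Poly_Mapping.keys m" by (auto simp: vars_def)
  obtain a b where ab: "m = a + b" "a \<in> Poly_Mapping.keys p" "b \<in> Poly_Mapping.keys q"
    using keys_mult[of p q] m(1) by blast
  have "i \<in> Poly_Mapping.keys a \<or> i \<in> Poly_Mapping.keys b"
    using m(2) Poly_Mapping.keys_add[of a b] ab(1) by blast
  then show "i \<in> vars p \<union> vars q" using ab by (auto simp: vars_def)
qed

lemma polyfun_imp_peval:
  assumes "polyfun I n f" shows "\<exists>p. vars p \<subseteq> I \<and> peval p = f"
  using assms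
proof (induction rule: polyfun.induct)
  case (const n c)
  have "vars (Poly_Mapping.single 0 c) \<subseteq> I" "peval (Poly_Mapping.single 0 c) = (\<lambda>_. c)"
    by (auto simp: vars_def peval_single mono_eval_def)
  then show ?case by blast
next
  case (var i n)
  have "vars (mpoly_var i :: 'a mpoly) \<subseteq> I" "peval (mpoly_var i :: 'a mpoly) = (\<lambda>x. x i)"
    using var by (auto simp: vars_def mpoly_var_def peval_var[unfolded mpoly_var_def] split: if_splits)
  then show ?case by blast
next
  case (add n f g)
  then obtain p q where pq: "vars p \<subseteq> I" "peval p = f" "vars q \<subseteq> I" "peval q = g" by blast
  then have "vars (p + q) \<subseteq> I" "peval (p + q) = (\<lambda>x. f x + g x)"
    using vars_add[of p q] by (auto simp: peval_add)
  then show ?case by blast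
next
  case (mult n f m g)
  then obtain p q where pq: "vars p \<subseteq> I" "peval p = f" "vars q \<subseteq> I" "peval q = g" by blast
  then have "vars (p * q) \<subseteq> I" "peval (p * q) = (\<lambda>x. f x * g x)"
    using vars_mult[of p q] by (auto simp: peval_mult)
  then show ?case by blast
qed

lemma zclosed_iff_pclosed: "zclosed 4 V \<longleftrightarrow> pclosed V"
proof
  assume "zclosed 4 V"
  then obtain F where F: "\<forall>f\<in>F. vars f \<subseteq> {..<4}" "V = zeros 4 F" by (auto simp: zclosed_def)
  show "pclosed V" unfolding pclosed_def
  proof (intro conjI ballI)
    show "V \<subseteq> aff 4" using F by (auto simp: zeros_def)
    fix x assume "x \<in> aff 4 - V"
    then obtain f where f: "f \<in> F" "peval f x \<noteq> 0" using F by (auto simp: zeros_def)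
    then have "pf4 (peval f)" using F(1) unfolding pf4_def by (blast intro: polyfun_peval)
    moreover have "\<forall>v\<in>V. peval f v = 0" using F f by (auto simp: zeros_def)
    ultimately show "\<exists>g. pf4 g \<and> (\<forall>v\<in>V. g v = 0) \<and> g x \<noteq> 0" using f(2) by blast
  qed
next
  assume V: "pclosed V"
  define F where "F = {f. vars f \<subseteq> {..<4} \<and> (\<forall>v\<in>V. peval f v = 0)}"
  have "V = zeros 4 F"
  proof (intro equalityI subsetI)
    fix x assume "x \<in> V"
    then show "x \<in> zeros 4 F" using V by (auto simp: zeros_def F_def pclosed_def)
  next
    fix x assume x: "x \<in> zeros 4 F"
    show "x \<in> V"
    proof (rule ccontr)
      assume "x \<notin> V"
      moreover have "x \<in> aff 4" using x by (simp add: zeros_def)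
      ultimately obtain g where g: "pf4 g" "\<forall>v\<in>V. g v = 0" "g x \<noteq> 0" using V unfolding pclosed_def by blast
      then obtain f where "vars f \<subseteq> {..<4}" "peval f = g" using polyfun_imp_peval unfolding pf4_def by blast
      then show False using x g by (auto simp: zeros_def F_def)
    qed
  qed
  then show "zclosed 4 V" unfolding zclosed_def by (intro exI[of _ F]) (auto simp: F_def)
qed

lemma pclosed_Int_zeros:
  assumes "pclosed V" "pf4 g" shows "pclosed {x \<in> V. g x = 0}"
  unfolding pclosed_def
proof (intro conjI ballI)
  show "{x \<in> V. g x = 0} \<subseteq> aff 4" using assms by (auto simp: pclosed_def)
  fix x assume x: "x \<in> aff 4 - {x \<in> V. g x = 0}"
  show "\<exists>h. pf4 h \<and> (\<forall>v\<in>{x \<in> V. g x = 0}. h v = 0) \<and> h x \<noteq> 0"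
  proof (cases "x \<in> V")
    case True
    then show ?thesis using x assms by (intro exI[of _ g]) auto
  next
    case False
    then show ?thesis using x assms(1) unfolding pclosed_def by blast
  qed
qed

text \<open>A product vanishing on \<open>V\<close> covers \<open>V\<close> by two closed zero sets.
  Conversely, functions separating points of \<open>V\<close> from two proper closed parts have a
  product that vanishes on their union.\<close>

lemma zirred_iff_pprime: "zirred 4 V \<longleftrightarrow> pclosed V \<and> pprime V"
proof
  assume V: "zirred 4 V"
  then have c: "pclosed V" by (simp add: zirred_def zclosed_iff_pclosed)
  have "pprime V" unfolding pprime_def
  proof (intro conjI allI impI)
    show "V \<noteq> {}" using V by (simp add: zirred_def)
    fix g h assume gh: "pf4 g" "pf4 h" "\<forall>v\<in>V. g v * h v = 0"
    have "V = {x \<in> V. g x = 0} \<union> {x \<in> V. h x = 0}" using gh(3) by auto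
    moreover have "zclosed 4 {x \<in> V. g x = 0}" "zclosed 4 {x \<in> V. h x = 0}"
      unfolding zclosed_iff_pclosed using c gh by (auto intro: pclosed_Int_zeros)
    ultimately have "V = {x \<in> V. g x = 0} \<or> V = {x \<in> V. h x = 0}" using V unfolding zirred_def by blast
    then show "(\<forall>v\<in>V. g v = 0) \<or> (\<forall>v\<in>V. h v = 0)" by blast
  qed
  then show "pclosed V \<and> pprime V" using c by simp
next
  assume V: "pclosed V \<and> pprime V"
  show "zirred 4 V" unfolding zirred_def zclosed_iff_pclosed
  proof (intro conjI allI impI)
    show "pclosed V" "V \<noteq> {}" using V by (auto simp: pprime_def)
    fix A B assume AB: "pclosed A \<and> pclosed B \<and> V = A \<union> B"
    show "V = A \<or> V = B"
    proof (rule ccontr)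
      assume "\<not> ?thesis"
      then obtain x y where xy: "x \<in> V" "x \<notin> A" "y \<in> V" "y \<notin> B" using AB by blast
      have V4: "V \<subseteq> aff 4" using V by (simp add: pclosed_def)
      obtain g where g: "pf4 g" "\<forall>v\<in>A. g v = 0" "g x \<noteq> 0" using AB xy V4 unfolding pclosed_def by blast
      obtain h where h: "pf4 h" "\<forall>v\<in>B. h v = 0" "h y \<noteq> 0" using AB xy V4 unfolding pclosed_def by blast
      have "(\<forall>v\<in>V. g v = 0) \<or> (\<forall>v\<in>V. h v = 0)"
        by (rule pprimeD[OF _ g(1) h(1)]) (use V AB g h in auto)
      then show False using g h xy by blast
    qed
  qed
qed

section \<open>Transport along linear coordinate changes\<close>

locale coordinate_change =
  fixes \<kappa> \<kappa>' :: "(nat \<Rightarrow> complex) \<Rightarrow> nat \<Rightarrow> complex"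
  assumes inv: "\<And>x. \<kappa> (\<kappa>' x) = x" "\<And>x. \<kappa>' (\<kappa> x) = x"
    and lin: "\<And>g n. polyfun {..<4} n g \<Longrightarrow> polyfun {..<4} n (\<lambda>x. g (\<kappa> x))"
      "\<And>g n. polyfun {..<4} n g \<Longrightarrow> polyfun {..<4} n (\<lambda>x. g (\<kappa>' x))"
    and aff: "\<And>x. x \<in> aff 4 \<Longrightarrow> \<kappa> x \<in> aff 4" "\<And>x. x \<in> aff 4 \<Longrightarrow> \<kappa>' x \<in> aff 4"
begin

lemma swap: "coordinate_change \<kappa>' \<kappa>"
  by unfold_locales (use inv lin aff in auto)

lemma pclosed_image:
  assumes "pclosed V" shows "pclosed (\<kappa> ` V)"
  unfolding pclosed_def
proof (intro conjI ballI)
  show "\<kappa> ` V \<subseteq> aff 4" using assms aff by (auto simp: pclosed_def)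
  fix x assume x: "x \<in> aff 4 - \<kappa> ` V"
  then have "\<kappa>' x \<in> aff 4 - V" using aff(2)[of x] inv(1)[of x] by (metis Diff_iff image_eqI)
  then obtain g where g: "pf4 g" "\<forall>v\<in>V. g v = 0" "g (\<kappa>' x) \<noteq> 0" using assms unfolding pclosed_def by blast
  have "pf4 (\<lambda>x. g (\<kappa>' x))" using g(1) lin unfolding pf4_def by blast
  then show "\<exists>g. pf4 g \<and> (\<forall>v\<in>\<kappa> ` V. g v = 0) \<and> g x \<noteq> 0"
    using g inv by (intro exI[of _ "\<lambda>x. g (\<kappa>' x)"]) auto
qed

lemma pprime_image:
  assumes "pprime V" shows "pprime (\<kappa> ` V)"
  unfolding pprime_def
proof (intro conjI allI impI)
  show "\<kappa> ` V \<noteq> {}" using assms by (auto simp: pprime_def)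
  fix g h assume gh: "pf4 g" "pf4 h" "\<forall>v\<in>\<kappa> ` V. g v * h v = 0"
  have "pf4 (\<lambda>x. g (\<kappa> x))" "pf4 (\<lambda>x. h (\<kappa> x))" using gh lin unfolding pf4_def by blast+
  from pprimeD[OF assms this] show "(\<forall>v\<in>\<kappa> ` V. g v = 0) \<or> (\<forall>v\<in>\<kappa> ` V. h v = 0)" using gh(3) by auto
qed

end

text \<open>Otherwise each \<open>V i\<close> has a function vanishing on it but not on all of
  \<open>W\<close>; by primality the product does not vanish on \<open>W\<close>, although it
  vanishes on the whole union.\<close>

lemma prime_subset_union:
  assumes W: "pprime W" "W \<subseteq> aff 4" "W \<subseteq> (\<Union>i<m. V i)" and V: "\<And>i. i < (m::nat) \<Longrightarrow> pclosed (V i)"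
  shows "\<exists>i<m. W \<subseteq> V i"
proof (rule ccontr)
  assume no: "\<not> ?thesis"
  have "\<forall>i\<in>{..<m}. \<exists>g. pf4 g \<and> (\<forall>v\<in>V i. g v = 0) \<and> (\<exists>w\<in>W. g w \<noteq> 0)"
  proof
    fix i assume i: "i \<in> {..<m}"
    then obtain w where w: "w \<in> W" "w \<notin> V i" using no by blast
    then have "w \<in> aff 4 - V i" using W by blast
    then show "\<exists>g. pf4 g \<and> (\<forall>v\<in>V i. g v = 0) \<and> (\<exists>w\<in>W. g w \<noteq> 0)"
      using V[of i] i w unfolding pclosed_def by blast
  qed
  from bchoice[OF this] obtain g where g: "\<forall>i\<in>{..<m}. pf4 (g i) \<and> (\<forall>v\<in>V i. g i v = 0) \<and> (\<exists>w\<in>W. g i w \<noteq> 0)" by blast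
  have "pf4 (\<lambda>x. \<Prod>i<k. g i x) \<and> (\<exists>w\<in>W. (\<Prod>i<k. g i w) \<noteq> 0)" if "k \<le> m" for k
    using that
  proof (induction k)
    case 0
    then show ?case using W(1) by (auto simp: pprime_def intro: pf4_const)
  next
    case (Suc k)
    then have k: "k < m" and IH: "pf4 (\<lambda>x. \<Prod>i<k. g i x)" "\<exists>w\<in>W. (\<Prod>i<k. g i w) \<noteq> 0" by auto
    have gk: "pf4 (g k)" "\<exists>w\<in>W. g k w \<noteq> 0" using g k by auto
    have "\<exists>w\<in>W. (\<Prod>i<k. g i w) * g k w \<noteq> 0"
      using pprimeD[OF W(1) IH(1) gk(1)] IH(2) gk(2) by blast
    then show ?case using pf4_mult[OF IH(1) gk(1)] by (simp add: mult.commute)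
  qed
  then obtain w where w: "w \<in> W" "(\<Prod>i<m. g i w) \<noteq> 0" by blast
  then obtain i where "i < m" "w \<in> V i" using W(3) by blast
  then show False using g w by auto
qed

lemma zdim_le_2:
  assumes "\<And>c :: nat \<Rightarrow> (nat \<Rightarrow> complex) set. (\<And>i. i \<le> 3 \<Longrightarrow> zirred 4 (c i) \<and> c i \<subseteq> V) \<Longrightarrow> (\<And>i. i < 3 \<Longrightarrow> c i \<subset> c (Suc i)) \<Longrightarrow> False"
  shows "zdim 4 V \<le> 2"
  unfolding zdim_def
proof (rule Sup_least, clarify)
  fix k and c :: "nat \<Rightarrow> (nat \<Rightarrow> complex) set"
  assume c: "\<forall>i\<le>k. zirred 4 (c i) \<and> c i \<subseteq> V" "\<forall>i<k. c i \<subset> c (Suc i)"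
  have "k \<le> 2"
  proof (rule ccontr)
    assume "\<not> k \<le> 2"
    then show False using assms[of c] c by auto
  qed
  then have "enat k \<le> enat 2" by simp
  then show "enat k \<le> 2" by (simp add: numeral_eq_enat)
qed

locale triangular_image = triangular + coordinate_change
begin

lemma zdim_image: assumes "V \<subseteq> \<kappa> ` Y" shows "zdim 4 V \<le> 2"
proof (rule zdim_le_2)
  fix c :: "nat \<Rightarrow> (nat \<Rightarrow> complex) set"
  assume c: "\<And>i. i \<le> 3 \<Longrightarrow> zirred 4 (c i) \<and> c i \<subseteq> V" "\<And>i. i < 3 \<Longrightarrow> c i \<subset> c (Suc i)"
  interpret s: coordinate_change \<kappa>' \<kappa> by (rule swap)
  show False
  proof (rule no_long_chain[of "\<lambda>i. \<kappa>' ` c i"])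
    fix i :: nat assume "i \<le> 3"
    then have "pclosed (c i)" "pprime (c i)" "c i \<subseteq> \<kappa> ` Y" using c(1)[of i] assms by (auto simp: zirred_iff_pprime)
    then show "pclosed (\<kappa>' ` c i) \<and> pprime (\<kappa>' ` c i) \<and> \<kappa>' ` c i \<subseteq> Y"
      using s.pclosed_image s.pprime_image inv by auto
  next
    fix i :: nat assume "i < 3"
    have "inj \<kappa>'" by (metis inv(1) injI)
    then show "\<kappa>' ` c i \<subset> \<kappa>' ` c (Suc i)" using c(2)[OF \<open>i < 3\<close>] by (simp add: inj_image_subset_iff psubset_eq inj_image_eq_iff)
  qed
qed

lemma zdeg_irr_image:
  assumes W: "pclosed W" "pprime W" "dominant W" "W \<subseteq> Y"
  shows "zdeg_irr 4 (\<kappa> ` W) \<le> nbound (nbound (nbound (b + 1))) * nbound (nbound (b + 1)) * (b * b)" (is "_ \<le> ?B")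
proof -
  define k where "k = the_enat (zdim 4 (\<kappa> ` W))"
  have "zdim 4 (\<kappa> ` W) \<le> 2" using W by (intro zdim_image image_mono)
  then have k: "k \<le> 2" unfolding k_def by (cases "zdim 4 (\<kappa> ` W)") (auto simp: numeral_eq_enat)
  define X where "X = {card (\<kappa> ` W \<inter> L) | L. \<exists>(a :: nat \<Rightarrow> nat \<Rightarrow> complex) (b :: nat \<Rightarrow> complex).
      L = {x \<in> aff 4. \<forall>j < k. (\<Sum>i<4. a j i * x i) = b j} \<and> finite (\<kappa> ` W \<inter> L)}"
  have bound: "n \<le> ?B" if nX: "n \<in> X" for n
  proof -
    obtain L and a :: "nat \<Rightarrow> nat \<Rightarrow> complex" and c :: "nat \<Rightarrow> complex" where
      L: "n = card (\<kappa> ` W \<inter> L)" "L = {x \<in> aff 4. \<forall>j < k. (\<Sum>i<4. a j i * x i) = c j}" "finite (\<kappa> ` W \<inter> L)"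
      using nX unfolding X_def by blast
    \<comment> \<open>The number \<open>k\<close> of linear equations may be less than 2; missing
      equations are padded with the zero form, so that a section is always described by two
      forms.\<close>
    define m where "m j x = (if j < k then (\<Sum>i<4. a j i * x i) - c j else 0)" for j and x :: "nat \<Rightarrow> complex"
    have m: "polyfun {..<4} 1 (m j)" for j
    proof (cases "j < k")
      case True
      have "polyfun {..<4} 1 (\<lambda>x. (\<Sum>i<4. a j i * x i) - c j)"
        by (intro polyfun_diff polyfun_sum polyfun_cmult polyfun_var polyfun.const) auto
      then show ?thesis using True by (simp add: m_def[abs_def])
    qed (simp add: m_def[abs_def] polyfun.const)
    define S where "S = {w \<in> W. m 0 (\<kappa> w) = 0 \<and> m 1 (\<kappa> w) = 0}"
    have eqS: "\<kappa> ` W \<inter> L = \<kappa> ` S"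
    proof -
      have "\<kappa> w \<in> L \<longleftrightarrow> m 0 (\<kappa> w) = 0 \<and> m 1 (\<kappa> w) = 0" if "w \<in> W" for w
      proof -
        have "\<kappa> w \<in> aff 4" using W(1) that aff by (auto simp: pclosed_def)
        then have "\<kappa> w \<in> L \<longleftrightarrow> (\<forall>j<k. m j (\<kappa> w) = 0)" by (auto simp: L(2) m_def)
        also have "\<dots> \<longleftrightarrow> m 0 (\<kappa> w) = 0 \<and> m 1 (\<kappa> w) = 0"
        proof
          assume "\<forall>j<k. m j (\<kappa> w) = 0"
          then have "m j (\<kappa> w) = 0" for j by (cases "j < k") (auto simp: m_def)
          then show "m 0 (\<kappa> w) = 0 \<and> m 1 (\<kappa> w) = 0" by simp
        next
          assume *: "m 0 (\<kappa> w) = 0 \<and> m 1 (\<kappa> w) = 0"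
          show "\<forall>j<k. m j (\<kappa> w) = 0"
          proof (intro allI impI)
            fix j assume "j < k"
            then have "j = 0 \<or> j = 1" using k by linarith
            then show "m j (\<kappa> w) = 0" using * by auto
          qed
        qed
        finally show ?thesis .
      qed
      then show ?thesis by (auto simp: S_def)
    qed
    have "inj \<kappa>" by (metis inv(2) injI)
    then have inj: "inj_on \<kappa> S" by (rule inj_on_subset) simp
    have "finite S" using L(3) inj unfolding eqS by (rule finite_imageD)
    have n: "n = card S" using L(1) card_image[OF inj] unfolding eqS by simp
    show "n \<le> ?B"
      unfolding n S_def by (rule finite_section_card[OF W lin(1)[OF m] lin(1)[OF m]]) (use \<open>finite S\<close> in \<open>simp add: S_def\<close>)
  qed
  have "zdeg_irr 4 (\<kappa> ` W) = Sup X" by (simp add: zdeg_irr_def X_def k_def)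
  also have "\<dots> \<le> ?B"
  \<comment> \<open>The supremum of the empty set of naturals is 0.\<close>
  proof (cases "X = {}")
    case False
    then show ?thesis using bound by (intro cSup_least) auto
  qed simp
  finally show ?thesis .
qed

text \<open>A component of the image is contained in some image of a \<open>W i\<close>, and by
  maximality equal to it. There are at most \<open>b * b\<close> such sets, and dominance of each
  \<open>W i\<close> gives the degree bound.\<close>

lemma zdeg_image: "zdeg 4 (\<kappa> ` Y) \<le> b * b * (nbound (nbound (nbound (b + 1))) * nbound (nbound (b + 1)) * (b * b))" (is "_ \<le> _ * ?B")
proof -
  obtain m W where mW: "m \<le> b * b" "Y = (\<Union>i<m. W i)" "\<forall>i<m. pclosed (W i) \<and> pprime (W i) \<and> dominant (W i)"
    using decomposition by blast
  have sub: "zcomponents 4 (\<kappa> ` Y) \<subseteq> (\<lambda>i. \<kappa> ` W i) ` {..<m}"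
  proof
    fix V assume V: "V \<in> zcomponents 4 (\<kappa> ` Y)"
    then have V1: "pclosed V" "pprime V" "V \<subseteq> \<kappa> ` Y" by (auto simp: zcomponents_def zirred_iff_pprime)
    have "V \<subseteq> aff 4" using V1(1) by (simp add: pclosed_def)
    moreover have "V \<subseteq> (\<Union>i<m. \<kappa> ` W i)" using V1(3) unfolding mW(2) by (simp add: image_UN)
    ultimately have "\<exists>i<m. V \<subseteq> \<kappa> ` W i"
      by (rule prime_subset_union[OF V1(2)]) (use mW(3) pclosed_image in blast)
    then obtain i where i: "i < m" "V \<subseteq> \<kappa> ` W i" by blast
    have "zirred 4 (\<kappa> ` W i)" "\<kappa> ` W i \<subseteq> \<kappa> ` Y"
      using mW i pclosed_image pprime_image by (auto simp: zirred_iff_pprime)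
    then have "\<kappa> ` W i = V" using V i unfolding zcomponents_def by blast
    then show "V \<in> (\<lambda>i. \<kappa> ` W i) ` {..<m}" using i by blast
  qed
  have "zdeg 4 (\<kappa> ` Y) \<le> (\<Sum>V\<in>(\<lambda>i. \<kappa> ` W i) ` {..<m}. zdeg_irr 4 V)"
    unfolding zdeg_def by (rule sum_mono2) (use sub in auto)
  also have "\<dots> \<le> card ((\<lambda>i. \<kappa> ` W i) ` {..<m}) * ?B"
  proof -
    have "zdeg_irr 4 V \<le> ?B" if V: "V \<in> (\<lambda>i. \<kappa> ` W i) ` {..<m}" for V
    proof -
      obtain i where i: "i < m" "V = \<kappa> ` W i" using V by blast
      have "W i \<subseteq> Y" using mW(2) i(1) by blast
      then show ?thesis unfolding i(2) using mW(3) i(1) by (intro zdeg_irr_image) auto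
    qed
    then show ?thesis using sum_bounded_above[of "(\<lambda>i. \<kappa> ` W i) ` {..<m}" "zdeg_irr 4" ?B] by simp
  qed
  also have "card ((\<lambda>i. \<kappa> ` W i) ` {..<m}) \<le> b * b"
    using card_image_le[of "{..<m}" "\<lambda>i. \<kappa> ` W i"] mW(1) by simp
  finally show ?thesis by simp
qed

end

theorem theorem3p3:
  fixes D :: nat
  shows "\<exists>C :: nat. \<forall>P :: real mpoly.
    vars P \<subseteq> {..<4} \<and> irreducible P \<and> tdeg P \<le> D \<longrightarrow>
    (\<exists>Y :: (nat \<Rightarrow> complex) set. zclosed 4 Y \<and> zdim 4 Y \<le> 2 \<and> zdeg 4 Y \<le> C \<and>
       (\<forall>p \<in> realZ P - real_points Y. \<forall>\<gamma>1 \<gamma>2.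
          plane_curve \<gamma>1 \<and> p \<in> iota ` curve_reg \<gamma>1 \<and> iota ` \<gamma>1 \<subseteq> realZ P \<and>
          plane_curve \<gamma>2 \<and> p \<in> iota ` curve_reg \<gamma>2 \<and> iota ` \<gamma>2 \<subseteq> realZ P
          \<longrightarrow> \<gamma>1 = \<gamma>2))"
proof -
  \<comment> \<open>Dominates both \<open>D\<close>, for the first monic equation, and
    \<open>2 * D * D\<close>, for the discriminant.\<close>
  define b where "b = D + 2 * D * D"
  define C where "C = b * b * (nbound (nbound (nbound (b + 1))) * nbound (nbound (b + 1)) * (b * b))"
  show ?thesis
  proof (intro exI[of _ C] allI impI)
    fix P :: "real mpoly" assume P: "vars P \<subseteq> {..<4} \<and> irreducible P \<and> tdeg P \<le> D"
    then have PP: "irreducible P" "vars P \<subseteq> {..<4}" "tdeg P \<le> D" by auto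
    obtain a1 a2 :: "nat \<Rightarrow> real" and d1 d2 G1 G2 where T:
      "a1 3 = 0 \<and> (\<forall>j\<ge>4. a1 j = 0) \<and> (\<forall>j\<ge>2. a2 j = 0) \<and> d1 \<le> D \<and> d2 \<le> 2 * D * D \<and>
    (\<forall>k. polyfun {0,1,2} D (G1 k)) \<and> (\<forall>k. polyfun {0,1} (2 * D * D) (G2 k)) \<and>
    (\<forall>x y. y = shear 3 a1 (shear 2 a2 x) \<longrightarrow> peval P y = 0 \<longrightarrow>
       (monic_fun 3 d1 G1 (\<lambda>i. complex_of_real (x i)) = 0 \<and> monic_fun 2 d2 G2 (\<lambda>i. complex_of_real (x i)) = 0) \<or>
       (\<exists>v t. t \<noteq> 0 \<and> ((\<lambda>s. peval P (\<lambda>i. y i + s * v i)) has_real_derivative t) (at 0)))"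
      using triangular_system_real[OF PP] by (elim exE) (rule that, assumption)
    then have a1: "a1 3 = 0" "\<forall>j\<ge>4. a1 j = 0" and a2: "\<forall>j\<ge>2. a2 j = 0" and d: "d1 \<le> D" "d2 \<le> 2 * D * D"
      and G: "\<forall>k. polyfun {0,1,2} D (G1 k)" "\<forall>k. polyfun {0,1} (2 * D * D) (G2 k)"
      by - (elim conjE; assumption)+
    have main: "(monic_fun 3 d1 G1 (\<lambda>i. complex_of_real (x i)) = 0 \<and> monic_fun 2 d2 G2 (\<lambda>i. complex_of_real (x i)) = 0) \<or>
       (\<exists>v t. t \<noteq> 0 \<and> ((\<lambda>s. peval P (\<lambda>i. y i + s * v i)) has_real_derivative t) (at 0))"
      if "y = shear 3 a1 (shear 2 a2 x)" "peval P y = 0" for x y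
      using T that by (elim conjE) (drule spec[of _ x], drule spec[of _ y], drule mp, assumption, drule mp, assumption, assumption)
    define c1 where "c1 j = complex_of_real (a1 j)" for j
    define c2 where "c2 j = complex_of_real (a2 j)" for j
    have c1: "c1 3 = 0" "\<forall>j\<ge>4. c1 j = 0" and c2: "\<forall>j\<ge>2. c2 j = 0" using a1 a2 by (auto simp: c1_def c2_def)
    define \<kappa> where "\<kappa> x = shear 3 c1 (shear 2 c2 x)" for x
    define \<kappa>' where "\<kappa>' x = shear 2 (\<lambda>j. - c2 j) (shear 3 (\<lambda>j. - c1 j) x)" for x
    interpret triangular_image d1 d2 b G1 G2 \<kappa> \<kappa>'
    proof
      show "polyfun {0,1,2} b (G1 k)" for k by (rule polyfun_mono[OF G(1)[rule_format]]) (auto simp: b_def)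
      show "polyfun {0,1} b (G2 k)" for k by (rule polyfun_mono[OF G(2)[rule_format]]) (auto simp: b_def)
      show "d1 \<le> b" "d2 \<le> b" using d by (auto simp: b_def)
      show "\<kappa> (\<kappa>' x) = x" "\<kappa>' (\<kappa> x) = x" for x
        unfolding \<kappa>_def \<kappa>'_def using c1 c2 by (simp_all add: shear_inverse)
      show "polyfun {..<4} n (\<lambda>x. g (\<kappa> x))" if "polyfun {..<4} n g" for g n
        unfolding \<kappa>_def by (rule polyfun_shear[OF polyfun_shear[OF that]]) auto
      show "polyfun {..<4} n (\<lambda>x. g (\<kappa>' x))" if "polyfun {..<4} n g" for g n
        unfolding \<kappa>'_def by (rule polyfun_shear[OF polyfun_shear[OF that]]) auto
      show "\<kappa> x \<in> aff 4" "\<kappa>' x \<in> aff 4" if "x \<in> aff 4" for x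
        using that c1 c2 by (auto simp: \<kappa>_def \<kappa>'_def shear_def aff_def)
    qed
    show "\<exists>Y. zclosed 4 Y \<and> zdim 4 Y \<le> 2 \<and> zdeg 4 Y \<le> C \<and>
       (\<forall>p \<in> realZ P - real_points Y. \<forall>\<gamma>1 \<gamma>2.
          plane_curve \<gamma>1 \<and> p \<in> iota ` curve_reg \<gamma>1 \<and> iota ` \<gamma>1 \<subseteq> realZ P \<and>
          plane_curve \<gamma>2 \<and> p \<in> iota ` curve_reg \<gamma>2 \<and> iota ` \<gamma>2 \<subseteq> realZ P
          \<longrightarrow> \<gamma>1 = \<gamma>2)"
    proof (intro exI[of _ "\<kappa> ` Y"] conjI ballI allI impI)
      show "zclosed 4 (\<kappa> ` Y)" unfolding zclosed_iff_pclosed by (rule pclosed_image[OF Y_pclosed])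
      show "zdim 4 (\<kappa> ` Y) \<le> 2" by (rule zdim_image) simp
      show "zdeg 4 (\<kappa> ` Y) \<le> C" unfolding C_def by (rule zdeg_image)
      fix p \<gamma>1 \<gamma>2
      assume p: "p \<in> realZ P - real_points (\<kappa> ` Y)"
        and \<gamma>: "plane_curve \<gamma>1 \<and> p \<in> iota ` curve_reg \<gamma>1 \<and> iota ` \<gamma>1 \<subseteq> realZ P \<and>
          plane_curve \<gamma>2 \<and> p \<in> iota ` curve_reg \<gamma>2 \<and> iota ` \<gamma>2 \<subseteq> realZ P"
      define x where "x = shear 2 (\<lambda>j. - a2 j) (shear 3 (\<lambda>j. - a1 j) p)"
      have px: "p = shear 3 a1 (shear 2 a2 x)" unfolding x_def using a1 a2 by (simp add: shear_inverse)
      have p4: "p \<in> aff 4" "peval P p = 0" using p by (auto simp: realZ_def zeros_def)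
      have x4: "x \<in> aff 4" using p4(1) a1 a2 by (auto simp: x_def shear_def aff_def)
      \<comment> \<open>The complex shears have the real coefficients of \<open>a1\<close> and
        \<open>a2\<close>, so they send the complexification of \<open>x\<close> to that of
        \<open>p\<close>. A real solution of the triangular system thus becomes a real point of the
        exceptional surface.\<close>
      have kx: "\<kappa> (\<lambda>i. complex_of_real (x i)) = (\<lambda>i. complex_of_real (p i))"
        unfolding px \<kappa>_def by (auto simp: shear_def c1_def c2_def)
      have nz: "\<not> (monic_fun 3 d1 G1 (\<lambda>i. complex_of_real (x i)) = 0 \<and> monic_fun 2 d2 G2 (\<lambda>i. complex_of_real (x i)) = 0)"
      proof
        assume "monic_fun 3 d1 G1 (\<lambda>i. complex_of_real (x i)) = 0 \<and> monic_fun 2 d2 G2 (\<lambda>i. complex_of_real (x i)) = 0"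
        then have "(\<lambda>i. complex_of_real (x i)) \<in> Y" using x4 by (auto simp: Y_def aff_def)
        then have "p \<in> real_points (\<kappa> ` Y)" using p4(1) kx by (force simp: real_points_def)
        then show False using p by simp
      qed
      have "\<exists>v t. t \<noteq> 0 \<and> ((\<lambda>s. peval P (\<lambda>i. p i + s * v i)) has_real_derivative t) (at 0)"
        using main[OF px p4(2)] by (rule disjE) (erule notE[OF nz], assumption)
      then obtain v t where vt: "t \<noteq> 0" "((\<lambda>s. peval P (\<lambda>i. p i + s * v i)) has_real_derivative t) (at 0)"
        by (elim exE conjE)
      show "\<gamma>1 = \<gamma>2"
        by (rule curve_through_regular_point_unique[OF PP(2) vt]) (use \<gamma> in auto)
    qed
  qed
qed

end
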